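(* Let $\mathcal{G}$ be a 2-group and $\mathcal{V}\in 2\mathrm{Rep}(\mathcal{G})$. Then the 2-character $\chi_{\mathcal{V}}\colon\mathcal{G}\to\mathrm{Vec}$ together with the conjugation invariance natural isomorphisms $\{\psi_g\}_{g\in\mathcal{G}}$ is an object in $\mathrm{Fun}(\mathcal{G},\mathrm{Vec})^{\mathcal{G}}$.
   Context: $k$ is an algebraically closed field of characteristic $0$ and $\mathrm{Vec}$ is the category of finite-dimensional $k$-vector spaces. A 2-group $\mathcal{G}$ is a monoidal category in which every object is invertible and every morphism is an isomorphism; $e$ is the tensor unit. For each object $g$ a left dual $g^*$ is fixed with isomorphisms $\mathrm{ev}_g\colon g^*\otimes g\to e$, $\mathrm{coev}_g\colon e\to g\otimes g^*$ (whose inverses exhibit $g^*$ also as a right dual); for $a\colon g\to h$, $a^*\colon g^*\to h^*$ is the inverse of the dual morphism $a^L\colon h^*\to g^*$. $2\mathrm{Rep}(\mathcal{G})=\mathrm{Fun}(\mathrm{B}\mathcal{G},2\mathrm{Vec})$ is the 2-category of finite semisimple 2-representations; an object is a finite semisimple $k$-linear category $\mathcal{V}$ with a left $\mathcal{G}$-module structure $\odot$ by $k$-linear functors. The 2-character of $\mathcal{V}$ is the functor $\chi_{\mathcal{V}}\colon\mathcal{G}\to\mathrm{Vec}$, $\chi_{\mathcal{V}}(x)=\mathrm{Nat}(1_{\mathcal{V}},x\odot-)$, with morphisms acting by post-composition. The conjugation invariance is the family of isomorphisms $\psi_{g,x}\colon\chi_{\mathcal{V}}(x)\to\chi_{\mathcal{V}}((g\otimes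 x)\otimes g^* )$ ($g,x\in\mathcal{G}$) sending $\alpha\colon 1_{\mathcal{V}}\Rightarrow x\odot-$ to the natural transformation with components $$v\simeq g\odot(g^*\odot v)\xrightarrow{1\odot\alpha_{g^*\odot v}}g\odot(x\odot(g^*\odot v))\simeq((g\otimes x)\otimes g^* )\odot v,\qquad v\in\mathcal{V};$$ $\psi_g$ denotes the family $\{\psi_{g,x}\}_{x\in\mathcal{G}}$. $\mathrm{Fun}(\mathcal{G},\mathrm{Vec})$ carries the $\mathcal{G}$-action induced by conjugation, $(g\odot F)(x)=F((g^*\otimes x)\otimes g)$, and $\mathrm{Fun}(\mathcal{G},\mathrm{Vec})^{\mathcal{G}}$ is its category of homotopy fixed points (class functors). In mate form, an object is a functor $F\colon\mathcal{G}\to\mathrm{Vec}$ with isomorphisms $\psi_{g,x}\colon F(x)\to F((g\otimes x)\otimes g^* )$ natural in $x$ (that is, natural isomorphisms $\psi_g\colon F\Rightarrow g^*\odot F$), such that for all $g,h,x\in\mathcal{G}$ and $a\colon g\to h$: (i) $\psi_{g,(h\otimes x)\otimes h^*}\circ\psi_{h,x}$ equals $\psi_{g\otimes h,x}$ followed by the canonical isomorphism $F(((g\otimes h)\otimes x)\otimes(g\otimes h)^* )\simeq F((g\otimes((h\otimes x)\otimes h^* ))\otimes g^* )$; (ii) $F((a\otimes 1_x)\otimes a^* )\circ\psi_{g,x}=\psi_{h,x}$. Morphisms are natural transformations commuting with the $\psi_{g,x}$. *)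

theory Defs
  imports "HOL-Algebra.Algebraic_Closure"
begin

section \<open>Categories, functors and natural transformations\<close>

record ('o, 'm) cat =
  Obj :: "'o set"
  Arr :: "'m set"
  Dom :: "'m \<Rightarrow> 'o"
  Cod :: "'m \<Rightarrow> 'o"
  Id :: "'o \<Rightarrow> 'm"
  Comp :: "'m \<Rightarrow> 'm \<Rightarrow> 'm" (infixr \<open>\<bullet>\<index>\<close> 55)

definition Hom :: "('o, 'm, 'z) cat_scheme \<Rightarrow> 'o \<Rightarrow> 'o \<Rightarrow> 'm set"
  where "Hom C x y = {f \<in> Arr C. Dom C f = x \<and> Cod C f = y}"

locale category =
  fixes C :: "('o, 'm, 'z) cat_scheme" (structure)
  assumes dom_obj: "f \<in> Arr C \<Longrightarrow> Dom C f \<in> Obj C"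
    and cod_obj: "f \<in> Arr C \<Longrightarrow> Cod C f \<in> Obj C"
    and id_hom: "x \<in> Obj C \<Longrightarrow> Id C x \<in> Hom C x x"
    and comp_hom: "\<lbrakk>f \<in> Hom C x y; g \<in> Hom C y z\<rbrakk> \<Longrightarrow> g \<bullet> f \<in> Hom C x z"
    and comp_id_right: "f \<in> Hom C x y \<Longrightarrow> f \<bullet> Id C x = f"
    and comp_id_left: "f \<in> Hom C x y \<Longrightarrow> Id C y \<bullet> f = f"
    and comp_assoc: "\<lbrakk>f \<in> Hom C w x; g \<in> Hom C x y; h \<in> Hom C y z\<rbrakk>
      \<Longrightarrow> (h \<bullet> g) \<bullet> f = h \<bullet> (g \<bullet> f)"

definition inverse_arrows :: "('o, 'm, 'z) cat_scheme \<Rightarrow> 'm \<Rightarrow> 'm \<Rightarrow> bool"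
  where "inverse_arrows C f g \<longleftrightarrow> g \<in> Hom C (Cod C f) (Dom C f) \<and>
    g \<bullet>\<^bsub>C\<^esub> f = Id C (Dom C f) \<and> f \<bullet>\<^bsub>C\<^esub> g = Id C (Cod C f)"

definition Iso :: "('o, 'm, 'z) cat_scheme \<Rightarrow> 'o \<Rightarrow> 'o \<Rightarrow> 'm set"
  where "Iso C x y = {f \<in> Hom C x y. \<exists>g. inverse_arrows C f g}"

definition inv_arr :: "('o, 'm, 'z) cat_scheme \<Rightarrow> 'm \<Rightarrow> 'm"
  where "inv_arr C f = (THE g. inverse_arrows C f g)"

definition monic :: "('o, 'm, 'z) cat_scheme \<Rightarrow> 'm \<Rightarrow> bool"
  where "monic C f \<longleftrightarrow> f \<in> Arr C \<and>
    (\<forall>x \<in> Obj C. \<forall>s \<in> Hom C x (Dom C f). \<forall>t \<in> Hom C x (Dom C f).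
      f \<bullet>\<^bsub>C\<^esub> s = f \<bullet>\<^bsub>C\<^esub> t \<longrightarrow> s = t)"

definition epic :: "('o, 'm, 'z) cat_scheme \<Rightarrow> 'm \<Rightarrow> bool"
  where "epic C f \<longleftrightarrow> f \<in> Arr C \<and>
    (\<forall>x \<in> Obj C. \<forall>s \<in> Hom C (Cod C f) x. \<forall>t \<in> Hom C (Cod C f) x.
      s \<bullet>\<^bsub>C\<^esub> f = t \<bullet>\<^bsub>C\<^esub> f \<longrightarrow> s = t)"

record ('o, 'm, 'p, 'n) fctr =
  FO :: "'o \<Rightarrow> 'p"
  FM :: "'m \<Rightarrow> 'n"

locale cat_functor = C: category C + D: category D
  for C :: "('o, 'm, 'y) cat_scheme" and D :: "('p, 'n, 'z) cat_scheme" +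
  fixes F :: "('o, 'm, 'p, 'n) fctr"
  assumes functor_obj: "x \<in> Obj C \<Longrightarrow> FO F x \<in> Obj D"
    and functor_hom: "f \<in> Hom C x y \<Longrightarrow> FM F f \<in> Hom D (FO F x) (FO F y)"
    and functor_id: "x \<in> Obj C \<Longrightarrow> FM F (Id C x) = Id D (FO F x)"
    and functor_comp: "\<lbrakk>f \<in> Hom C x y; g \<in> Hom C y z\<rbrakk>
      \<Longrightarrow> FM F (g \<bullet>\<^bsub>C\<^esub> f) = FM F g \<bullet>\<^bsub>D\<^esub> FM F f"

definition id_functor :: "('o, 'm, 'o, 'm) fctr"
  where "id_functor = \<lparr>FO = (\<lambda>x. x), FM = (\<lambda>f. f)\<rparr>"

text \<open>Families of components are extensional (\<^const>\<open>PiE\<close>), so that equality of natural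
  transformations is equality of components.\<close>

definition NatTrans :: "('o, 'm, 'y) cat_scheme \<Rightarrow> ('p, 'n, 'z) cat_scheme \<Rightarrow>
    ('o, 'm, 'p, 'n) fctr \<Rightarrow> ('o, 'm, 'p, 'n) fctr \<Rightarrow> ('o \<Rightarrow> 'n) set"
  where "NatTrans C D F F' = {\<alpha> \<in> (\<Pi>\<^sub>E x\<in>Obj C. Hom D (FO F x) (FO F' x)).
    \<forall>f \<in> Arr C. FM F' f \<bullet>\<^bsub>D\<^esub> \<alpha> (Dom C f) = \<alpha> (Cod C f) \<bullet>\<^bsub>D\<^esub> FM F f}"


section \<open>Finite-dimensional vector spaces\<close>

definition finite_dimensional :: "('k, 'r) ring_scheme \<Rightarrow> ('k, 'w, 's) module_scheme \<Rightarrow> bool"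
  where "finite_dimensional K A \<longleftrightarrow> (\<exists>B. finite B \<and> B \<subseteq> carrier A \<and>
    (\<forall>v \<in> carrier A. \<exists>c \<in> B \<rightarrow> carrier K. v = (\<Oplus>\<^bsub>A\<^esub>b\<in>B. c b \<odot>\<^bsub>A\<^esub> b)))"

definition linear_map :: "('k, 'r) ring_scheme \<Rightarrow> ('k, 'a, 's) module_scheme \<Rightarrow>
    ('k, 'b, 't) module_scheme \<Rightarrow> ('a \<Rightarrow> 'b) \<Rightarrow> bool"
  where "linear_map K A B f \<longleftrightarrow> f \<in> carrier A \<rightarrow> carrier B \<and>
    (\<forall>u \<in> carrier A. \<forall>v \<in> carrier A. f (u \<oplus>\<^bsub>A\<^esub> v) = f u \<oplus>\<^bsub>B\<^esub> f v) \<and>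
    (\<forall>c \<in> carrier K. \<forall>v \<in> carrier A. f (c \<odot>\<^bsub>A\<^esub> v) = c \<odot>\<^bsub>B\<^esub> f v)"

type_synonym ('k, 'w) lin_arr = "('k, 'w) module \<times> ('w \<Rightarrow> 'w) \<times> ('k, 'w) module"

text \<open>The category of finite-dimensional vector spaces over \<open>K\<close> whose vectors are taken from the
  type \<open>'w\<close>. An arrow is a triple (source, map, target) with the map undefined outside the
  source. The fields \<^const>\<open>monoid.mult\<close> and \<^const>\<open>monoid.one\<close> that \<open>module\<close>
  inherits from \<open>ring\<close> play no role.\<close>

definition Vec :: "('k, 'r) ring_scheme \<Rightarrow> (('k, 'w) module, ('k, 'w) lin_arr) cat"
  where "Vec K = \<lparr>
    Obj = {A. module K A \<and> finite_dimensional K A},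
    Arr = {(A, f, B). module K A \<and> finite_dimensional K A \<and> module K B \<and> finite_dimensional K B \<and>
      linear_map K A B f \<and> f \<in> extensional (carrier A)},
    Dom = (\<lambda>(A, f, B). A),
    Cod = (\<lambda>(A, f, B). B),
    Id = (\<lambda>A. (A, \<lambda>v\<in>carrier A. v, A)),
    Comp = (\<lambda>(B', g, C) (A, f, B). (A, compose (carrier A) g f, C))\<rparr>"


section \<open>Finite semisimple linear categories\<close>

record ('o, 'm, 'k) lin_cat = "('o, 'm) cat" +
  HomSp :: "'o \<Rightarrow> 'o \<Rightarrow> ('k, 'm) module"

locale linear_category = K: field K + category V
  for K :: "('k, 'r) ring_scheme" and V :: "('v, 'vm, 'k, 'z) lin_cat_scheme" +
  assumes hom_module: "\<lbrakk>x \<in> Obj V; y \<in> Obj V\<rbrakk> \<Longrightarrow> module K (HomSp V x y)"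
    and hom_carrier: "\<lbrakk>x \<in> Obj V; y \<in> Obj V\<rbrakk> \<Longrightarrow> carrier (HomSp V x y) = Hom V x y"
    and comp_linear_left: "\<lbrakk>x \<in> Obj V; f \<in> Hom V y z\<rbrakk>
      \<Longrightarrow> linear_map K (HomSp V x y) (HomSp V x z) (\<lambda>g. f \<bullet>\<^bsub>V\<^esub> g)"
    and comp_linear_right: "\<lbrakk>z \<in> Obj V; f \<in> Hom V x y\<rbrakk>
      \<Longrightarrow> linear_map K (HomSp V y z) (HomSp V x z) (\<lambda>g. g \<bullet>\<^bsub>V\<^esub> f)"

abbreviation zero_arr :: "('v, 'vm, 'k, 'z) lin_cat_scheme \<Rightarrow> 'v \<Rightarrow> 'v \<Rightarrow> 'vm"
  where "zero_arr V x y \<equiv> \<zero>\<^bsub>HomSp V x y\<^esub>"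

text \<open>The object \<open>v\<close> is a direct sum (biproduct) of \<open>s 0, \<dots>, s (n - 1)\<close>; for \<open>n = 0\<close> this
  says that the identity of \<open>v\<close> is zero, i.e. that \<open>v\<close> is a zero object.\<close>

definition direct_sum :: "('v, 'vm, 'k, 'z) lin_cat_scheme \<Rightarrow> nat \<Rightarrow> (nat \<Rightarrow> 'v) \<Rightarrow> 'v \<Rightarrow> bool"
  where "direct_sum V n s v \<longleftrightarrow> v \<in> Obj V \<and> (\<forall>i<n. s i \<in> Obj V) \<and>
    (\<exists>\<iota> \<pi>. (\<forall>i<n. \<iota> i \<in> Hom V (s i) v \<and> \<pi> i \<in> Hom V v (s i)) \<and>
      (\<forall>i<n. \<forall>j<n. \<pi> i \<bullet>\<^bsub>V\<^esub> \<iota> j = (if i = j then Id V (s i) else zero_arr V (s j) (s i))) \<and>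
      Id V v = (\<Oplus>\<^bsub>HomSp V v v\<^esub>i\<in>{..<n}. \<iota> i \<bullet>\<^bsub>V\<^esub> \<pi> i))"

definition is_kernel :: "('v, 'vm, 'k, 'z) lin_cat_scheme \<Rightarrow> 'vm \<Rightarrow> 'vm \<Rightarrow> bool"
  where "is_kernel V f k \<longleftrightarrow> f \<in> Arr V \<and> k \<in> Arr V \<and> Cod V k = Dom V f \<and>
    f \<bullet>\<^bsub>V\<^esub> k = zero_arr V (Dom V k) (Cod V f) \<and>
    (\<forall>u \<in> Obj V. \<forall>t \<in> Hom V u (Dom V f). f \<bullet>\<^bsub>V\<^esub> t = zero_arr V u (Cod V f) \<longrightarrow>
      (\<exists>!t'. t' \<in> Hom V u (Dom V k) \<and> k \<bullet>\<^bsub>V\<^esub> t' = t))"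

definition is_cokernel :: "('v, 'vm, 'k, 'z) lin_cat_scheme \<Rightarrow> 'vm \<Rightarrow> 'vm \<Rightarrow> bool"
  where "is_cokernel V f q \<longleftrightarrow> f \<in> Arr V \<and> q \<in> Arr V \<and> Dom V q = Cod V f \<and>
    q \<bullet>\<^bsub>V\<^esub> f = zero_arr V (Dom V f) (Cod V q) \<and>
    (\<forall>u \<in> Obj V. \<forall>t \<in> Hom V (Cod V f) u. t \<bullet>\<^bsub>V\<^esub> f = zero_arr V (Dom V f) u \<longrightarrow>
      (\<exists>!t'. t' \<in> Hom V (Cod V q) u \<and> t' \<bullet>\<^bsub>V\<^esub> q = t))"

locale abelian_linear_category = linear_category +
  assumes additive: "(\<And>i. i < n \<Longrightarrow> s i \<in> Obj V) \<Longrightarrow> \<exists>v. direct_sum V n s v"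
    and has_kernel: "f \<in> Arr V \<Longrightarrow> \<exists>k. is_kernel V f k"
    and has_cokernel: "f \<in> Arr V \<Longrightarrow> \<exists>q. is_cokernel V f q"
    and monic_is_kernel: "monic V k \<Longrightarrow> \<exists>f. is_kernel V f k"
    and epic_is_cokernel: "epic V q \<Longrightarrow> \<exists>f. is_cokernel V f q"

text \<open>A simple object: non-zero, and every subobject is zero or everything.\<close>

definition simple_object :: "('v, 'vm, 'k, 'z) lin_cat_scheme \<Rightarrow> 'v \<Rightarrow> bool"
  where "simple_object V s \<longleftrightarrow> s \<in> Obj V \<and> Id V s \<noteq> zero_arr V s s \<and>
    (\<forall>u \<in> Obj V. \<forall>f \<in> Hom V u s. monic V f \<longrightarrow> Id V u = zero_arr V u u \<or> f \<in> Iso V u s)"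

locale finite_semisimple_category = abelian_linear_category +
  assumes hom_finite_dimensional:
      "\<lbrakk>x \<in> Obj V; y \<in> Obj V\<rbrakk> \<Longrightarrow> finite_dimensional K (HomSp V x y)"
    and semisimple:
      "v \<in> Obj V \<Longrightarrow> \<exists>n s. (\<forall>i<n. simple_object V (s i)) \<and> direct_sum V n s v"
    and finitely_many_simples:
      "\<exists>S. finite S \<and> (\<forall>s. simple_object V s \<longrightarrow> (\<exists>t \<in> S. simple_object V t \<and> Iso V s t \<noteq> {}))"


section \<open>Monoidal categories and 2-groups\<close>

record ('g, 'gm) mon_cat = "('g, 'gm) cat" +
  TensO :: "'g \<Rightarrow> 'g \<Rightarrow> 'g" (infixl \<open>\<otimes>\<^sub>o\<index>\<close> 70)
  TensM :: "'gm \<Rightarrow> 'gm \<Rightarrow> 'gm" (infixl \<open>\<otimes>\<^sub>m\<index>\<close> 70)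
  Unit :: "'g"
  Assoc :: "'g \<Rightarrow> 'g \<Rightarrow> 'g \<Rightarrow> 'gm"  \<comment> \<open>\<open>(x \<otimes> y) \<otimes> z \<rightarrow> x \<otimes> (y \<otimes> z)\<close>\<close>
  LUnit :: "'g \<Rightarrow> 'gm"  \<comment> \<open>\<open>e \<otimes> x \<rightarrow> x\<close>\<close>
  RUnit :: "'g \<Rightarrow> 'gm"  \<comment> \<open>\<open>x \<otimes> e \<rightarrow> x\<close>\<close>

locale monoidal_category = category G
  for G :: "('g, 'gm, 'z) mon_cat_scheme" (structure) +
  assumes tens_obj: "\<lbrakk>x \<in> Obj G; y \<in> Obj G\<rbrakk> \<Longrightarrow> x \<otimes>\<^sub>o y \<in> Obj G"
    and tens_hom: "\<lbrakk>f \<in> Hom G x x'; g \<in> Hom G y y'\<rbrakk>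
      \<Longrightarrow> f \<otimes>\<^sub>m g \<in> Hom G (x \<otimes>\<^sub>o y) (x' \<otimes>\<^sub>o y')"
    and tens_id: "\<lbrakk>x \<in> Obj G; y \<in> Obj G\<rbrakk> \<Longrightarrow> Id G x \<otimes>\<^sub>m Id G y = Id G (x \<otimes>\<^sub>o y)"
    and tens_comp: "\<lbrakk>f \<in> Hom G x x'; f' \<in> Hom G x' x''; g \<in> Hom G y y'; g' \<in> Hom G y' y''\<rbrakk>
      \<Longrightarrow> (f' \<bullet> f) \<otimes>\<^sub>m (g' \<bullet> g) = (f' \<otimes>\<^sub>m g') \<bullet> (f \<otimes>\<^sub>m g)"
    and unit_obj: "Unit G \<in> Obj G"
    and assoc_iso: "\<lbrakk>x \<in> Obj G; y \<in> Obj G; z \<in> Obj G\<rbrakk>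
      \<Longrightarrow> Assoc G x y z \<in> Iso G ((x \<otimes>\<^sub>o y) \<otimes>\<^sub>o z) (x \<otimes>\<^sub>o (y \<otimes>\<^sub>o z))"
    and assoc_natural: "\<lbrakk>f \<in> Hom G x x'; g \<in> Hom G y y'; h \<in> Hom G z z'\<rbrakk>
      \<Longrightarrow> Assoc G x' y' z' \<bullet> ((f \<otimes>\<^sub>m g) \<otimes>\<^sub>m h) = (f \<otimes>\<^sub>m (g \<otimes>\<^sub>m h)) \<bullet> Assoc G x y z"
    and lunit_iso: "x \<in> Obj G \<Longrightarrow> LUnit G x \<in> Iso G (Unit G \<otimes>\<^sub>o x) x"
    and lunit_natural: "f \<in> Hom G x y
      \<Longrightarrow> LUnit G y \<bullet> (Id G (Unit G) \<otimes>\<^sub>m f) = f \<bullet> LUnit G x"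
    and runit_iso: "x \<in> Obj G \<Longrightarrow> RUnit G x \<in> Iso G (x \<otimes>\<^sub>o Unit G) x"
    and runit_natural: "f \<in> Hom G x y
      \<Longrightarrow> RUnit G y \<bullet> (f \<otimes>\<^sub>m Id G (Unit G)) = f \<bullet> RUnit G x"
    and pentagon: "\<lbrakk>w \<in> Obj G; x \<in> Obj G; y \<in> Obj G; z \<in> Obj G\<rbrakk>
      \<Longrightarrow> (Id G w \<otimes>\<^sub>m Assoc G x y z) \<bullet> Assoc G w (x \<otimes>\<^sub>o y) z \<bullet> (Assoc G w x y \<otimes>\<^sub>m Id G z)
        = Assoc G w x (y \<otimes>\<^sub>o z) \<bullet> Assoc G (w \<otimes>\<^sub>o x) y z"
    and triangle: "\<lbrakk>x \<in> Obj G; y \<in> Obj G\<rbrakk>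
      \<Longrightarrow> (Id G x \<otimes>\<^sub>m LUnit G y) \<bullet> Assoc G x (Unit G) y = RUnit G x \<otimes>\<^sub>m Id G y"

locale two_group = monoidal_category +
  assumes obj_invertible: "x \<in> Obj G \<Longrightarrow>
      \<exists>y \<in> Obj G. Iso G (x \<otimes>\<^sub>o y) (Unit G) \<noteq> {} \<and> Iso G (y \<otimes>\<^sub>o x) (Unit G) \<noteq> {}"
    and arr_invertible: "f \<in> Hom G x y \<Longrightarrow> f \<in> Iso G x y"

record ('g, 'gm) dual_mon_cat = "('g, 'gm) mon_cat" +
  Dual :: "'g \<Rightarrow> 'g"
  Ev :: "'g \<Rightarrow> 'gm"  \<comment> \<open>\<open>g\<^sup>* \<otimes> g \<rightarrow> e\<close>\<close>
  Coev :: "'g \<Rightarrow> 'gm"  \<comment> \<open>\<open>e \<rightarrow> g \<otimes> g\<^sup>*\<close>\<close>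

text \<open>A 2-group with a chosen left dual of each object. Inverting the two snake identities shows
  that the inverses of \<open>Ev\<close> and \<open>Coev\<close> exhibit the same object as a right dual.\<close>

locale two_group_with_duals = two_group G
  for G :: "('g, 'gm, 'z) dual_mon_cat_scheme" (structure) +
  assumes dual_obj: "g \<in> Obj G \<Longrightarrow> Dual G g \<in> Obj G"
    and ev_iso: "g \<in> Obj G \<Longrightarrow> Ev G g \<in> Iso G (Dual G g \<otimes>\<^sub>o g) (Unit G)"
    and coev_iso: "g \<in> Obj G \<Longrightarrow> Coev G g \<in> Iso G (Unit G) (g \<otimes>\<^sub>o Dual G g)"
    and snake: "g \<in> Obj G \<Longrightarrow>
      RUnit G g \<bullet> (Id G g \<otimes>\<^sub>m Ev G g) \<bullet> Assoc G g (Dual G g) g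
        \<bullet> (Coev G g \<otimes>\<^sub>m Id G g) \<bullet> inv_arr G (LUnit G g) = Id G g"
    and snake_dual: "g \<in> Obj G \<Longrightarrow>
      LUnit G (Dual G g) \<bullet> (Ev G g \<otimes>\<^sub>m Id G (Dual G g))
        \<bullet> inv_arr G (Assoc G (Dual G g) g (Dual G g))
        \<bullet> (Id G (Dual G g) \<otimes>\<^sub>m Coev G g) \<bullet> inv_arr G (RUnit G (Dual G g)) = Id G (Dual G g)"

context
  fixes G :: "('g, 'gm, 'z) dual_mon_cat_scheme" (structure)
begin

text \<open>The arrow \<open>h\<^sup>* \<rightarrow> d\<close> corresponding under duality to \<open>c : e \<rightarrow> h \<otimes> d\<close>:
  \[ h^* \simeq h^* \otimes e \to h^* \otimes (h \otimes d) \simeq (h^* \otimes h) \otimes d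
     \to e \otimes d \simeq d. \]\<close>

definition mate :: "'g \<Rightarrow> 'g \<Rightarrow> 'gm \<Rightarrow> 'gm"
  where "mate h d c = LUnit G d \<bullet> (Ev G h \<otimes>\<^sub>m Id G d) \<bullet> inv_arr G (Assoc G (Dual G h) h d)
    \<bullet> (Id G (Dual G h) \<otimes>\<^sub>m c) \<bullet> inv_arr G (RUnit G (Dual G h))"

text \<open>For \<open>a : g \<rightarrow> h\<close>, the dual arrow \<open>a\<^sup>L : h\<^sup>* \<rightarrow> g\<^sup>*\<close>, and its inverse
  \<open>a\<^sup>* : g\<^sup>* \<rightarrow> h\<^sup>*\<close>.\<close>

definition dual_arr :: "'gm \<Rightarrow> 'gm"
  where "dual_arr a = mate (Cod G a) (Dual G (Dom G a))
    ((a \<otimes>\<^sub>m Id G (Dual G (Dom G a))) \<bullet> Coev G (Dom G a))"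

definition star_arr :: "'gm \<Rightarrow> 'gm"
  where "star_arr a = inv_arr G (dual_arr a)"

text \<open>The coevaluation \<open>e \<rightarrow> (g \<otimes> h) \<otimes> (h\<^sup>* \<otimes> g\<^sup>*)\<close> that makes \<open>h\<^sup>* \<otimes> g\<^sup>*\<close>
  a left dual of \<open>g \<otimes> h\<close>, and the resulting canonical comparison of left duals
  \<open>(g \<otimes> h)\<^sup>* \<rightarrow> h\<^sup>* \<otimes> g\<^sup>*\<close>.\<close>

definition coev_tens :: "'g \<Rightarrow> 'g \<Rightarrow> 'gm"
  where "coev_tens g h = inv_arr G (Assoc G g h (Dual G h \<otimes>\<^sub>o Dual G g))
    \<bullet> (Id G g \<otimes>\<^sub>m Assoc G h (Dual G h) (Dual G g))
    \<bullet> (Id G g \<otimes>\<^sub>m (Coev G h \<otimes>\<^sub>m Id G (Dual G g)))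
    \<bullet> (Id G g \<otimes>\<^sub>m inv_arr G (LUnit G (Dual G g)))
    \<bullet> Coev G g"

definition dual_tens :: "'g \<Rightarrow> 'g \<Rightarrow> 'gm"
  where "dual_tens g h = mate (g \<otimes>\<^sub>o h) (Dual G h \<otimes>\<^sub>o Dual G g) (coev_tens g h)"

definition conjO :: "'g \<Rightarrow> 'g \<Rightarrow> 'g"
  where "conjO g x = (g \<otimes>\<^sub>o x) \<otimes>\<^sub>o Dual G g"

definition conjM :: "'g \<Rightarrow> 'gm \<Rightarrow> 'gm"
  where "conjM g f = (Id G g \<otimes>\<^sub>m f) \<otimes>\<^sub>m Id G (Dual G g)"

text \<open>The canonical isomorphism
  \<open>((g \<otimes> h) \<otimes> x) \<otimes> (g \<otimes> h)\<^sup>* \<rightarrow> (g \<otimes> ((h \<otimes> x) \<otimes> h\<^sup>*)) \<otimes> g\<^sup>*\<close>.\<close>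

definition conj_tens :: "'g \<Rightarrow> 'g \<Rightarrow> 'g \<Rightarrow> 'gm"
  where "conj_tens g h x =
    (Assoc G g (h \<otimes>\<^sub>o x) (Dual G h) \<otimes>\<^sub>m Id G (Dual G g))
    \<bullet> ((Assoc G g h x \<otimes>\<^sub>m Id G (Dual G h)) \<otimes>\<^sub>m Id G (Dual G g))
    \<bullet> inv_arr G (Assoc G ((g \<otimes>\<^sub>o h) \<otimes>\<^sub>o x) (Dual G h) (Dual G g))
    \<bullet> (Id G ((g \<otimes>\<^sub>o h) \<otimes>\<^sub>o x) \<otimes>\<^sub>m dual_tens g h)"

end


section \<open>Class functors\<close>

text \<open>Homotopy fixed points of the conjugation action on functors \<open>G \<rightarrow> Vec\<close>, in mate form.\<close>

locale class_functor = G: two_group_with_duals G + cat_functor G "Vec K" F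
  for K :: "('k, 'r) ring_scheme"
    and G :: "('g, 'gm, 'z) dual_mon_cat_scheme"
    and F :: "('g, 'gm, ('k, 'w) module, ('k, 'w) lin_arr) fctr" +
  fixes \<psi> :: "'g \<Rightarrow> 'g \<Rightarrow> ('k, 'w) lin_arr"
  assumes psi_iso: "\<lbrakk>g \<in> Obj G; x \<in> Obj G\<rbrakk> \<Longrightarrow> \<psi> g x \<in> Iso (Vec K) (FO F x) (FO F (conjO G g x))"
    and psi_natural: "\<lbrakk>g \<in> Obj G; f \<in> Hom G x y\<rbrakk>
      \<Longrightarrow> FM F (conjM G g f) \<bullet>\<^bsub>Vec K\<^esub> \<psi> g x = \<psi> g y \<bullet>\<^bsub>Vec K\<^esub> FM F f"
    and psi_tens: "\<lbrakk>g \<in> Obj G; h \<in> Obj G; x \<in> Obj G\<rbrakk>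
      \<Longrightarrow> \<psi> g (conjO G h x) \<bullet>\<^bsub>Vec K\<^esub> \<psi> h x
        = FM F (conj_tens G g h x) \<bullet>\<^bsub>Vec K\<^esub> \<psi> (g \<otimes>\<^sub>o\<^bsub>G\<^esub> h) x"
    and psi_arr: "\<lbrakk>a \<in> Hom G g h; x \<in> Obj G\<rbrakk>
      \<Longrightarrow> FM F ((a \<otimes>\<^sub>m\<^bsub>G\<^esub> Id G x) \<otimes>\<^sub>m\<^bsub>G\<^esub> star_arr G a) \<bullet>\<^bsub>Vec K\<^esub> \<psi> g x = \<psi> h x"

type_synonym ('g, 'gm, 'k, 'w) class_fctr =
  "('g, 'gm, ('k, 'w) module, ('k, 'w) lin_arr) fctr \<times> ('g \<Rightarrow> 'g \<Rightarrow> ('k, 'w) lin_arr)"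

text \<open>The category of class functors; as for \<^const>\<open>Vec\<close>, arrows are triples
  (source, family of components, target).\<close>

definition class_functors :: "('k, 'r) ring_scheme \<Rightarrow> ('g, 'gm, 'z) dual_mon_cat_scheme \<Rightarrow>
    (('g, 'gm, 'k, 'w) class_fctr, ('g, 'gm, 'k, 'w) class_fctr \<times> ('g \<Rightarrow> ('k, 'w) lin_arr) \<times>
      ('g, 'gm, 'k, 'w) class_fctr) cat"
  where "class_functors K G = \<lparr>
    Obj = {(F, \<psi>). class_functor K G F \<psi>},
    Arr = {((F, \<psi>), \<eta>, (F', \<psi>')). class_functor K G F \<psi> \<and> class_functor K G F' \<psi>' \<and>
      \<eta> \<in> NatTrans G (Vec K) F F' \<and>
      (\<forall>g \<in> Obj G. \<forall>x \<in> Obj G.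
        \<eta> (conjO G g x) \<bullet>\<^bsub>Vec K\<^esub> \<psi> g x = \<psi>' g x \<bullet>\<^bsub>Vec K\<^esub> \<eta> x)},
    Dom = (\<lambda>(P, \<eta>, Q). P),
    Cod = (\<lambda>(P, \<eta>, Q). Q),
    Id = (\<lambda>P. (P, \<lambda>x\<in>Obj G. Id (Vec K) (FO (fst P) x), P)),
    Comp = (\<lambda>(Q', \<theta>, R) (P, \<eta>, Q). (P, \<lambda>x\<in>Obj G. \<theta> x \<bullet>\<^bsub>Vec K\<^esub> \<eta> x, R))\<rparr>"


section \<open>2-representations\<close>

record ('g, 'gm, 'v, 'vm) action =
  ActO :: "'g \<Rightarrow> 'v \<Rightarrow> 'v" (infixr \<open>\<odot>\<^sub>o\<index>\<close> 70)
  ActM :: "'gm \<Rightarrow> 'vm \<Rightarrow> 'vm" (infixr \<open>\<odot>\<^sub>m\<index>\<close> 70)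
  MAssoc :: "'g \<Rightarrow> 'g \<Rightarrow> 'v \<Rightarrow> 'vm"  \<comment> \<open>\<open>(g \<otimes> h) \<odot> v \<rightarrow> g \<odot> (h \<odot> v)\<close>\<close>
  MUnit :: "'v \<Rightarrow> 'vm"  \<comment> \<open>\<open>e \<odot> v \<rightarrow> v\<close>\<close>

locale left_module_category = G: monoidal_category G + V: category V
  for G :: "('g, 'gm, 'y) mon_cat_scheme" and V :: "('v, 'vm, 'z) cat_scheme" +
  fixes M :: "('g, 'gm, 'v, 'vm) action" (structure)
  assumes act_obj: "\<lbrakk>g \<in> Obj G; v \<in> Obj V\<rbrakk> \<Longrightarrow> g \<odot>\<^sub>o v \<in> Obj V"
    and act_hom: "\<lbrakk>a \<in> Hom G g h; f \<in> Hom V v w\<rbrakk> \<Longrightarrow> a \<odot>\<^sub>m f \<in> Hom V (g \<odot>\<^sub>o v) (h \<odot>\<^sub>o w)"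
    and act_id: "\<lbrakk>g \<in> Obj G; v \<in> Obj V\<rbrakk> \<Longrightarrow> Id G g \<odot>\<^sub>m Id V v = Id V (g \<odot>\<^sub>o v)"
    and act_comp: "\<lbrakk>a \<in> Hom G g g'; a' \<in> Hom G g' g''; f \<in> Hom V v v'; f' \<in> Hom V v' v''\<rbrakk>
      \<Longrightarrow> (a' \<bullet>\<^bsub>G\<^esub> a) \<odot>\<^sub>m (f' \<bullet>\<^bsub>V\<^esub> f) = (a' \<odot>\<^sub>m f') \<bullet>\<^bsub>V\<^esub> (a \<odot>\<^sub>m f)"
    and massoc_iso: "\<lbrakk>g \<in> Obj G; h \<in> Obj G; v \<in> Obj V\<rbrakk>
      \<Longrightarrow> MAssoc M g h v \<in> Iso V ((g \<otimes>\<^sub>o\<^bsub>G\<^esub> h) \<odot>\<^sub>o v) (g \<odot>\<^sub>o (h \<odot>\<^sub>o v))"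
    and massoc_natural: "\<lbrakk>a \<in> Hom G g g'; b \<in> Hom G h h'; f \<in> Hom V v v'\<rbrakk>
      \<Longrightarrow> MAssoc M g' h' v' \<bullet>\<^bsub>V\<^esub> ((a \<otimes>\<^sub>m\<^bsub>G\<^esub> b) \<odot>\<^sub>m f)
        = (a \<odot>\<^sub>m (b \<odot>\<^sub>m f)) \<bullet>\<^bsub>V\<^esub> MAssoc M g h v"
    and munit_iso: "v \<in> Obj V \<Longrightarrow> MUnit M v \<in> Iso V (Unit G \<odot>\<^sub>o v) v"
    and munit_natural: "f \<in> Hom V v w
      \<Longrightarrow> MUnit M w \<bullet>\<^bsub>V\<^esub> (Id G (Unit G) \<odot>\<^sub>m f) = f \<bullet>\<^bsub>V\<^esub> MUnit M v"
    and act_pentagon: "\<lbrakk>g \<in> Obj G; h \<in> Obj G; k \<in> Obj G; v \<in> Obj V\<rbrakk>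
      \<Longrightarrow> (Id G g \<odot>\<^sub>m MAssoc M h k v) \<bullet>\<^bsub>V\<^esub> MAssoc M g (h \<otimes>\<^sub>o\<^bsub>G\<^esub> k) v
          \<bullet>\<^bsub>V\<^esub> (Assoc G g h k \<odot>\<^sub>m Id V v)
        = MAssoc M g h (k \<odot>\<^sub>o v) \<bullet>\<^bsub>V\<^esub> MAssoc M (g \<otimes>\<^sub>o\<^bsub>G\<^esub> h) k v"
    and act_triangle: "\<lbrakk>g \<in> Obj G; v \<in> Obj V\<rbrakk>
      \<Longrightarrow> (Id G g \<odot>\<^sub>m MUnit M v) \<bullet>\<^bsub>V\<^esub> MAssoc M g (Unit G) v = RUnit G g \<odot>\<^sub>m Id V v"

locale two_rep = G: two_group G + V: finite_semisimple_category K V + left_module_category G V M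
  for K :: "('k, 'r) ring_scheme" and G :: "('g, 'gm, 'y) mon_cat_scheme"
    and V :: "('v, 'vm, 'k, 'z) lin_cat_scheme" and M :: "('g, 'gm, 'v, 'vm) action" +
  assumes act_linear: "\<lbrakk>g \<in> Obj G; v \<in> Obj V; w \<in> Obj V\<rbrakk>
      \<Longrightarrow> linear_map K (HomSp V v w) (HomSp V (g \<odot>\<^sub>o\<^bsub>M\<^esub> v) (g \<odot>\<^sub>o\<^bsub>M\<^esub> w)) (\<lambda>f. Id G g \<odot>\<^sub>m\<^bsub>M\<^esub> f)"


section \<open>The 2-character and its conjugation invariance\<close>

definition act_functor :: "('g, 'gm, 'y) mon_cat_scheme \<Rightarrow> ('g, 'gm, 'v, 'vm) action \<Rightarrow> 'g
    \<Rightarrow> ('v, 'vm, 'v, 'vm) fctr"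
  where "act_functor G M x = \<lparr>FO = (\<lambda>v. x \<odot>\<^sub>o\<^bsub>M\<^esub> v), FM = (\<lambda>f. Id G x \<odot>\<^sub>m\<^bsub>M\<^esub> f)\<rparr>"

context
  fixes G :: "('g, 'gm, 'y) dual_mon_cat_scheme"
    and V :: "('v, 'vm, 'k, 'z) lin_cat_scheme"
    and M :: "('g, 'gm, 'v, 'vm) action"
begin

definition two_char_space :: "'g \<Rightarrow> ('k, 'v \<Rightarrow> 'vm) module"
  where "two_char_space x = \<lparr>
    carrier = NatTrans V V id_functor (act_functor G M x),
    monoid.mult = undefined,
    monoid.one = undefined,
    zero = (\<lambda>v\<in>Obj V. \<zero>\<^bsub>HomSp V v (x \<odot>\<^sub>o\<^bsub>M\<^esub> v)\<^esub>),
    add = (\<lambda>\<alpha> \<beta>. \<lambda>v\<in>Obj V. \<alpha> v \<oplus>\<^bsub>HomSp V v (x \<odot>\<^sub>o\<^bsub>M\<^esub> v)\<^esub> \<beta> v),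
    smult = (\<lambda>c \<alpha>. \<lambda>v\<in>Obj V. c \<odot>\<^bsub>HomSp V v (x \<odot>\<^sub>o\<^bsub>M\<^esub> v)\<^esub> \<alpha> v)\<rparr>"

definition two_char :: "('g, 'gm, ('k, 'v \<Rightarrow> 'vm) module, ('k, 'v \<Rightarrow> 'vm) lin_arr) fctr"
  where "two_char = \<lparr>
    FO = two_char_space,
    FM = (\<lambda>f. (two_char_space (Dom G f),
      \<lambda>\<alpha>\<in>carrier (two_char_space (Dom G f)). \<lambda>v\<in>Obj V. (f \<odot>\<^sub>m\<^bsub>M\<^esub> Id V v) \<bullet>\<^bsub>V\<^esub> \<alpha> v,
      two_char_space (Cod G f)))\<rparr>"

text \<open>The component at \<open>v\<close> is
  \[ v \simeq e \odot v \simeq (g \otimes g^*) \odot v \simeq g \odot (g^* \odot v)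
     \to g \odot (x \odot (g^* \odot v)) \simeq (g \otimes x) \odot (g^* \odot v)
     \simeq ((g \otimes x) \otimes g^*) \odot v. \]\<close>

definition conj_inv_component :: "'g \<Rightarrow> 'g \<Rightarrow> ('v \<Rightarrow> 'vm) \<Rightarrow> 'v \<Rightarrow> 'vm"
  where "conj_inv_component g x \<alpha> v =
    inv_arr V (MAssoc M (g \<otimes>\<^sub>o\<^bsub>G\<^esub> x) (Dual G g) v)
    \<bullet>\<^bsub>V\<^esub> inv_arr V (MAssoc M g x (Dual G g \<odot>\<^sub>o\<^bsub>M\<^esub> v))
    \<bullet>\<^bsub>V\<^esub> (Id G g \<odot>\<^sub>m\<^bsub>M\<^esub> \<alpha> (Dual G g \<odot>\<^sub>o\<^bsub>M\<^esub> v))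
    \<bullet>\<^bsub>V\<^esub> MAssoc M g (Dual G g) v
    \<bullet>\<^bsub>V\<^esub> (Coev G g \<odot>\<^sub>m\<^bsub>M\<^esub> Id V v)
    \<bullet>\<^bsub>V\<^esub> inv_arr V (MUnit M v)"

definition conj_inv :: "'g \<Rightarrow> 'g \<Rightarrow> ('k, 'v \<Rightarrow> 'vm) lin_arr"
  where "conj_inv g x = (two_char_space x,
    \<lambda>\<alpha>\<in>carrier (two_char_space x). \<lambda>v\<in>Obj V. conj_inv_component g x \<alpha> v,
    two_char_space (conjO G g x))"

end

end

theory Submission
  imports Defs
begin

text \<open>Write \<open>\<Psi>(g, d, c)\<close> for the conjugation map in which the coevaluation
  \<open>e \<rightarrow> g \<otimes> g\<^sup>*\<close> is replaced by any arrow \<open>c : e \<rightarrow> g \<otimes> d\<close>. It is natural in \<open>g\<close>, \<open>d\<close>, the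
  conjugated object and the object of \<open>V\<close> at once, so each axiom of a class functor becomes a
  statement about \<open>c\<close>: condition (ii) says that \<open>(a \<otimes> a\<^sup>*) \<circ> coev\<^sub>g = coev\<^sub>h\<close>, and condition (i)
  that the comparison \<open>(g \<otimes> h)\<^sup>* \<rightarrow> h\<^sup>* \<otimes> g\<^sup>*\<close> carries \<open>coev\<close> of \<open>g \<otimes> h\<close> to the nested coevaluation,
  together with the module pentagon. Both facts on coevaluations follow from the snake identity.
  For invertibility, the map of the unit object is post-composition with a natural isomorphism;
  hence, by (i) and (ii), the composites of the maps of \<open>g\<close> and \<open>g\<^sup>*\<close> in either order are
  isomorphisms, and the two-out-of-six property applies. The space of natural transformations is finite-dimensional
  since a transformation is determined by its components at the finitely many simple objects.\<close>

section \<open>Isomorphisms in a category\<close>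

text \<open>Condition (i) compares two different left duals of \<open>g \<otimes> h\<close>: the
  chosen one, which enters through the conjugation by the tensor product, and
  \<open>h\<^sup>* \<otimes> g\<^sup>*\<close>, which iterated conjugation produces. This is why the
  coevaluation is made a variable: with \<open>c\<close> free, a change of dual is one more instance
  of naturality, and only rebracketing is left. No coherence theorem is invoked. Every rebracketing
  is settled by explicit instances of the pentagon, and the units by Kelly's identity, which is
  needed for the tensor product and for the action; it is proved once, for module categories, and
  specialised to the 2-group acting on itself. No formula is given for the inverse of a conjugation
  map. Conjugating by \<open>g\<close> and then by its dual ends at an object that is only
  isomorphic to the one at the start, so an explicit inverse would need further coherence
  identities; invertibility of the composites is enough and needs none. Finite-dimensionality is
  transported through finite generation of subspaces, which avoids bases and products.\<close>

lemma hom_iff: "f \<in> Hom C x y \<longleftrightarrow> f \<in> Arr C \<and> Dom C f = x \<and> Cod C f = y"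
  by (simp add: Hom_def)

text \<open>Invertibility is separated from the endpoints, so that membership in \<open>Iso\<close>
  splits into this predicate and two equations, each within reach of the simplifier.\<close>

definition iso_arr :: "('o, 'm, 'z) cat_scheme \<Rightarrow> 'm \<Rightarrow> bool"
  where "iso_arr C f \<longleftrightarrow> f \<in> Arr C \<and> (\<exists>g. inverse_arrows C f g)"

lemma Iso_iff: "f \<in> Iso C x y \<longleftrightarrow> iso_arr C f \<and> Dom C f = x \<and> Cod C f = y"
  by (auto simp: Iso_def iso_arr_def hom_iff)

context category
begin

text \<open>From here on arrows are typed by membership in \<open>Arr\<close> and equations for
  \<open>Dom\<close> and \<open>Cod\<close> instead of membership in \<open>Hom\<close>; the
  simplifier can then compute the endpoints of long composites.\<close>

lemma dom_cod_simps [simp]: "f \<in> Arr C \<Longrightarrow> Dom C f \<in> Obj C" "f \<in> Arr C \<Longrightarrow> Cod C f \<in> Obj C"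
  by (auto intro: dom_obj cod_obj)

lemma id_simps [simp]:
  assumes "x \<in> Obj C"
  shows "Id C x \<in> Arr C" "Dom C (Id C x) = x" "Cod C (Id C x) = x"
  using id_hom[OF assms] by (auto simp: hom_iff)

lemma comp_simps [simp]:
  assumes "f \<in> Arr C" "g \<in> Arr C" "Dom C g = Cod C f"
  shows "g \<bullet> f \<in> Arr C" "Dom C (g \<bullet> f) = Dom C f" "Cod C (g \<bullet> f) = Cod C g"
  using comp_hom[of f "Dom C f" "Cod C f" g "Cod C g"] assms by (auto simp: hom_iff)

lemma comp_id_simps [simp]:
  "\<lbrakk>f \<in> Arr C; Dom C f = x\<rbrakk> \<Longrightarrow> f \<bullet> Id C x = f"
  "\<lbrakk>f \<in> Arr C; Cod C f = y\<rbrakk> \<Longrightarrow> Id C y \<bullet> f = f"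
  using comp_id_right comp_id_left by (auto simp: hom_iff)

lemma comp_assoc_simp [simp]:
  "\<lbrakk>f \<in> Arr C; g \<in> Arr C; h \<in> Arr C; Dom C g = Cod C f; Dom C h = Cod C g\<rbrakk>
    \<Longrightarrow> (h \<bullet> g) \<bullet> f = h \<bullet> g \<bullet> f"
  using comp_assoc by (auto simp: hom_iff)

text \<open>\<open>comp_assoc_simp\<close> keeps composites nested to the right, where an equation
  for \<open>p \<bullet> q\<close> no longer matches inside
  \<open>p \<bullet> q \<bullet> t\<close>. This supplies the tail \<open>t\<close>; the primed
  variants of later laws serve the same purpose.\<close>

lemma comp_extend:
  assumes "p \<bullet> q = r"
    and "q \<in> Arr C" "p \<in> Arr C" "t \<in> Arr C" "Dom C p = Cod C q" "Dom C q = Cod C t"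
  shows "p \<bullet> q \<bullet> t = r \<bullet> t"
  using assms by (metis comp_assoc_simp)

lemma inverse_arrows_unique:
  assumes f: "f \<in> Arr C" and g: "inverse_arrows C f g" and h: "inverse_arrows C f h"
  shows "g = h"
proof -
  have "g = g \<bullet> f \<bullet> h"
    using f g h by (simp add: inverse_arrows_def hom_iff)
  also have "\<dots> = (g \<bullet> f) \<bullet> h"
    using f g h by (subst comp_assoc_simp) (simp_all add: inverse_arrows_def hom_iff)
  also have "\<dots> = h"
    using f g h by (simp add: inverse_arrows_def hom_iff)
  finally show ?thesis .
qed

lemma inv_arr_eq:
  "\<lbrakk>f \<in> Arr C; inverse_arrows C f g\<rbrakk> \<Longrightarrow> inv_arr C f = g"
  unfolding inv_arr_def using inverse_arrows_unique by blast

lemma inverse_arrows_inv_arr: "iso_arr C f \<Longrightarrow> inverse_arrows C f (inv_arr C f)"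
  using inv_arr_eq by (auto simp: iso_arr_def)

lemma iso_arr_arr: "iso_arr C f \<Longrightarrow> f \<in> Arr C"
  by (simp add: iso_arr_def)

lemma inv_arr_simps [simp]:
  assumes "iso_arr C f"
  shows "inv_arr C f \<in> Arr C" "Dom C (inv_arr C f) = Cod C f" "Cod C (inv_arr C f) = Dom C f"
    "inv_arr C f \<bullet> f = Id C (Dom C f)" "f \<bullet> inv_arr C f = Id C (Cod C f)"
  using inverse_arrows_inv_arr[OF assms] by (auto simp: inverse_arrows_def hom_iff)

lemma inv_arr_cancel [simp]:
  assumes "iso_arr C f" "t \<in> Arr C"
  shows "Cod C t = Dom C f \<Longrightarrow> inv_arr C f \<bullet> f \<bullet> t = t"
    "Cod C t = Cod C f \<Longrightarrow> f \<bullet> inv_arr C f \<bullet> t = t"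
  using assms comp_extend[OF inv_arr_simps(4)] comp_extend[OF inv_arr_simps(5)]
  by (simp_all add: iso_arr_arr)

lemma iso_arrI:
  assumes "f \<in> Arr C" "g \<in> Arr C" "Dom C g = Cod C f" "Cod C g = Dom C f"
    "g \<bullet> f = Id C (Dom C f)" "f \<bullet> g = Id C (Cod C f)"
  shows "iso_arr C f" "inv_arr C f = g"
proof -
  have "inverse_arrows C f g"
    using assms by (simp add: inverse_arrows_def hom_iff)
  then show "iso_arr C f" "inv_arr C f = g"
    using assms inv_arr_eq by (auto simp: iso_arr_def)
qed

lemma iso_arr_inv_arr [simp]: "iso_arr C f \<Longrightarrow> iso_arr C (inv_arr C f)"
  by (rule iso_arrI(1)[where g = f]) (simp_all add: iso_arr_arr)

lemma iso_arr_comp [simp]: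
  assumes "iso_arr C f" "iso_arr C g" "Dom C g = Cod C f"
  shows "iso_arr C (g \<bullet> f)"
  using assms by (intro iso_arrI(1)[where g = "inv_arr C f \<bullet> inv_arr C g"]) (simp_all add: iso_arr_arr)

lemma iso_arr_id [simp]:
  assumes "x \<in> Obj C"
  shows "iso_arr C (Id C x)" "inv_arr C (Id C x) = Id C x"
  using assms iso_arrI[of "Id C x" "Id C x"] by simp_all

lemma comp_iso_eq_iff:
  assumes "iso_arr C p" "s \<in> Arr C" "t \<in> Arr C" "Dom C s = Cod C p" "Dom C t = Dom C p"
  shows "s \<bullet> p = t \<longleftrightarrow> s = t \<bullet> inv_arr C p"
proof
  assume "s \<bullet> p = t"
  then have "t \<bullet> inv_arr C p = (s \<bullet> p) \<bullet> inv_arr C p" by simp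
  then show "s = t \<bullet> inv_arr C p" using assms by (simp add: iso_arr_arr)
qed (use assms in \<open>simp add: iso_arr_arr\<close>)

lemma iso_cancel_left:
  assumes "p \<bullet> s = p \<bullet> t" "iso_arr C p" "s \<in> Arr C" "t \<in> Arr C" "Cod C s = Dom C p" "Cod C t = Dom C p"
  shows "s = t"
  by (metis assms inv_arr_cancel(1))

lemma iso_cancel_right:
  assumes "s \<bullet> p = t \<bullet> p" "iso_arr C p" "s \<in> Arr C" "t \<in> Arr C" "Dom C s = Cod C p" "Dom C t = Cod C p"
  shows "s = t"
  using assms comp_iso_eq_iff[of p s "t \<bullet> p"] by (simp add: iso_arr_arr)

text \<open>Turns naturality of a family of isomorphisms into naturality of the inverse
  family.\<close>

lemma inv_square:
  assumes "p \<bullet> s = t \<bullet> q" "iso_arr C p" "iso_arr C q" "s \<in> Arr C" "t \<in> Arr C"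
    "Cod C s = Dom C p" "Dom C s = Dom C q" "Dom C t = Cod C q" "Cod C t = Cod C p"
  shows "inv_arr C p \<bullet> t = s \<bullet> inv_arr C q"
proof -
  have "inv_arr C p \<bullet> t = inv_arr C p \<bullet> (t \<bullet> q) \<bullet> inv_arr C q"
    using assms by (simp add: iso_arr_arr)
  also have "\<dots> = s \<bullet> inv_arr C q"
    unfolding assms(1)[symmetric] using assms(2-) by (simp add: iso_arr_arr)
  finally show ?thesis .
qed

end

section \<open>Unit coherence\<close>

context monoidal_category
begin

lemma tens_obj_simps [simp]:
  "\<lbrakk>x \<in> Obj G; y \<in> Obj G\<rbrakk> \<Longrightarrow> x \<otimes>\<^sub>o y \<in> Obj G" "Unit G \<in> Obj G"
  by (simp_all add: tens_obj unit_obj)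

lemma tens_simps [simp]:
  assumes "f \<in> Arr G" "g \<in> Arr G"
  shows "f \<otimes>\<^sub>m g \<in> Arr G" "Dom G (f \<otimes>\<^sub>m g) = Dom G f \<otimes>\<^sub>o Dom G g"
    "Cod G (f \<otimes>\<^sub>m g) = Cod G f \<otimes>\<^sub>o Cod G g"
  using tens_hom[of f "Dom G f" "Cod G f" g "Dom G g" "Cod G g"] assms by (simp_all add: hom_iff)

lemma assoc_simps [simp]:
  assumes "x \<in> Obj G" "y \<in> Obj G" "z \<in> Obj G"
  shows "iso_arr G (Assoc G x y z)" "Assoc G x y z \<in> Arr G"
    "Dom G (Assoc G x y z) = (x \<otimes>\<^sub>o y) \<otimes>\<^sub>o z" "Cod G (Assoc G x y z) = x \<otimes>\<^sub>o (y \<otimes>\<^sub>o z)"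
  using assoc_iso[OF assms] iso_arr_arr by (auto simp: Iso_iff)

lemma unit_simps [simp]:
  assumes "x \<in> Obj G"
  shows "iso_arr G (LUnit G x)" "LUnit G x \<in> Arr G"
    "Dom G (LUnit G x) = Unit G \<otimes>\<^sub>o x" "Cod G (LUnit G x) = x"
    "iso_arr G (RUnit G x)" "RUnit G x \<in> Arr G"
    "Dom G (RUnit G x) = x \<otimes>\<^sub>o Unit G" "Cod G (RUnit G x) = x"
  using lunit_iso[OF assms] runit_iso[OF assms] iso_arr_arr by (auto simp: Iso_iff)

lemma tens_id_simp [simp]: "\<lbrakk>x \<in> Obj G; y \<in> Obj G\<rbrakk> \<Longrightarrow> Id G x \<otimes>\<^sub>m Id G y = Id G (x \<otimes>\<^sub>o y)"
  by (rule tens_id)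

lemma tens_interchange:
  "\<lbrakk>f \<in> Arr G; f' \<in> Arr G; g \<in> Arr G; g' \<in> Arr G; Dom G f' = Cod G f; Dom G g' = Cod G g\<rbrakk>
    \<Longrightarrow> (f' \<otimes>\<^sub>m g') \<bullet> (f \<otimes>\<^sub>m g) = (f' \<bullet> f) \<otimes>\<^sub>m (g' \<bullet> g)"
  by (subst tens_comp[of f "Dom G f" "Cod G f" f' "Cod G f'" g "Dom G g" "Cod G g" g' "Cod G g'"])
    (simp_all add: hom_iff)

lemma tens_comp_left:
  "\<lbrakk>f \<in> Arr G; f' \<in> Arr G; Dom G f' = Cod G f; x \<in> Obj G\<rbrakk>
    \<Longrightarrow> (f' \<bullet> f) \<otimes>\<^sub>m Id G x = (f' \<otimes>\<^sub>m Id G x) \<bullet> (f \<otimes>\<^sub>m Id G x)"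
  by (simp add: tens_interchange)

lemma tens_comp_right:
  "\<lbrakk>f \<in> Arr G; f' \<in> Arr G; Dom G f' = Cod G f; x \<in> Obj G\<rbrakk>
    \<Longrightarrow> Id G x \<otimes>\<^sub>m (f' \<bullet> f) = (Id G x \<otimes>\<^sub>m f') \<bullet> (Id G x \<otimes>\<^sub>m f)"
  by (simp add: tens_interchange)

end

section \<open>Calculus of actions and Kelly's unit identity\<close>

context left_module_category
begin

lemma act_obj_simp [simp]: "\<lbrakk>g \<in> Obj G; v \<in> Obj V\<rbrakk> \<Longrightarrow> g \<odot>\<^sub>o v \<in> Obj V"
  by (rule act_obj)

lemma act_simps [simp]:
  assumes "a \<in> Arr G" "f \<in> Arr V"
  shows "a \<odot>\<^sub>m f \<in> Arr V" "Dom V (a \<odot>\<^sub>m f) = Dom G a \<odot>\<^sub>o Dom V f"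
    "Cod V (a \<odot>\<^sub>m f) = Cod G a \<odot>\<^sub>o Cod V f"
  using act_hom[of a "Dom G a" "Cod G a" f "Dom V f" "Cod V f"] assms by (simp_all add: hom_iff)

lemma massoc_simps [simp]:
  assumes "g \<in> Obj G" "h \<in> Obj G" "v \<in> Obj V"
  shows "iso_arr V (MAssoc M g h v)" "MAssoc M g h v \<in> Arr V"
    "Dom V (MAssoc M g h v) = (g \<otimes>\<^sub>o\<^bsub>G\<^esub> h) \<odot>\<^sub>o v" "Cod V (MAssoc M g h v) = g \<odot>\<^sub>o h \<odot>\<^sub>o v"
  using massoc_iso[OF assms] V.iso_arr_arr by (auto simp: Iso_iff)

lemma munit_simps [simp]:
  assumes "v \<in> Obj V"
  shows "iso_arr V (MUnit M v)" "MUnit M v \<in> Arr V"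
    "Dom V (MUnit M v) = Unit G \<odot>\<^sub>o v" "Cod V (MUnit M v) = v"
  using munit_iso[OF assms] V.iso_arr_arr by (auto simp: Iso_iff)

lemma act_id_simp [simp]: "\<lbrakk>g \<in> Obj G; v \<in> Obj V\<rbrakk> \<Longrightarrow> Id G g \<odot>\<^sub>m Id V v = Id V (g \<odot>\<^sub>o v)"
  by (rule act_id)

lemma act_interchange:
  "\<lbrakk>a \<in> Arr G; a' \<in> Arr G; f \<in> Arr V; f' \<in> Arr V; Dom G a' = Cod G a; Dom V f' = Cod V f\<rbrakk>
    \<Longrightarrow> (a' \<odot>\<^sub>m f') \<bullet>\<^bsub>V\<^esub> (a \<odot>\<^sub>m f) = (a' \<bullet>\<^bsub>G\<^esub> a) \<odot>\<^sub>m (f' \<bullet>\<^bsub>V\<^esub> f)"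
  by (subst act_comp[of a "Dom G a" "Cod G a" a' "Cod G a'" f "Dom V f" "Cod V f" f' "Cod V f'"])
    (simp_all add: hom_iff)

lemma act_interchange':
  "\<lbrakk>a \<in> Arr G; a' \<in> Arr G; f \<in> Arr V; f' \<in> Arr V; Dom G a' = Cod G a; Dom V f' = Cod V f;
    t \<in> Arr V; Cod V t = Dom G a \<odot>\<^sub>o Dom V f\<rbrakk>
    \<Longrightarrow> (a' \<odot>\<^sub>m f') \<bullet>\<^bsub>V\<^esub> (a \<odot>\<^sub>m f) \<bullet>\<^bsub>V\<^esub> t = ((a' \<bullet>\<^bsub>G\<^esub> a) \<odot>\<^sub>m (f' \<bullet>\<^bsub>V\<^esub> f)) \<bullet>\<^bsub>V\<^esub> t"
  by (rule V.comp_extend[OF act_interchange]) simp_all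

lemma act_comp_left:
  "\<lbrakk>a \<in> Arr G; a' \<in> Arr G; Dom G a' = Cod G a; v \<in> Obj V\<rbrakk>
    \<Longrightarrow> (a' \<bullet>\<^bsub>G\<^esub> a) \<odot>\<^sub>m Id V v = (a' \<odot>\<^sub>m Id V v) \<bullet>\<^bsub>V\<^esub> (a \<odot>\<^sub>m Id V v)"
  by (simp add: act_interchange)

lemma act_comp_right:
  "\<lbrakk>f \<in> Arr V; f' \<in> Arr V; Dom V f' = Cod V f; g \<in> Obj G\<rbrakk>
    \<Longrightarrow> Id G g \<odot>\<^sub>m (f' \<bullet>\<^bsub>V\<^esub> f) = (Id G g \<odot>\<^sub>m f') \<bullet>\<^bsub>V\<^esub> (Id G g \<odot>\<^sub>m f)"
  by (simp add: act_interchange)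

lemma iso_arr_act [simp]:
  assumes "iso_arr G a" "iso_arr V f"
  shows "iso_arr V (a \<odot>\<^sub>m f)" "inv_arr V (a \<odot>\<^sub>m f) = inv_arr G a \<odot>\<^sub>m inv_arr V f"
proof -
  note [simp] = G.iso_arr_arr[OF assms(1)] V.iso_arr_arr[OF assms(2)]
  show "iso_arr V (a \<odot>\<^sub>m f)" "inv_arr V (a \<odot>\<^sub>m f) = inv_arr G a \<odot>\<^sub>m inv_arr V f"
    using assms V.iso_arrI[of "a \<odot>\<^sub>m f" "inv_arr G a \<odot>\<^sub>m inv_arr V f"]
    by (simp_all add: act_interchange)
qed

lemma massoc_nat:
  "\<lbrakk>a \<in> Arr G; b \<in> Arr G; f \<in> Arr V; Cod G a = g; Cod G b = h; Cod V f = v\<rbrakk>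
    \<Longrightarrow> MAssoc M g h v \<bullet>\<^bsub>V\<^esub> ((a \<otimes>\<^sub>m\<^bsub>G\<^esub> b) \<odot>\<^sub>m f)
      = (a \<odot>\<^sub>m (b \<odot>\<^sub>m f)) \<bullet>\<^bsub>V\<^esub> MAssoc M (Dom G a) (Dom G b) (Dom V f)"
  by (rule massoc_natural) (simp_all add: hom_iff)

lemma massoc_nat':
  "\<lbrakk>a \<in> Arr G; b \<in> Arr G; f \<in> Arr V; Cod G a = g; Cod G b = h; Cod V f = v;
    t \<in> Arr V; Cod V t = (Dom G a \<otimes>\<^sub>o\<^bsub>G\<^esub> Dom G b) \<odot>\<^sub>o Dom V f\<rbrakk>
    \<Longrightarrow> MAssoc M g h v \<bullet>\<^bsub>V\<^esub> ((a \<otimes>\<^sub>m\<^bsub>G\<^esub> b) \<odot>\<^sub>m f) \<bullet>\<^bsub>V\<^esub> t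
      = (a \<odot>\<^sub>m (b \<odot>\<^sub>m f)) \<bullet>\<^bsub>V\<^esub> MAssoc M (Dom G a) (Dom G b) (Dom V f) \<bullet>\<^bsub>V\<^esub> t"
  by (subst V.comp_extend[OF massoc_nat]) auto

lemma act_pentagon':
  "\<lbrakk>g \<in> Obj G; h \<in> Obj G; k \<in> Obj G; v \<in> Obj V; t \<in> Arr V;
    Cod V t = ((g \<otimes>\<^sub>o\<^bsub>G\<^esub> h) \<otimes>\<^sub>o\<^bsub>G\<^esub> k) \<odot>\<^sub>o v\<rbrakk>
    \<Longrightarrow> (Id G g \<odot>\<^sub>m MAssoc M h k v) \<bullet>\<^bsub>V\<^esub> MAssoc M g (h \<otimes>\<^sub>o\<^bsub>G\<^esub> k) v
          \<bullet>\<^bsub>V\<^esub> (Assoc G g h k \<odot>\<^sub>m Id V v) \<bullet>\<^bsub>V\<^esub> t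
        = MAssoc M g h (k \<odot>\<^sub>o v) \<bullet>\<^bsub>V\<^esub> MAssoc M (g \<otimes>\<^sub>o\<^bsub>G\<^esub> h) k v \<bullet>\<^bsub>V\<^esub> t"
  using arg_cong[OF act_pentagon[of g h k v], of "\<lambda>s. s \<bullet>\<^bsub>V\<^esub> t"] by simp

lemma act_triangle':
  "\<lbrakk>g \<in> Obj G; v \<in> Obj V; t \<in> Arr V; Cod V t = (g \<otimes>\<^sub>o\<^bsub>G\<^esub> Unit G) \<odot>\<^sub>o v\<rbrakk>
    \<Longrightarrow> (Id G g \<odot>\<^sub>m MUnit M v) \<bullet>\<^bsub>V\<^esub> MAssoc M g (Unit G) v \<bullet>\<^bsub>V\<^esub> t
      = (RUnit G g \<odot>\<^sub>m Id V v) \<bullet>\<^bsub>V\<^esub> t"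
  by (subst V.comp_extend[OF act_triangle]) simp_all

lemma munit_nat:
  "\<lbrakk>f \<in> Arr V; Cod V f = w\<rbrakk>
    \<Longrightarrow> MUnit M w \<bullet>\<^bsub>V\<^esub> (Id G (Unit G) \<odot>\<^sub>m f) = f \<bullet>\<^bsub>V\<^esub> MUnit M (Dom V f)"
  by (rule munit_natural) (simp add: hom_iff)

lemma munit_nat':
  "\<lbrakk>f \<in> Arr V; Cod V f = w; t \<in> Arr V; Cod V t = Unit G \<odot>\<^sub>o Dom V f\<rbrakk>
    \<Longrightarrow> MUnit M w \<bullet>\<^bsub>V\<^esub> (Id G (Unit G) \<odot>\<^sub>m f) \<bullet>\<^bsub>V\<^esub> t = f \<bullet>\<^bsub>V\<^esub> MUnit M (Dom V f) \<bullet>\<^bsub>V\<^esub> t"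
  by (subst V.comp_extend[OF munit_nat]) auto

text \<open>By \<open>MUnit\<close>, acting with the unit object is naturally isomorphic to the
  identity functor, hence injective on parallel arrows.\<close>

lemma unit_act_faithful:
  assumes "Id G (Unit G) \<odot>\<^sub>m s = Id G (Unit G) \<odot>\<^sub>m t"
    and "s \<in> Arr V" "t \<in> Arr V" "Dom V s = Dom V t" "Cod V s = Cod V t"
  shows "s = t"
proof (rule V.iso_cancel_right)
  show "s \<bullet>\<^bsub>V\<^esub> MUnit M (Dom V t) = t \<bullet>\<^bsub>V\<^esub> MUnit M (Dom V t)"
    using assms munit_nat[of s "Cod V s"] munit_nat[of t "Cod V t"] by simp
qed (use assms in simp_all)

text \<open>Kelly's argument: act by the unit, use the pentagon and both triangles, and cancel.\<close>

lemma munit_act: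
  assumes [simp]: "g \<in> Obj G" "v \<in> Obj V"
  shows "MUnit M (g \<odot>\<^sub>o v) \<bullet>\<^bsub>V\<^esub> MAssoc M (Unit G) g v = LUnit G g \<odot>\<^sub>m Id V v"
proof (rule unit_act_faithful, rule V.iso_cancel_right)
  let ?e = "Unit G"
  let ?Z = "MAssoc M ?e (?e \<otimes>\<^sub>o\<^bsub>G\<^esub> g) v \<bullet>\<^bsub>V\<^esub> (Assoc G ?e ?e g \<odot>\<^sub>m Id V v)"
  have "(Id G ?e \<odot>\<^sub>m (MUnit M (g \<odot>\<^sub>o v) \<bullet>\<^bsub>V\<^esub> MAssoc M ?e g v)) \<bullet>\<^bsub>V\<^esub> ?Z
      = (Id G ?e \<odot>\<^sub>m MUnit M (g \<odot>\<^sub>o v)) \<bullet>\<^bsub>V\<^esub> MAssoc M ?e ?e (g \<odot>\<^sub>o v)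
        \<bullet>\<^bsub>V\<^esub> MAssoc M (?e \<otimes>\<^sub>o\<^bsub>G\<^esub> ?e) g v"
    by (simp add: act_comp_right act_pentagon)
  also have "\<dots> = (RUnit G ?e \<odot>\<^sub>m (Id G g \<odot>\<^sub>m Id V v)) \<bullet>\<^bsub>V\<^esub> MAssoc M (?e \<otimes>\<^sub>o\<^bsub>G\<^esub> ?e) g v"
    by (simp add: act_triangle')
  also have "\<dots> = MAssoc M ?e g v \<bullet>\<^bsub>V\<^esub> ((RUnit G ?e \<otimes>\<^sub>m\<^bsub>G\<^esub> Id G g) \<odot>\<^sub>m Id V v)"
    by (simp add: massoc_nat)
  also have "\<dots> = MAssoc M ?e g v \<bullet>\<^bsub>V\<^esub> ((Id G ?e \<otimes>\<^sub>m\<^bsub>G\<^esub> LUnit G g) \<odot>\<^sub>m Id V v)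
      \<bullet>\<^bsub>V\<^esub> (Assoc G ?e ?e g \<odot>\<^sub>m Id V v)"
    by (simp add: G.triangle[symmetric] act_comp_left)
  also have "\<dots> = (Id G ?e \<odot>\<^sub>m (LUnit G g \<odot>\<^sub>m Id V v)) \<bullet>\<^bsub>V\<^esub> ?Z"
    by (simp add: massoc_nat')
  finally show "(Id G ?e \<odot>\<^sub>m (MUnit M (g \<odot>\<^sub>o v) \<bullet>\<^bsub>V\<^esub> MAssoc M ?e g v)) \<bullet>\<^bsub>V\<^esub> ?Z
      = (Id G ?e \<odot>\<^sub>m (LUnit G g \<odot>\<^sub>m Id V v)) \<bullet>\<^bsub>V\<^esub> ?Z" .
qed simp_all

end

text \<open>The monoidal category as a module over itself: the module laws become the monoidal
  axioms, so the lemmas on actions are reused for tensor products. With \<open>LUnit\<close> in the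
  role of \<open>MUnit\<close>, Kelly's identity becomes \<open>lunit_tens\<close>.\<close>

definition regular_action :: "('g, 'gm, 'z) mon_cat_scheme \<Rightarrow> ('g, 'gm, 'g, 'gm) action"
  where "regular_action G = \<lparr>ActO = TensO G, ActM = TensM G, MAssoc = Assoc G, MUnit = LUnit G\<rparr>"

context monoidal_category
begin

lemma regular_module: "left_module_category G G (regular_action G)"
  by unfold_locales
    (auto simp: regular_action_def tens_hom tens_comp assoc_iso assoc_natural lunit_iso
      lunit_natural pentagon triangle)

interpretation R: left_module_category G G "regular_action G"
  rewrites "ActO (regular_action G) = TensO G" and "ActM (regular_action G) = TensM G"
    and "MAssoc (regular_action G) = Assoc G" and "MUnit (regular_action G) = LUnit G"
  by (rule regular_module) (simp_all add: regular_action_def)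

lemmas iso_arr_tens [simp] = R.iso_arr_act
  and tens_interchange' = R.act_interchange'
  and assoc_nat = R.massoc_nat
  and assoc_nat' = R.massoc_nat'
  and pentagon' = R.act_pentagon'
  and triangle' = R.act_triangle'
  and lunit_nat = R.munit_nat
  and lunit_tens = R.munit_act

end

context monoidal_category
begin

lemma runit_nat:
  "\<lbrakk>f \<in> Arr G; Cod G f = y\<rbrakk> \<Longrightarrow> RUnit G y \<bullet> (f \<otimes>\<^sub>m Id G (Unit G)) = f \<bullet> RUnit G (Dom G f)"
  by (rule runit_natural) (simp add: hom_iff)

lemma tens_unit_faithful:
  assumes "s \<otimes>\<^sub>m Id G (Unit G) = t \<otimes>\<^sub>m Id G (Unit G)"
    and "s \<in> Arr G" "t \<in> Arr G" "Dom G s = Dom G t" "Cod G s = Cod G t"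
  shows "s = t"
proof (rule iso_cancel_right)
  show "s \<bullet> RUnit G (Dom G t) = t \<bullet> RUnit G (Dom G t)"
    using assms runit_nat[of s _] runit_nat[of t _] by simp
qed (use assms in simp_all)

text \<open>Naturality of \<open>LUnit\<close> along \<open>LUnit\<close> at the unit object
  identifies two arrows out of a triple tensor product; composed with the associator,
  \<open>lunit_tens\<close> and \<open>triangle\<close> read them as \<open>LUnit\<close> and
  \<open>RUnit\<close> tensored with the unit object, and that tensoring is faithful.\<close>

lemma lunit_unit_eq_runit_unit: "LUnit G (Unit G) = RUnit G (Unit G)"
proof (rule tens_unit_faithful)
  let ?e = "Unit G"
  have "LUnit G (?e \<otimes>\<^sub>o ?e) = Id G ?e \<otimes>\<^sub>m LUnit G ?e"
  proof (rule iso_cancel_left)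
    show "LUnit G ?e \<bullet> LUnit G (?e \<otimes>\<^sub>o ?e) = LUnit G ?e \<bullet> (Id G ?e \<otimes>\<^sub>m LUnit G ?e)"
      by (simp add: lunit_nat)
  qed simp_all
  then show "LUnit G ?e \<otimes>\<^sub>m Id G ?e = RUnit G ?e \<otimes>\<^sub>m Id G ?e"
    by (simp add: lunit_tens[symmetric] triangle[symmetric])
qed simp_all

text \<open>The mirror image of \<open>lunit_tens\<close>. The regular action does not involve
  \<open>RUnit\<close>, so Kelly's argument is repeated on the right, with the pentagon at
  \<open>x\<close>, \<open>y\<close> and two unit objects.\<close>

lemma runit_tens:
  assumes [simp]: "x \<in> Obj G" "y \<in> Obj G"
  shows "(Id G x \<otimes>\<^sub>m RUnit G y) \<bullet> Assoc G x y (Unit G) = RUnit G (x \<otimes>\<^sub>o y)"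
proof (rule tens_unit_faithful, rule iso_cancel_left)
  let ?e = "Unit G"
  have "Assoc G x y ?e \<bullet> (((Id G x \<otimes>\<^sub>m RUnit G y) \<bullet> Assoc G x y ?e) \<otimes>\<^sub>m Id G ?e)
      = (Id G x \<otimes>\<^sub>m (RUnit G y \<otimes>\<^sub>m Id G ?e)) \<bullet> Assoc G x (y \<otimes>\<^sub>o ?e) ?e
        \<bullet> (Assoc G x y ?e \<otimes>\<^sub>m Id G ?e)"
    by (simp add: tens_comp_left assoc_nat')
  also have "\<dots> = (Id G x \<otimes>\<^sub>m (Id G y \<otimes>\<^sub>m LUnit G ?e)) \<bullet> (Id G x \<otimes>\<^sub>m Assoc G y ?e ?e)
      \<bullet> Assoc G x (y \<otimes>\<^sub>o ?e) ?e \<bullet> (Assoc G x y ?e \<otimes>\<^sub>m Id G ?e)"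
    by (simp add: triangle[symmetric] tens_comp_right)
  also have "\<dots> = (Id G x \<otimes>\<^sub>m (Id G y \<otimes>\<^sub>m LUnit G ?e)) \<bullet> Assoc G x y (?e \<otimes>\<^sub>o ?e)
      \<bullet> Assoc G (x \<otimes>\<^sub>o y) ?e ?e"
    by (simp add: pentagon)
  \<comment> \<open>The identity of \<open>x \<otimes> y\<close> is split into a tensor product of
    identities because naturality of the associator only matches in that form. As
    \<open>tens_id_simp\<close> rewrites the other way, the law is applied by \<open>subst\<close>;
    the same device recurs below.\<close>
  also have "\<dots> = Assoc G x y ?e \<bullet> ((Id G x \<otimes>\<^sub>m Id G y) \<otimes>\<^sub>m LUnit G ?e) \<bullet> Assoc G (x \<otimes>\<^sub>o y) ?e ?e"
    by (subst assoc_nat') simp_all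
  also have "\<dots> = Assoc G x y ?e \<bullet> (RUnit G (x \<otimes>\<^sub>o y) \<otimes>\<^sub>m Id G ?e)"
    by (simp add: triangle)
  finally show "Assoc G x y ?e \<bullet> (((Id G x \<otimes>\<^sub>m RUnit G y) \<bullet> Assoc G x y ?e) \<otimes>\<^sub>m Id G ?e)
      = Assoc G x y ?e \<bullet> (RUnit G (x \<otimes>\<^sub>o y) \<otimes>\<^sub>m Id G ?e)" .
qed simp_all

end

section \<open>Mates and coevaluations\<close>

lemma (in two_group) iso_arr_simp [simp]: "f \<in> Arr G \<Longrightarrow> iso_arr G f"
  using arr_invertible[of f "Dom G f" "Cod G f"] by (simp add: hom_iff Iso_iff)

context two_group_with_duals
begin

lemma dual_simps [simp]:
  assumes "g \<in> Obj G"
  shows "Dual G g \<in> Obj G"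
    "Ev G g \<in> Arr G" "Dom G (Ev G g) = Dual G g \<otimes>\<^sub>o g" "Cod G (Ev G g) = Unit G"
    "Coev G g \<in> Arr G" "Dom G (Coev G g) = Unit G" "Cod G (Coev G g) = g \<otimes>\<^sub>o Dual G g"
  using dual_obj[OF assms] ev_iso[OF assms] coev_iso[OF assms]
  by (auto simp: Iso_iff intro: iso_arr_arr)

lemma mate_simps [simp]:
  assumes "h \<in> Obj G" "d \<in> Obj G" "c \<in> Arr G" "Dom G c = Unit G" "Cod G c = h \<otimes>\<^sub>o d"
  shows "mate G h d c \<in> Arr G" "Dom G (mate G h d c) = Dual G h" "Cod G (mate G h d c) = d"
  using assms by (simp_all add: mate_def)

text \<open>Precomposing with an associator and applying the pentagon gathers everything except
  \<open>d\<close> in one left tensor factor, where \<open>snake\<close> applies;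
  \<open>lunit_tens\<close> then restores the unit. The bracketing is the one that arises in
  \<open>mate_coev\<close>.\<close>

lemma snake_tens:
  assumes [simp]: "h \<in> Obj G" "d \<in> Obj G"
  shows "(Id G h \<otimes>\<^sub>m LUnit G d) \<bullet> (Id G h \<otimes>\<^sub>m (Ev G h \<otimes>\<^sub>m Id G d))
    \<bullet> (Id G h \<otimes>\<^sub>m inv_arr G (Assoc G (Dual G h) h d)) \<bullet> Assoc G h (Dual G h) (h \<otimes>\<^sub>o d)
    \<bullet> (Coev G h \<otimes>\<^sub>m Id G (h \<otimes>\<^sub>o d)) = LUnit G (h \<otimes>\<^sub>o d)" (is "?l = _")
proof (rule iso_cancel_right)
  let ?a = "Assoc G" and ?i = "Id G" and ?e = "Unit G"
  let ?h = "Dual G h"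
  have "?l \<bullet> ?a ?e h d = (?i h \<otimes>\<^sub>m LUnit G d) \<bullet> (?i h \<otimes>\<^sub>m (Ev G h \<otimes>\<^sub>m ?i d))
    \<bullet> (?i h \<otimes>\<^sub>m inv_arr G (?a ?h h d)) \<bullet> ?a h ?h (h \<otimes>\<^sub>o d) \<bullet> ?a (h \<otimes>\<^sub>o ?h) h d
    \<bullet> ((Coev G h \<otimes>\<^sub>m ?i h) \<otimes>\<^sub>m ?i d)"
    by (simp add: assoc_nat)
  also have "\<dots> = (?i h \<otimes>\<^sub>m LUnit G d) \<bullet> (?i h \<otimes>\<^sub>m (Ev G h \<otimes>\<^sub>m ?i d))
    \<bullet> ?a h (?h \<otimes>\<^sub>o h) d \<bullet> (?a h ?h h \<otimes>\<^sub>m ?i d)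
    \<bullet> ((Coev G h \<otimes>\<^sub>m ?i h) \<otimes>\<^sub>m ?i d)"
    by (simp add: pentagon'[symmetric] tens_interchange')
  also have "\<dots> = (?i h \<otimes>\<^sub>m LUnit G d) \<bullet> ?a h ?e d \<bullet> ((?i h \<otimes>\<^sub>m Ev G h) \<otimes>\<^sub>m ?i d)
    \<bullet> (?a h ?h h \<otimes>\<^sub>m ?i d) \<bullet> ((Coev G h \<otimes>\<^sub>m ?i h) \<otimes>\<^sub>m ?i d)"
    by (simp add: assoc_nat')
  also have "\<dots> = (RUnit G h \<bullet> (?i h \<otimes>\<^sub>m Ev G h) \<bullet> ?a h ?h h \<bullet> (Coev G h \<otimes>\<^sub>m ?i h)) \<otimes>\<^sub>m ?i d"
    by (simp add: triangle' tens_comp_left)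
  \<comment> \<open>\<open>snake\<close> begins with the inverse of \<open>LUnit G h\<close>;
    composing with \<open>LUnit G h\<close> removes it.\<close>
  also have "RUnit G h \<bullet> (?i h \<otimes>\<^sub>m Ev G h) \<bullet> ?a h ?h h \<bullet> (Coev G h \<otimes>\<^sub>m ?i h) = LUnit G h"
    using arg_cong[OF snake[of h], of "\<lambda>t. t \<bullet> LUnit G h"] by simp
  also have "LUnit G h \<otimes>\<^sub>m ?i d = LUnit G (h \<otimes>\<^sub>o d) \<bullet> ?a ?e h d"
    by (simp add: lunit_tens)
  finally show "?l \<bullet> ?a ?e h d = LUnit G (h \<otimes>\<^sub>o d) \<bullet> ?a ?e h d" .
qed simp_all

text \<open>One half of the bijection between arrows \<open>e \<rightarrow> h \<otimes> d\<close>
  and arrows \<open>h\<^sup>* \<rightarrow> d\<close>: \<open>mate\<close> bends \<open>c\<close>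
  with \<open>Ev\<close>, the coevaluation bends it back, and the snake identity straightens the
  result. Both \<open>dual_arr\<close> and \<open>dual_tens\<close> are mates, so this one identity
  serves (i) and (ii).\<close>

lemma mate_coev:
  assumes [simp]: "h \<in> Obj G" "d \<in> Obj G" "c \<in> Arr G" "Dom G c = Unit G" "Cod G c = h \<otimes>\<^sub>o d"
  shows "(Id G h \<otimes>\<^sub>m mate G h d c) \<bullet> Coev G h = c"
proof (rule iso_cancel_right)
  let ?a = "Assoc G" and ?i = "Id G" and ?e = "Unit G"
  let ?h = "Dual G h"
  \<comment> \<open>Moves the inverse right unit that begins \<open>mate\<close> past
    \<open>Coev\<close>, by naturality of \<open>RUnit\<close> and
    \<open>runit_tens\<close>.\<close>
  have r: "(?i h \<otimes>\<^sub>m inv_arr G (RUnit G ?h)) \<bullet> Coev G h \<bullet> RUnit G ?e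
      = ?a h ?h ?e \<bullet> (Coev G h \<otimes>\<^sub>m ?i ?e)"
  proof (rule iso_cancel_left)
    show "(?i h \<otimes>\<^sub>m RUnit G ?h) \<bullet> (?i h \<otimes>\<^sub>m inv_arr G (RUnit G ?h)) \<bullet> Coev G h \<bullet> RUnit G ?e
      = (?i h \<otimes>\<^sub>m RUnit G ?h) \<bullet> ?a h ?h ?e \<bullet> (Coev G h \<otimes>\<^sub>m ?i ?e)"
      by (simp add: tens_interchange' comp_extend[OF runit_tens] runit_nat)
  qed simp_all
  have "((?i h \<otimes>\<^sub>m mate G h d c) \<bullet> Coev G h) \<bullet> RUnit G ?e
    = (?i h \<otimes>\<^sub>m LUnit G d) \<bullet> (?i h \<otimes>\<^sub>m (Ev G h \<otimes>\<^sub>m ?i d)) \<bullet> (?i h \<otimes>\<^sub>m inv_arr G (?a ?h h d))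
      \<bullet> (?i h \<otimes>\<^sub>m (?i ?h \<otimes>\<^sub>m c)) \<bullet> ?a h ?h ?e \<bullet> (Coev G h \<otimes>\<^sub>m ?i ?e)"
    by (simp add: mate_def tens_comp_right r)
  also have "(?i h \<otimes>\<^sub>m (?i ?h \<otimes>\<^sub>m c)) \<bullet> ?a h ?h ?e \<bullet> (Coev G h \<otimes>\<^sub>m ?i ?e)
    = ?a h ?h (h \<otimes>\<^sub>o d) \<bullet> ((?i h \<otimes>\<^sub>m ?i ?h) \<otimes>\<^sub>m c) \<bullet> (Coev G h \<otimes>\<^sub>m ?i ?e)"
    by (subst assoc_nat') simp_all
  \<comment> \<open>\<open>c\<close> and \<open>Coev\<close> sit in different tensor factors and may
    be exchanged; \<open>Coev\<close> then stands next to \<open>Ev\<close> and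
    \<open>snake_tens\<close> applies.\<close>
  also have "((?i h \<otimes>\<^sub>m ?i ?h) \<otimes>\<^sub>m c) \<bullet> (Coev G h \<otimes>\<^sub>m ?i ?e)
    = (Coev G h \<otimes>\<^sub>m ?i (h \<otimes>\<^sub>o d)) \<bullet> (?i ?e \<otimes>\<^sub>m c)"
    by (simp add: tens_interchange)
  also have "(?i h \<otimes>\<^sub>m LUnit G d) \<bullet> (?i h \<otimes>\<^sub>m (Ev G h \<otimes>\<^sub>m ?i d))
    \<bullet> (?i h \<otimes>\<^sub>m inv_arr G (?a ?h h d)) \<bullet> ?a h ?h (h \<otimes>\<^sub>o d)
    \<bullet> (Coev G h \<otimes>\<^sub>m ?i (h \<otimes>\<^sub>o d)) \<bullet> (?i ?e \<otimes>\<^sub>m c) = LUnit G (h \<otimes>\<^sub>o d) \<bullet> (?i ?e \<otimes>\<^sub>m c)"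
    using arg_cong[OF snake_tens[of h d], of "\<lambda>t. t \<bullet> (?i ?e \<otimes>\<^sub>m c)"] by simp
  \<comment> \<open>The snake leaves \<open>LUnit\<close> at the unit object, while the right unit
    in \<open>mate\<close> asks for \<open>RUnit\<close>; the two agree there.\<close>
  also have "\<dots> = c \<bullet> RUnit G ?e"
    by (simp add: lunit_nat lunit_unit_eq_runit_unit)
  finally show "((?i h \<otimes>\<^sub>m mate G h d c) \<bullet> Coev G h) \<bullet> RUnit G ?e = c \<bullet> RUnit G ?e" .
qed simp_all

lemma star_arr_simps [simp]:
  assumes "a \<in> Arr G"
  shows "star_arr G a \<in> Arr G" "Dom G (star_arr G a) = Dual G (Dom G a)"
    "Cod G (star_arr G a) = Dual G (Cod G a)"
  using assms by (simp_all add: star_arr_def dual_arr_def)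

text \<open>\<open>dual_arr a\<close> is the mate of \<open>a\<close> applied to the coevaluation of
  its source. By \<open>mate_coev\<close>, that arrow is therefore \<open>dual_arr a\<close> applied
  to the coevaluation of the target, and \<open>star_arr a\<close>, the inverse of
  \<open>dual_arr a\<close>, cancels it.\<close>

lemma star_arr_coev:
  assumes [simp]: "a \<in> Arr G"
  shows "(a \<otimes>\<^sub>m star_arr G a) \<bullet> Coev G (Dom G a) = Coev G (Cod G a)"
proof -
  let ?g = "Dom G a" and ?h = "Cod G a"
  have [simp]: "dual_arr G a \<in> Arr G" "Dom G (dual_arr G a) = Dual G ?h"
      "Cod G (dual_arr G a) = Dual G ?g"
    by (simp_all add: dual_arr_def)
  have "(a \<otimes>\<^sub>m star_arr G a) \<bullet> Coev G ?g
      = (Id G ?h \<otimes>\<^sub>m star_arr G a) \<bullet> (a \<otimes>\<^sub>m Id G (Dual G ?g)) \<bullet> Coev G ?g"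
    by (simp add: tens_interchange')
  also have "(a \<otimes>\<^sub>m Id G (Dual G ?g)) \<bullet> Coev G ?g = (Id G ?h \<otimes>\<^sub>m dual_arr G a) \<bullet> Coev G ?h"
    unfolding dual_arr_def by (simp add: mate_coev)
  also have "(Id G ?h \<otimes>\<^sub>m star_arr G a) \<bullet> \<dots> = Coev G ?h"
    by (simp add: star_arr_def tens_interchange')
  finally show ?thesis .
qed

lemma coev_tens_simps [simp]:
  assumes "g \<in> Obj G" "h \<in> Obj G"
  shows "coev_tens G g h \<in> Arr G" "Dom G (coev_tens G g h) = Unit G"
    "Cod G (coev_tens G g h) = (g \<otimes>\<^sub>o h) \<otimes>\<^sub>o (Dual G h \<otimes>\<^sub>o Dual G g)"
  using assms by (simp_all add: coev_tens_def)

lemma dual_tens_simps [simp]: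
  assumes "g \<in> Obj G" "h \<in> Obj G"
  shows "dual_tens G g h \<in> Arr G" "Dom G (dual_tens G g h) = Dual G (g \<otimes>\<^sub>o h)"
    "Cod G (dual_tens G g h) = Dual G h \<otimes>\<^sub>o Dual G g"
  using assms by (simp_all add: dual_tens_def)

lemma dual_tens_coev:
  "\<lbrakk>g \<in> Obj G; h \<in> Obj G\<rbrakk>
    \<Longrightarrow> (Id G (g \<otimes>\<^sub>o h) \<otimes>\<^sub>m dual_tens G g h) \<bullet> Coev G (g \<otimes>\<^sub>o h) = coev_tens G g h"
  unfolding dual_tens_def by (rule mate_coev) simp_all

end

section \<open>Conjugation of natural transformations\<close>

context left_module_category
begin

lemma inv_massoc_nat:
  assumes [simp]: "a \<in> Arr G" "b \<in> Arr G" "f \<in> Arr V"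
    and eqs: "Cod G a = g" "Cod G b = h" "Cod V f = v"
  shows "inv_arr V (MAssoc M g h v) \<bullet>\<^bsub>V\<^esub> (a \<odot>\<^sub>m (b \<odot>\<^sub>m f))
      = ((a \<otimes>\<^sub>m\<^bsub>G\<^esub> b) \<odot>\<^sub>m f) \<bullet>\<^bsub>V\<^esub> inv_arr V (MAssoc M (Dom G a) (Dom G b) (Dom V f))"
  unfolding eqs[symmetric] by (rule V.inv_square[OF massoc_nat]) simp_all

lemma inv_massoc_nat':
  assumes [simp]: "a \<in> Arr G" "b \<in> Arr G" "f \<in> Arr V"
    and eqs [simp]: "Cod G a = g" "Cod G b = h" "Cod V f = v"
    and [simp]: "t \<in> Arr V" "Cod V t = Dom G a \<odot>\<^sub>o Dom G b \<odot>\<^sub>o Dom V f"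
  shows "inv_arr V (MAssoc M g h v) \<bullet>\<^bsub>V\<^esub> (a \<odot>\<^sub>m (b \<odot>\<^sub>m f)) \<bullet>\<^bsub>V\<^esub> t
      = ((a \<otimes>\<^sub>m\<^bsub>G\<^esub> b) \<odot>\<^sub>m f) \<bullet>\<^bsub>V\<^esub> inv_arr V (MAssoc M (Dom G a) (Dom G b) (Dom V f)) \<bullet>\<^bsub>V\<^esub> t"
  using V.comp_extend[OF inv_massoc_nat[of a b f g h v], of t] by (simp flip: eqs)

lemma inv_munit_nat:
  assumes [simp]: "f \<in> Arr V" and eq: "Cod V f = w"
  shows "inv_arr V (MUnit M w) \<bullet>\<^bsub>V\<^esub> f
    = (Id G (Unit G) \<odot>\<^sub>m f) \<bullet>\<^bsub>V\<^esub> inv_arr V (MUnit M (Dom V f))"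
  unfolding eq[symmetric] by (rule V.inv_square[OF munit_nat]) simp_all

abbreviation char_carrier :: "'g \<Rightarrow> ('v \<Rightarrow> 'vm) set"
  where "char_carrier x \<equiv> NatTrans V V id_functor (act_functor G M x)"

lemma char_carrier_simps:
  assumes "\<alpha> \<in> char_carrier x" "v \<in> Obj V"
  shows "\<alpha> v \<in> Arr V" "Dom V (\<alpha> v) = v" "Cod V (\<alpha> v) = x \<odot>\<^sub>o v"
  using assms by (auto simp: NatTrans_def id_functor_def act_functor_def PiE_def Pi_def hom_iff)

lemma char_carrier_nat:
  "\<lbrakk>\<alpha> \<in> char_carrier x; f \<in> Arr V; Cod V f = w\<rbrakk>
    \<Longrightarrow> \<alpha> w \<bullet>\<^bsub>V\<^esub> f = (Id G x \<odot>\<^sub>m f) \<bullet>\<^bsub>V\<^esub> \<alpha> (Dom V f)"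
  by (auto simp: NatTrans_def id_functor_def act_functor_def)

lemma char_carrierI:
  assumes "\<alpha> \<in> extensional (Obj V)"
    and "\<And>v. v \<in> Obj V \<Longrightarrow> \<alpha> v \<in> Arr V \<and> Dom V (\<alpha> v) = v \<and> Cod V (\<alpha> v) = x \<odot>\<^sub>o v"
    and "\<And>f. f \<in> Arr V \<Longrightarrow> \<alpha> (Cod V f) \<bullet>\<^bsub>V\<^esub> f = (Id G x \<odot>\<^sub>m f) \<bullet>\<^bsub>V\<^esub> \<alpha> (Dom V f)"
  shows "\<alpha> \<in> char_carrier x"
  using assms by (auto simp: NatTrans_def id_functor_def act_functor_def PiE_def Pi_def hom_iff)

lemma char_carrier_eqI:
  assumes "\<alpha> \<in> char_carrier x" "\<beta> \<in> char_carrier x" "\<And>v. v \<in> Obj V \<Longrightarrow> \<alpha> v = \<beta> v"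
  shows "\<alpha> = \<beta>"
  using assms by (auto simp: NatTrans_def PiE_def intro: extensionalityI)

text \<open>The conjugation invariance, with the coevaluation replaced by any \<open>c : e \<rightarrow> g \<otimes> d\<close>.\<close>

definition conj_comp :: "'g \<Rightarrow> 'g \<Rightarrow> 'gm \<Rightarrow> 'g \<Rightarrow> ('v \<Rightarrow> 'vm) \<Rightarrow> 'v \<Rightarrow> 'vm"
  where "conj_comp g d c x \<alpha> v =
    inv_arr V (MAssoc M (g \<otimes>\<^sub>o\<^bsub>G\<^esub> x) d v)
    \<bullet>\<^bsub>V\<^esub> inv_arr V (MAssoc M g x (d \<odot>\<^sub>o v))
    \<bullet>\<^bsub>V\<^esub> (Id G g \<odot>\<^sub>m \<alpha> (d \<odot>\<^sub>o v))
    \<bullet>\<^bsub>V\<^esub> MAssoc M g d v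
    \<bullet>\<^bsub>V\<^esub> (c \<odot>\<^sub>m Id V v)
    \<bullet>\<^bsub>V\<^esub> inv_arr V (MUnit M v)"

lemma conj_comp_simps:
  assumes "\<alpha> \<in> char_carrier x"
    and "g \<in> Obj G" "d \<in> Obj G" "c \<in> Arr G" "Dom G c = Unit G" "Cod G c = g \<otimes>\<^sub>o\<^bsub>G\<^esub> d"
    and "x \<in> Obj G" "v \<in> Obj V"
  shows "conj_comp g d c x \<alpha> v \<in> Arr V" "Dom V (conj_comp g d c x \<alpha> v) = v"
    "Cod V (conj_comp g d c x \<alpha> v) = ((g \<otimes>\<^sub>o\<^bsub>G\<^esub> x) \<otimes>\<^sub>o\<^bsub>G\<^esub> d) \<odot>\<^sub>o v"
proof -
  note [simp] = char_carrier_simps[OF assms(1)] and [simp] = assms(2-)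
  show "conj_comp g d c x \<alpha> v \<in> Arr V" "Dom V (conj_comp g d c x \<alpha> v) = v"
    "Cod V (conj_comp g d c x \<alpha> v) = ((g \<otimes>\<^sub>o\<^bsub>G\<^esub> x) \<otimes>\<^sub>o\<^bsub>G\<^esub> d) \<odot>\<^sub>o v"
    by (simp_all add: conj_comp_def)
qed

text \<open>All naturality of conjugation in one square. Varying only \<open>\<phi>\<close> shows
  that the result is again a natural transformation; varying only \<open>f\<close> gives naturality
  of \<open>\<psi>\<close> in the conjugated object; \<open>b = dual_tens G g h\<close> changes the
  dual in (i); \<open>a\<close> together with \<open>b = star_arr G a\<close> gives (ii).\<close>

lemma conj_comp_natural:
  assumes \<alpha>: "\<alpha> \<in> char_carrier (Dom G f)"
    and [simp]: "f \<in> Arr G" "a \<in> Arr G" "b \<in> Arr G" "\<phi> \<in> Arr V" "c \<in> Arr G" "Dom G c = Unit G"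
      "Cod G c = Dom G a \<otimes>\<^sub>o\<^bsub>G\<^esub> Dom G b"
  shows "conj_comp (Cod G a) (Cod G b) ((a \<otimes>\<^sub>m\<^bsub>G\<^esub> b) \<bullet>\<^bsub>G\<^esub> c) (Cod G f)
      (\<lambda>w\<in>Obj V. (f \<odot>\<^sub>m Id V w) \<bullet>\<^bsub>V\<^esub> \<alpha> w) (Cod V \<phi>) \<bullet>\<^bsub>V\<^esub> \<phi>
    = (((a \<otimes>\<^sub>m\<^bsub>G\<^esub> f) \<otimes>\<^sub>m\<^bsub>G\<^esub> b) \<odot>\<^sub>m \<phi>)
      \<bullet>\<^bsub>V\<^esub> conj_comp (Dom G a) (Dom G b) c (Dom G f) \<alpha> (Dom V \<phi>)"
proof -
  note [simp] = char_carrier_simps[OF \<alpha>]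
  let ?g = "Dom G a" and ?h = "Cod G a" and ?d = "Dom G b" and ?d' = "Cod G b"
    and ?x = "Dom G f" and ?y = "Cod G f" and ?v = "Dom V \<phi>" and ?w = "Cod V \<phi>"
  let ?A = "inv_arr V (MAssoc M (?h \<otimes>\<^sub>o\<^bsub>G\<^esub> ?y) ?d' ?w) \<bullet>\<^bsub>V\<^esub> inv_arr V (MAssoc M ?h ?y (?d' \<odot>\<^sub>o ?w))"
  let ?Q = "MAssoc M ?g ?d ?v \<bullet>\<^bsub>V\<^esub> (c \<odot>\<^sub>m Id V ?v) \<bullet>\<^bsub>V\<^esub> inv_arr V (MUnit M ?v)"
  \<comment> \<open>The one place in this computation where naturality of \<open>\<alpha>\<close>
    enters; the rest is interchange and naturality of the structure isomorphisms.\<close>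
  have *: "\<alpha> (?d' \<odot>\<^sub>o ?w) \<bullet>\<^bsub>V\<^esub> (b \<odot>\<^sub>m \<phi>) = (Id G ?x \<odot>\<^sub>m (b \<odot>\<^sub>m \<phi>)) \<bullet>\<^bsub>V\<^esub> \<alpha> (?d \<odot>\<^sub>o ?v)"
    by (simp add: char_carrier_nat[OF \<alpha>])
  have "conj_comp ?h ?d' ((a \<otimes>\<^sub>m\<^bsub>G\<^esub> b) \<bullet>\<^bsub>G\<^esub> c) ?y
      (\<lambda>w\<in>Obj V. (f \<odot>\<^sub>m Id V w) \<bullet>\<^bsub>V\<^esub> \<alpha> w) ?w \<bullet>\<^bsub>V\<^esub> \<phi>
    = ?A \<bullet>\<^bsub>V\<^esub> (Id G ?h \<odot>\<^sub>m ((f \<odot>\<^sub>m Id V (?d' \<odot>\<^sub>o ?w)) \<bullet>\<^bsub>V\<^esub> \<alpha> (?d' \<odot>\<^sub>o ?w)))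
      \<bullet>\<^bsub>V\<^esub> MAssoc M ?h ?d' ?w \<bullet>\<^bsub>V\<^esub> (((a \<otimes>\<^sub>m\<^bsub>G\<^esub> b) \<bullet>\<^bsub>G\<^esub> c) \<odot>\<^sub>m \<phi>) \<bullet>\<^bsub>V\<^esub> inv_arr V (MUnit M ?v)"
    by (simp add: conj_comp_def inv_munit_nat act_interchange')
  also have "((a \<otimes>\<^sub>m\<^bsub>G\<^esub> b) \<bullet>\<^bsub>G\<^esub> c) \<odot>\<^sub>m \<phi> = ((a \<otimes>\<^sub>m\<^bsub>G\<^esub> b) \<odot>\<^sub>m \<phi>) \<bullet>\<^bsub>V\<^esub> (c \<odot>\<^sub>m Id V ?v)"
    by (simp add: act_interchange)
  also have "?A \<bullet>\<^bsub>V\<^esub> (Id G ?h \<odot>\<^sub>m ((f \<odot>\<^sub>m Id V (?d' \<odot>\<^sub>o ?w)) \<bullet>\<^bsub>V\<^esub> \<alpha> (?d' \<odot>\<^sub>o ?w)))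
      \<bullet>\<^bsub>V\<^esub> MAssoc M ?h ?d' ?w \<bullet>\<^bsub>V\<^esub> (((a \<otimes>\<^sub>m\<^bsub>G\<^esub> b) \<odot>\<^sub>m \<phi>) \<bullet>\<^bsub>V\<^esub> (c \<odot>\<^sub>m Id V ?v))
      \<bullet>\<^bsub>V\<^esub> inv_arr V (MUnit M ?v)
    = ?A \<bullet>\<^bsub>V\<^esub> (Id G ?h \<odot>\<^sub>m ((f \<odot>\<^sub>m Id V (?d' \<odot>\<^sub>o ?w)) \<bullet>\<^bsub>V\<^esub> \<alpha> (?d' \<odot>\<^sub>o ?w)))
      \<bullet>\<^bsub>V\<^esub> (a \<odot>\<^sub>m (b \<odot>\<^sub>m \<phi>)) \<bullet>\<^bsub>V\<^esub> ?Q"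
    by (simp add: massoc_nat')
  also have "\<dots> = ?A \<bullet>\<^bsub>V\<^esub> (a \<odot>\<^sub>m ((f \<odot>\<^sub>m Id V (?d' \<odot>\<^sub>o ?w)) \<bullet>\<^bsub>V\<^esub> \<alpha> (?d' \<odot>\<^sub>o ?w) \<bullet>\<^bsub>V\<^esub> (b \<odot>\<^sub>m \<phi>))) \<bullet>\<^bsub>V\<^esub> ?Q"
    by (simp add: act_interchange')
  also have "\<dots> = ?A \<bullet>\<^bsub>V\<^esub> (a \<odot>\<^sub>m (f \<odot>\<^sub>m (b \<odot>\<^sub>m \<phi>))) \<bullet>\<^bsub>V\<^esub> (Id G ?g \<odot>\<^sub>m \<alpha> (?d \<odot>\<^sub>o ?v)) \<bullet>\<^bsub>V\<^esub> ?Q"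
    unfolding * by (simp add: act_interchange' act_interchange)
  also have "\<dots> = (((a \<otimes>\<^sub>m\<^bsub>G\<^esub> f) \<otimes>\<^sub>m\<^bsub>G\<^esub> b) \<odot>\<^sub>m \<phi>) \<bullet>\<^bsub>V\<^esub> conj_comp ?g ?d c ?x \<alpha> ?v"
    by (simp add: conj_comp_def inv_massoc_nat')
  finally show ?thesis .
qed

lemma conj_comp_in_char_carrier:
  assumes \<alpha>: "\<alpha> \<in> char_carrier x"
    and [simp]: "g \<in> Obj G" "d \<in> Obj G" "c \<in> Arr G" "Dom G c = Unit G" "Cod G c = g \<otimes>\<^sub>o\<^bsub>G\<^esub> d" "x \<in> Obj G"
  shows "(\<lambda>v\<in>Obj V. conj_comp g d c x \<alpha> v) \<in> char_carrier ((g \<otimes>\<^sub>o\<^bsub>G\<^esub> x) \<otimes>\<^sub>o\<^bsub>G\<^esub> d)"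
proof (rule char_carrierI)
  note [simp] = conj_comp_simps[OF \<alpha>] char_carrier_simps[OF \<alpha>]
  fix f assume [simp]: "f \<in> Arr V"
  \<comment> \<open>The instance of \<open>conj_comp_natural\<close> at identities speaks of
    \<open>\<alpha>\<close> restricted to the objects. The restriction is harmless, as only the
    value of \<open>\<alpha>\<close> at \<open>d \<odot> v\<close> occurs.\<close>
  have "conj_comp g d c x (\<lambda>w\<in>Obj V. \<alpha> w) v = conj_comp g d c x \<alpha> v" if "v \<in> Obj V" for v
    using that by (simp add: conj_comp_def)
  then show "(\<lambda>v\<in>Obj V. conj_comp g d c x \<alpha> v) (Cod V f) \<bullet>\<^bsub>V\<^esub> f
    = (Id G ((g \<otimes>\<^sub>o\<^bsub>G\<^esub> x) \<otimes>\<^sub>o\<^bsub>G\<^esub> d) \<odot>\<^sub>m f) \<bullet>\<^bsub>V\<^esub> (\<lambda>v\<in>Obj V. conj_comp g d c x \<alpha> v) (Dom V f)"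
    using conj_comp_natural[of \<alpha> "Id G x" "Id G g" "Id G d" f c] \<alpha>
    by (simp cong: restrict_cong)
qed (use conj_comp_simps[OF \<alpha>] in simp_all)

end

locale dual_module_category = G: two_group_with_duals G + left_module_category G V M
  for G :: "('g, 'gm, 'y) dual_mon_cat_scheme" and V :: "('v, 'vm, 'z) cat_scheme"
    and M :: "('g, 'gm, 'v, 'vm) action" (structure)
begin

text \<open>Acting on \<open>v\<close> turns the nested coevaluation into two successive insertions:
  \<open>g\<close> with its dual \<open>p\<close> around \<open>v\<close>, then \<open>h\<close>
  with its dual \<open>q\<close> around \<open>p \<odot> v\<close>. Two module pentagons, at
  \<open>g\<close>, \<open>h\<close>, \<open>q \<otimes> p\<close> and at \<open>h\<close>,
  \<open>q\<close>, \<open>p\<close>, account for the brackets.\<close>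

lemma coev_tens_act:
  assumes [simp]: "g \<in> Obj G" "h \<in> Obj G" "v \<in> Obj V"
  defines "p \<equiv> Dual G g" and "q \<equiv> Dual G h"
  shows "MAssoc M g h (q \<odot>\<^sub>o p \<odot>\<^sub>o v) \<bullet>\<^bsub>V\<^esub> (Id G (g \<otimes>\<^sub>o\<^bsub>G\<^esub> h) \<odot>\<^sub>m MAssoc M q p v)
      \<bullet>\<^bsub>V\<^esub> MAssoc M (g \<otimes>\<^sub>o\<^bsub>G\<^esub> h) (q \<otimes>\<^sub>o\<^bsub>G\<^esub> p) v \<bullet>\<^bsub>V\<^esub> (coev_tens G g h \<odot>\<^sub>m Id V v)
    = (Id G g \<odot>\<^sub>m (MAssoc M h q (p \<odot>\<^sub>o v) \<bullet>\<^bsub>V\<^esub> (Coev G h \<odot>\<^sub>m Id V (p \<odot>\<^sub>o v))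
        \<bullet>\<^bsub>V\<^esub> inv_arr V (MUnit M (p \<odot>\<^sub>o v))))
      \<bullet>\<^bsub>V\<^esub> MAssoc M g p v \<bullet>\<^bsub>V\<^esub> (Coev G g \<odot>\<^sub>m Id V v)"
proof -
  let ?a = "MAssoc M" and ?i = "Id G" and ?v = "Id V v"
  have [simp]: "p \<in> Obj G" "q \<in> Obj G" "Cod G (Coev G g) = g \<otimes>\<^sub>o\<^bsub>G\<^esub> p" "Cod G (Coev G h) = h \<otimes>\<^sub>o\<^bsub>G\<^esub> q"
    by (simp_all add: p_def q_def)
  \<comment> \<open>Initial stretches of the composite defining \<open>coev_tens\<close>. Its
    factors are peeled off from the target end, each being pulled through \<open>MAssoc\<close> by
    naturality.\<close>
  let ?c0 = "(?i g \<otimes>\<^sub>m\<^bsub>G\<^esub> inv_arr G (LUnit G p)) \<bullet>\<^bsub>G\<^esub> Coev G g"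
  let ?c1 = "(?i g \<otimes>\<^sub>m\<^bsub>G\<^esub> (Coev G h \<otimes>\<^sub>m\<^bsub>G\<^esub> ?i p)) \<bullet>\<^bsub>G\<^esub> ?c0"
  let ?c2 = "(?i g \<otimes>\<^sub>m\<^bsub>G\<^esub> Assoc G h q p) \<bullet>\<^bsub>G\<^esub> ?c1"
  have c: "coev_tens G g h = inv_arr G (Assoc G g h (q \<otimes>\<^sub>o\<^bsub>G\<^esub> p)) \<bullet>\<^bsub>G\<^esub> ?c2"
    by (simp add: coev_tens_def p_def q_def)
  have "?a g h (q \<odot>\<^sub>o p \<odot>\<^sub>o v) \<bullet>\<^bsub>V\<^esub> (?i (g \<otimes>\<^sub>o\<^bsub>G\<^esub> h) \<odot>\<^sub>m ?a q p v)
      \<bullet>\<^bsub>V\<^esub> ?a (g \<otimes>\<^sub>o\<^bsub>G\<^esub> h) (q \<otimes>\<^sub>o\<^bsub>G\<^esub> p) v \<bullet>\<^bsub>V\<^esub> (coev_tens G g h \<odot>\<^sub>m ?v)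
    = ?a g h (q \<odot>\<^sub>o p \<odot>\<^sub>o v) \<bullet>\<^bsub>V\<^esub> ((?i g \<otimes>\<^sub>m\<^bsub>G\<^esub> ?i h) \<odot>\<^sub>m ?a q p v)
      \<bullet>\<^bsub>V\<^esub> ?a (g \<otimes>\<^sub>o\<^bsub>G\<^esub> h) (q \<otimes>\<^sub>o\<^bsub>G\<^esub> p) v \<bullet>\<^bsub>V\<^esub> (coev_tens G g h \<odot>\<^sub>m ?v)"
    by simp
  also have "\<dots> = (?i g \<odot>\<^sub>m (?i h \<odot>\<^sub>m ?a q p v)) \<bullet>\<^bsub>V\<^esub> ?a g h ((q \<otimes>\<^sub>o\<^bsub>G\<^esub> p) \<odot>\<^sub>o v)
      \<bullet>\<^bsub>V\<^esub> ?a (g \<otimes>\<^sub>o\<^bsub>G\<^esub> h) (q \<otimes>\<^sub>o\<^bsub>G\<^esub> p) v \<bullet>\<^bsub>V\<^esub> (coev_tens G g h \<odot>\<^sub>m ?v)"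
    by (subst massoc_nat') (simp_all flip: p_def q_def)
  also have "\<dots> = (?i g \<odot>\<^sub>m (?i h \<odot>\<^sub>m ?a q p v)) \<bullet>\<^bsub>V\<^esub> (?i g \<odot>\<^sub>m ?a h (q \<otimes>\<^sub>o\<^bsub>G\<^esub> p) v)
      \<bullet>\<^bsub>V\<^esub> ?a g (h \<otimes>\<^sub>o\<^bsub>G\<^esub> (q \<otimes>\<^sub>o\<^bsub>G\<^esub> p)) v \<bullet>\<^bsub>V\<^esub> (?c2 \<odot>\<^sub>m ?v)"
    by (subst act_pentagon'[symmetric]) (simp_all add: c act_interchange flip: p_def q_def)
  also have "?a g (h \<otimes>\<^sub>o\<^bsub>G\<^esub> (q \<otimes>\<^sub>o\<^bsub>G\<^esub> p)) v \<bullet>\<^bsub>V\<^esub> (?c2 \<odot>\<^sub>m ?v)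
    = (?i g \<odot>\<^sub>m (Assoc G h q p \<odot>\<^sub>m ?v)) \<bullet>\<^bsub>V\<^esub> ?a g ((h \<otimes>\<^sub>o\<^bsub>G\<^esub> q) \<otimes>\<^sub>o\<^bsub>G\<^esub> p) v \<bullet>\<^bsub>V\<^esub> (?c1 \<odot>\<^sub>m ?v)"
    by (subst act_comp_left) (simp_all add: massoc_nat')
  also have "?a g ((h \<otimes>\<^sub>o\<^bsub>G\<^esub> q) \<otimes>\<^sub>o\<^bsub>G\<^esub> p) v \<bullet>\<^bsub>V\<^esub> (?c1 \<odot>\<^sub>m ?v)
    = (?i g \<odot>\<^sub>m ((Coev G h \<otimes>\<^sub>m\<^bsub>G\<^esub> ?i p) \<odot>\<^sub>m ?v)) \<bullet>\<^bsub>V\<^esub> ?a g (Unit G \<otimes>\<^sub>o\<^bsub>G\<^esub> p) v \<bullet>\<^bsub>V\<^esub> (?c0 \<odot>\<^sub>m ?v)"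
    by (subst act_comp_left) (simp_all add: massoc_nat')
  also have "?a g (Unit G \<otimes>\<^sub>o\<^bsub>G\<^esub> p) v \<bullet>\<^bsub>V\<^esub> (?c0 \<odot>\<^sub>m ?v)
    = (?i g \<odot>\<^sub>m (inv_arr G (LUnit G p) \<odot>\<^sub>m ?v)) \<bullet>\<^bsub>V\<^esub> ?a g p v \<bullet>\<^bsub>V\<^esub> (Coev G g \<odot>\<^sub>m ?v)"
    by (subst act_comp_left) (simp_all add: massoc_nat')
  also have "(?i g \<odot>\<^sub>m (?i h \<odot>\<^sub>m ?a q p v)) \<bullet>\<^bsub>V\<^esub> (?i g \<odot>\<^sub>m ?a h (q \<otimes>\<^sub>o\<^bsub>G\<^esub> p) v)
    \<bullet>\<^bsub>V\<^esub> (?i g \<odot>\<^sub>m (Assoc G h q p \<odot>\<^sub>m ?v)) \<bullet>\<^bsub>V\<^esub> (?i g \<odot>\<^sub>m ((Coev G h \<otimes>\<^sub>m\<^bsub>G\<^esub> ?i p) \<odot>\<^sub>m ?v))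
    \<bullet>\<^bsub>V\<^esub> (?i g \<odot>\<^sub>m (inv_arr G (LUnit G p) \<odot>\<^sub>m ?v)) \<bullet>\<^bsub>V\<^esub> ?a g p v \<bullet>\<^bsub>V\<^esub> (Coev G g \<odot>\<^sub>m ?v)
    = (?i g \<odot>\<^sub>m ((?i h \<odot>\<^sub>m ?a q p v) \<bullet>\<^bsub>V\<^esub> ?a h (q \<otimes>\<^sub>o\<^bsub>G\<^esub> p) v
      \<bullet>\<^bsub>V\<^esub> (Assoc G h q p \<odot>\<^sub>m ?v) \<bullet>\<^bsub>V\<^esub> ((Coev G h \<otimes>\<^sub>m\<^bsub>G\<^esub> ?i p) \<odot>\<^sub>m ?v)
      \<bullet>\<^bsub>V\<^esub> (inv_arr G (LUnit G p) \<odot>\<^sub>m ?v))) \<bullet>\<^bsub>V\<^esub> ?a g p v \<bullet>\<^bsub>V\<^esub> (Coev G g \<odot>\<^sub>m ?v)"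
    by (simp add: act_comp_right)
  also have "(?i h \<odot>\<^sub>m ?a q p v) \<bullet>\<^bsub>V\<^esub> ?a h (q \<otimes>\<^sub>o\<^bsub>G\<^esub> p) v
      \<bullet>\<^bsub>V\<^esub> (Assoc G h q p \<odot>\<^sub>m ?v) \<bullet>\<^bsub>V\<^esub> ((Coev G h \<otimes>\<^sub>m\<^bsub>G\<^esub> ?i p) \<odot>\<^sub>m ?v)
      \<bullet>\<^bsub>V\<^esub> (inv_arr G (LUnit G p) \<odot>\<^sub>m ?v)
    = ?a h q (p \<odot>\<^sub>o v) \<bullet>\<^bsub>V\<^esub> (Coev G h \<odot>\<^sub>m Id V (p \<odot>\<^sub>o v))
      \<bullet>\<^bsub>V\<^esub> ?a (Unit G) p v \<bullet>\<^bsub>V\<^esub> (inv_arr G (LUnit G p) \<odot>\<^sub>m ?v)"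
    by (simp add: act_pentagon' massoc_nat')
  \<comment> \<open>Kelly's identity \<open>munit_act\<close> exchanges the inverse of
    \<open>LUnit\<close>, used inside \<open>coev_tens\<close>, for the inverse of
    \<open>MUnit\<close>, used by the inner conjugation.\<close>
  also have "?a (Unit G) p v \<bullet>\<^bsub>V\<^esub> (inv_arr G (LUnit G p) \<odot>\<^sub>m ?v) = inv_arr V (MUnit M (p \<odot>\<^sub>o v))"
  proof (rule V.iso_cancel_left)
    show "MUnit M (p \<odot>\<^sub>o v) \<bullet>\<^bsub>V\<^esub> ?a (Unit G) p v \<bullet>\<^bsub>V\<^esub> (inv_arr G (LUnit G p) \<odot>\<^sub>m ?v)
      = MUnit M (p \<odot>\<^sub>o v) \<bullet>\<^bsub>V\<^esub> inv_arr V (MUnit M (p \<odot>\<^sub>o v))"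
      by (simp add: V.comp_extend[OF munit_act] act_interchange)
  qed simp_all
  finally show ?thesis .
qed

end

context dual_module_category
begin

text \<open>One module pentagon for each associator in \<open>conj_tens\<close>: at
  \<open>g\<close>, \<open>h\<close>, \<open>x\<close>; at \<open>g\<close>,
  \<open>h \<otimes> x\<close>, \<open>q\<close>; and at \<open>(g \<otimes> h) \<otimes> x\<close>,
  \<open>q\<close>, \<open>p\<close>. The comparison of duals is left out, so \<open>p\<close> and
  \<open>q\<close> may be arbitrary objects.\<close>

lemma conj_assoc_act:
  assumes [simp]: "g \<in> Obj G" "h \<in> Obj G" "x \<in> Obj G" "p \<in> Obj G" "q \<in> Obj G" "v \<in> Obj V"
  shows "(Id G g \<odot>\<^sub>m MAssoc M h x (q \<odot>\<^sub>o p \<odot>\<^sub>o v))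
      \<bullet>\<^bsub>V\<^esub> (Id G g \<odot>\<^sub>m MAssoc M (h \<otimes>\<^sub>o\<^bsub>G\<^esub> x) q (p \<odot>\<^sub>o v))
      \<bullet>\<^bsub>V\<^esub> MAssoc M g ((h \<otimes>\<^sub>o\<^bsub>G\<^esub> x) \<otimes>\<^sub>o\<^bsub>G\<^esub> q) (p \<odot>\<^sub>o v)
      \<bullet>\<^bsub>V\<^esub> MAssoc M (g \<otimes>\<^sub>o\<^bsub>G\<^esub> ((h \<otimes>\<^sub>o\<^bsub>G\<^esub> x) \<otimes>\<^sub>o\<^bsub>G\<^esub> q)) p v
      \<bullet>\<^bsub>V\<^esub> ((Assoc G g (h \<otimes>\<^sub>o\<^bsub>G\<^esub> x) q \<otimes>\<^sub>m\<^bsub>G\<^esub> Id G p) \<odot>\<^sub>m Id V v)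
      \<bullet>\<^bsub>V\<^esub> (((Assoc G g h x \<otimes>\<^sub>m\<^bsub>G\<^esub> Id G q) \<otimes>\<^sub>m\<^bsub>G\<^esub> Id G p) \<odot>\<^sub>m Id V v)
      \<bullet>\<^bsub>V\<^esub> (inv_arr G (Assoc G ((g \<otimes>\<^sub>o\<^bsub>G\<^esub> h) \<otimes>\<^sub>o\<^bsub>G\<^esub> x) q p) \<odot>\<^sub>m Id V v)
    = MAssoc M g h (x \<odot>\<^sub>o q \<odot>\<^sub>o p \<odot>\<^sub>o v)
      \<bullet>\<^bsub>V\<^esub> (Id G (g \<otimes>\<^sub>o\<^bsub>G\<^esub> h) \<odot>\<^sub>m (Id G x \<odot>\<^sub>m MAssoc M q p v))
      \<bullet>\<^bsub>V\<^esub> MAssoc M (g \<otimes>\<^sub>o\<^bsub>G\<^esub> h) x ((q \<otimes>\<^sub>o\<^bsub>G\<^esub> p) \<odot>\<^sub>o v)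
      \<bullet>\<^bsub>V\<^esub> MAssoc M ((g \<otimes>\<^sub>o\<^bsub>G\<^esub> h) \<otimes>\<^sub>o\<^bsub>G\<^esub> x) (q \<otimes>\<^sub>o\<^bsub>G\<^esub> p) v"
    (is "_ = ?r")
proof -
  let ?a = "MAssoc M" and ?i = "Id G" and ?v = "Id V v"
  let ?gh = "g \<otimes>\<^sub>o\<^bsub>G\<^esub> h" and ?hx = "h \<otimes>\<^sub>o\<^bsub>G\<^esub> x" and ?pv = "p \<odot>\<^sub>o v"
  let ?y = "?gh \<otimes>\<^sub>o\<^bsub>G\<^esub> x"
  let ?t = "inv_arr G (Assoc G ?y q p) \<odot>\<^sub>m ?v"
  have "?a ?gh x (q \<odot>\<^sub>o ?pv) \<bullet>\<^bsub>V\<^esub> ?a ?y q ?pv \<bullet>\<^bsub>V\<^esub> ?a (?y \<otimes>\<^sub>o\<^bsub>G\<^esub> q) p v \<bullet>\<^bsub>V\<^esub> ?t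
    = ?a ?gh x (q \<odot>\<^sub>o ?pv) \<bullet>\<^bsub>V\<^esub> ((?i ?gh \<otimes>\<^sub>m\<^bsub>G\<^esub> ?i x) \<odot>\<^sub>m ?a q p v) \<bullet>\<^bsub>V\<^esub> ?a ?y (q \<otimes>\<^sub>o\<^bsub>G\<^esub> p) v"
    by (simp add: act_pentagon'[symmetric] act_interchange)
  also have "\<dots> = (?i ?gh \<odot>\<^sub>m (?i x \<odot>\<^sub>m ?a q p v)) \<bullet>\<^bsub>V\<^esub> ?a ?gh x ((q \<otimes>\<^sub>o\<^bsub>G\<^esub> p) \<odot>\<^sub>o v)
      \<bullet>\<^bsub>V\<^esub> ?a ?y (q \<otimes>\<^sub>o\<^bsub>G\<^esub> p) v"
    by (subst massoc_nat') simp_all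
  finally have r: "?a ?gh x (q \<odot>\<^sub>o ?pv) \<bullet>\<^bsub>V\<^esub> ?a ?y q ?pv \<bullet>\<^bsub>V\<^esub> ?a (?y \<otimes>\<^sub>o\<^bsub>G\<^esub> q) p v \<bullet>\<^bsub>V\<^esub> ?t
    = (?i ?gh \<odot>\<^sub>m (?i x \<odot>\<^sub>m ?a q p v)) \<bullet>\<^bsub>V\<^esub> ?a ?gh x ((q \<otimes>\<^sub>o\<^bsub>G\<^esub> p) \<odot>\<^sub>o v)
      \<bullet>\<^bsub>V\<^esub> ?a ?y (q \<otimes>\<^sub>o\<^bsub>G\<^esub> p) v" .
  show ?thesis
    unfolding r[symmetric]
    by (simp add: massoc_nat' act_pentagon')
qed

text \<open>Compose with the isomorphism of \<open>conj_assoc_act\<close>, which cancels the associators at the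
  target; what remains at the source is \<open>coev_tens_act\<close>.\<close>

lemma conj_comp_tens:
  assumes \<alpha>: "\<alpha> \<in> char_carrier x"
    and [simp]: "g \<in> Obj G" "h \<in> Obj G" "x \<in> Obj G" "v \<in> Obj V"
  defines "p \<equiv> Dual G g" and "q \<equiv> Dual G h"
  shows "conj_comp g p (Coev G g) (conjO G h x) (\<lambda>w\<in>Obj V. conj_comp h q (Coev G h) x \<alpha> w) v
    = (((Assoc G g (h \<otimes>\<^sub>o\<^bsub>G\<^esub> x) q \<otimes>\<^sub>m\<^bsub>G\<^esub> Id G p)
      \<bullet>\<^bsub>G\<^esub> ((Assoc G g h x \<otimes>\<^sub>m\<^bsub>G\<^esub> Id G q) \<otimes>\<^sub>m\<^bsub>G\<^esub> Id G p)
      \<bullet>\<^bsub>G\<^esub> inv_arr G (Assoc G ((g \<otimes>\<^sub>o\<^bsub>G\<^esub> h) \<otimes>\<^sub>o\<^bsub>G\<^esub> x) q p)) \<odot>\<^sub>m Id V v)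
      \<bullet>\<^bsub>V\<^esub> conj_comp (g \<otimes>\<^sub>o\<^bsub>G\<^esub> h) (q \<otimes>\<^sub>o\<^bsub>G\<^esub> p) (coev_tens G g h) x \<alpha> v"
    (is "?l = ?r")
proof (rule V.iso_cancel_left)
  let ?a = "MAssoc M" and ?i = "Id G" and ?v = "Id V v"
  let ?gh = "g \<otimes>\<^sub>o\<^bsub>G\<^esub> h" and ?hx = "h \<otimes>\<^sub>o\<^bsub>G\<^esub> x" and ?pv = "p \<odot>\<^sub>o v" and ?qp = "q \<otimes>\<^sub>o\<^bsub>G\<^esub> p"
  let ?y = "?gh \<otimes>\<^sub>o\<^bsub>G\<^esub> x"
  have [simp]: "p \<in> Obj G" "q \<in> Obj G" "Cod G (Coev G g) = g \<otimes>\<^sub>o\<^bsub>G\<^esub> p" "Cod G (Coev G h) = h \<otimes>\<^sub>o\<^bsub>G\<^esub> q"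
    "Cod G (coev_tens G g h) = ?gh \<otimes>\<^sub>o\<^bsub>G\<^esub> ?qp" and conjO: "conjO G h x = ?hx \<otimes>\<^sub>o\<^bsub>G\<^esub> q"
    by (simp_all add: p_def q_def conjO_def)
  note [simp] = char_carrier_simps[OF \<alpha>] conj_comp_simps[OF \<alpha>]
    char_carrier_simps[OF conj_comp_in_char_carrier[OF \<alpha>]]
    conj_comp_simps[OF conj_comp_in_char_carrier[OF \<alpha>]]
  let ?A = "(?i g \<odot>\<^sub>m ?a h x (q \<odot>\<^sub>o ?pv)) \<bullet>\<^bsub>V\<^esub> (?i g \<odot>\<^sub>m ?a ?hx q ?pv)
      \<bullet>\<^bsub>V\<^esub> ?a g (?hx \<otimes>\<^sub>o\<^bsub>G\<^esub> q) ?pv \<bullet>\<^bsub>V\<^esub> ?a (g \<otimes>\<^sub>o\<^bsub>G\<^esub> (?hx \<otimes>\<^sub>o\<^bsub>G\<^esub> q)) p v"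
  let ?Qg = "?a g p v \<bullet>\<^bsub>V\<^esub> (Coev G g \<odot>\<^sub>m ?v) \<bullet>\<^bsub>V\<^esub> inv_arr V (MUnit M v)"
  let ?Qh = "?a h q ?pv \<bullet>\<^bsub>V\<^esub> (Coev G h \<odot>\<^sub>m Id V ?pv) \<bullet>\<^bsub>V\<^esub> inv_arr V (MUnit M ?pv)"
  let ?\<alpha> = "\<alpha> (q \<odot>\<^sub>o ?pv)"
  let ?Q = "?a ?gh ?qp v \<bullet>\<^bsub>V\<^esub> (coev_tens G g h \<odot>\<^sub>m ?v) \<bullet>\<^bsub>V\<^esub> inv_arr V (MUnit M v)"
  let ?X = "((Assoc G g ?hx q \<otimes>\<^sub>m\<^bsub>G\<^esub> ?i p) \<odot>\<^sub>m ?v)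
      \<bullet>\<^bsub>V\<^esub> (((Assoc G g h x \<otimes>\<^sub>m\<^bsub>G\<^esub> ?i q) \<otimes>\<^sub>m\<^bsub>G\<^esub> ?i p) \<odot>\<^sub>m ?v)
      \<bullet>\<^bsub>V\<^esub> (inv_arr G (Assoc G ?y q p) \<odot>\<^sub>m ?v)"
  let ?P = "conj_comp ?gh ?qp (coev_tens G g h) x \<alpha> v"
  \<comment> \<open>Iterated conjugation evaluates \<open>\<alpha>\<close> at
    \<open>q \<odot> (p \<odot> v)\<close>, conjugation by the tensor product at
    \<open>(q \<otimes> p) \<odot> v\<close>; naturality along \<open>MAssoc\<close> relates the two
    values.\<close>
  have \<alpha>nat: "\<alpha> (q \<odot>\<^sub>o ?pv) \<bullet>\<^bsub>V\<^esub> ?a q p v = (?i x \<odot>\<^sub>m ?a q p v) \<bullet>\<^bsub>V\<^esub> \<alpha> (?qp \<odot>\<^sub>o v)"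
    by (simp add: char_carrier_nat[OF \<alpha>])
  have "?A \<bullet>\<^bsub>V\<^esub> ?r = (?A \<bullet>\<^bsub>V\<^esub> ?X) \<bullet>\<^bsub>V\<^esub> ?P"
    by (simp add: act_comp_left)
  also have "?A \<bullet>\<^bsub>V\<^esub> ?X = ?a g h (x \<odot>\<^sub>o q \<odot>\<^sub>o ?pv) \<bullet>\<^bsub>V\<^esub> (?i ?gh \<odot>\<^sub>m (?i x \<odot>\<^sub>m ?a q p v))
      \<bullet>\<^bsub>V\<^esub> ?a ?gh x (?qp \<odot>\<^sub>o v) \<bullet>\<^bsub>V\<^esub> ?a ?y ?qp v"
    using conj_assoc_act[of g h x p q v] by simp
  also have "\<dots> \<bullet>\<^bsub>V\<^esub> ?P = ?a g h (x \<odot>\<^sub>o q \<odot>\<^sub>o ?pv) \<bullet>\<^bsub>V\<^esub> (?i ?gh \<odot>\<^sub>m (?i x \<odot>\<^sub>m ?a q p v))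
      \<bullet>\<^bsub>V\<^esub> (?i ?gh \<odot>\<^sub>m \<alpha> (?qp \<odot>\<^sub>o v)) \<bullet>\<^bsub>V\<^esub> ?Q"
    by (simp add: conj_comp_def)
  also have "\<dots> = ?a g h (x \<odot>\<^sub>o q \<odot>\<^sub>o ?pv) \<bullet>\<^bsub>V\<^esub> ((?i g \<otimes>\<^sub>m\<^bsub>G\<^esub> ?i h) \<odot>\<^sub>m ?\<alpha>) \<bullet>\<^bsub>V\<^esub> (?i ?gh \<odot>\<^sub>m ?a q p v)
      \<bullet>\<^bsub>V\<^esub> ?Q"
    by (simp add: act_interchange' flip: \<alpha>nat)
  also have "\<dots> = (?i g \<odot>\<^sub>m (?i h \<odot>\<^sub>m ?\<alpha>)) \<bullet>\<^bsub>V\<^esub> ?a g h (q \<odot>\<^sub>o ?pv) \<bullet>\<^bsub>V\<^esub> (?i ?gh \<odot>\<^sub>m ?a q p v) \<bullet>\<^bsub>V\<^esub> ?Q"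
    by (subst massoc_nat') simp_all
  also have "?a g h (q \<odot>\<^sub>o ?pv) \<bullet>\<^bsub>V\<^esub> (?i ?gh \<odot>\<^sub>m ?a q p v) \<bullet>\<^bsub>V\<^esub> ?Q = (?i g \<odot>\<^sub>m ?Qh) \<bullet>\<^bsub>V\<^esub> ?Qg"
    using arg_cong[OF coev_tens_act[of g h v, folded p_def q_def],
      of "\<lambda>t. t \<bullet>\<^bsub>V\<^esub> inv_arr V (MUnit M v)"] by simp
  also have "(?i g \<odot>\<^sub>m (?i h \<odot>\<^sub>m ?\<alpha>)) \<bullet>\<^bsub>V\<^esub> (?i g \<odot>\<^sub>m ?Qh) \<bullet>\<^bsub>V\<^esub> ?Qg = ?A \<bullet>\<^bsub>V\<^esub> ?l"
    by (simp add: conj_comp_def conjO act_interchange')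
  finally show "?A \<bullet>\<^bsub>V\<^esub> ?l = ?A \<bullet>\<^bsub>V\<^esub> ?r" by (rule sym)
  show "Cod V ?l = Dom V ?A" "?l \<in> Arr V"
    unfolding conjO by simp_all
  show "iso_arr V ?A" "?r \<in> Arr V" "Cod V ?r = Dom V ?A"
    by simp_all
qed

end

section \<open>Finitely generated submodules\<close>

lemma linear_mapD:
  assumes "linear_map K A B f"
  shows "v \<in> carrier A \<Longrightarrow> f v \<in> carrier B"
    and "\<lbrakk>u \<in> carrier A; v \<in> carrier A\<rbrakk> \<Longrightarrow> f (u \<oplus>\<^bsub>A\<^esub> v) = f u \<oplus>\<^bsub>B\<^esub> f v"
    and "\<lbrakk>c \<in> carrier K; v \<in> carrier A\<rbrakk> \<Longrightarrow> f (c \<odot>\<^bsub>A\<^esub> v) = c \<odot>\<^bsub>B\<^esub> f v"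
  using assms by (auto simp: linear_map_def)

lemma linear_map_zero:
  assumes "module K A" "module K B" "linear_map K A B f"
  shows "f \<zero>\<^bsub>A\<^esub> = \<zero>\<^bsub>B\<^esub>"
proof -
  interpret A: module K A by fact
  interpret B: module K B by fact
  have "f (\<zero>\<^bsub>K\<^esub> \<odot>\<^bsub>A\<^esub> \<zero>\<^bsub>A\<^esub>) = \<zero>\<^bsub>K\<^esub> \<odot>\<^bsub>B\<^esub> f \<zero>\<^bsub>A\<^esub>"
    using linear_mapD(3)[OF assms(3)] by blast
  then show ?thesis
    using linear_mapD(1)[OF assms(3) A.M.zero_closed] by simp
qed

lemma linear_map_compose:
  assumes "linear_map K A B f" "linear_map K B C g"
  shows "linear_map K A C (\<lambda>v. g (f v))"
  using assms by (auto simp: linear_map_def Pi_def)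

lemma linear_map_cong:
  assumes "module K A" "linear_map K A B f" "\<And>v. v \<in> carrier A \<Longrightarrow> f v = g v"
  shows "linear_map K A B g"
proof -
  interpret A: module K A by fact
  show ?thesis using assms(2,3) by (auto simp: linear_map_def Pi_def)
qed

lemma (in module) submoduleI':
  assumes "H \<subseteq> carrier M" "\<zero>\<^bsub>M\<^esub> \<in> H"
    and "\<And>u v. \<lbrakk>u \<in> H; v \<in> H\<rbrakk> \<Longrightarrow> u \<oplus>\<^bsub>M\<^esub> v \<in> H"
    and smult: "\<And>c v. \<lbrakk>c \<in> carrier R; v \<in> H\<rbrakk> \<Longrightarrow> c \<odot>\<^bsub>M\<^esub> v \<in> H"
  shows "submodule H R M"
proof (rule submoduleI)
  fix a assume "a \<in> H"
  then show "\<ominus>\<^bsub>M\<^esub> a \<in> H"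
    using smult[of "\<ominus>\<^bsub>R\<^esub> \<one>\<^bsub>R\<^esub>" a] assms(1) by (simp add: smult_l_minus subset_iff)
qed (use assms in auto)

lemma (in module) submodule_zero: "submodule H R M \<Longrightarrow> \<zero>\<^bsub>M\<^esub> \<in> H"
  using subgroup.one_closed[of H "add_monoid M"] by (simp add: submodule_def)

lemma (in module) submodule_Int:
  assumes "submodule H R M" "submodule H' R M"
  shows "submodule (H \<inter> H') R M"
  using submoduleE[OF assms(1)] submoduleE[OF assms(2)] assms[THEN submodule_zero]
  by (intro submoduleI') auto

lemma submodule_image:
  assumes "module K A" "module K B" and f: "linear_map K A B f" and H: "submodule H K A"
  shows "submodule (f ` H) K B"
proof -
  interpret A: module K A by fact
  interpret B: module K B by fact
  note H = A.submoduleE[OF H] A.submodule_zero[OF H]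
  have HA: "v \<in> H \<Longrightarrow> v \<in> carrier A" for v using H(1) by blast
  show ?thesis
  proof (rule B.submoduleI')
    show "f ` H \<subseteq> carrier B" using H(1) linear_mapD(1)[OF f] by blast
    show "\<zero>\<^bsub>B\<^esub> \<in> f ` H" using linear_map_zero[OF assms(1-3)] H(7) by (metis imageI)
  next
    fix u v assume "u \<in> f ` H" "v \<in> f ` H"
    then obtain u' v' where "u' \<in> H" "v' \<in> H" "u = f u'" "v = f v'" by blast
    then show "u \<oplus>\<^bsub>B\<^esub> v \<in> f ` H"
      using linear_mapD(2)[OF f HA HA, symmetric] H(5) by auto
  next
    fix c v assume "c \<in> carrier K" "v \<in> f ` H"
    then show "c \<odot>\<^bsub>B\<^esub> v \<in> f ` H"
      using linear_mapD(3)[OF f _ HA, symmetric] H(4) by auto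
  qed
qed

lemma submodule_kernel:
  assumes "module K A" "module K B" and f: "linear_map K A B f"
  shows "submodule {v \<in> carrier A. f v = \<zero>\<^bsub>B\<^esub>} K A"
proof -
  interpret A: module K A by fact
  interpret B: module K B by fact
  show ?thesis
    by (rule A.submoduleI') (auto simp: linear_mapD[OF f] linear_map_zero[OF assms])
qed

text \<open>Generation is phrased through the submodules containing \<open>B\<close>, so that
  extensions can be handled without linear combinations. Those appear only where this notion meets
  \<open>finite_dimensional\<close>.\<close>

definition fin_gen :: "('k, 'r) ring_scheme \<Rightarrow> ('k, 'w, 's) module_scheme \<Rightarrow> 'w set \<Rightarrow> bool"
  where "fin_gen K A W \<longleftrightarrow> (\<exists>B. finite B \<and> B \<subseteq> W \<and> (\<forall>U. submodule U K A \<longrightarrow> B \<subseteq> U \<longrightarrow> W \<subseteq> U))"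

definition lin_combs :: "('k, 'r) ring_scheme \<Rightarrow> ('k, 'w, 's) module_scheme \<Rightarrow> 'w set \<Rightarrow> 'w set"
  where "lin_combs K A B = {v. \<exists>c \<in> B \<rightarrow> carrier K. v = (\<Oplus>\<^bsub>A\<^esub>b\<in>B. c b \<odot>\<^bsub>A\<^esub> b)}"

lemma lin_combsI:
  "\<lbrakk>v = (\<Oplus>\<^bsub>A\<^esub>b\<in>B. c b \<odot>\<^bsub>A\<^esub> b); c \<in> B \<rightarrow> carrier K\<rbrakk> \<Longrightarrow> v \<in> lin_combs K A B"
  by (auto simp: lin_combs_def)

lemma lin_combsE:
  assumes "v \<in> lin_combs K A B"
  obtains c where "c \<in> B \<rightarrow> carrier K" "v = (\<Oplus>\<^bsub>A\<^esub>b\<in>B. c b \<odot>\<^bsub>A\<^esub> b)"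
  using assms unfolding lin_combs_def by blast

context module
begin

lemma submodule_lin_combs:
  assumes "finite B" and B: "B \<subseteq> carrier M"
  shows "submodule (lin_combs R M B) R M"
proof (rule submoduleI')
  have cl: "(\<lambda>b. c b \<odot>\<^bsub>M\<^esub> b) \<in> B \<rightarrow> carrier M" if "c \<in> B \<rightarrow> carrier R" for c
    using that B by auto
  show "lin_combs R M B \<subseteq> carrier M"
  proof
    fix v assume "v \<in> lin_combs R M B"
    then obtain c where "c \<in> B \<rightarrow> carrier R" "v = (\<Oplus>\<^bsub>M\<^esub>b\<in>B. c b \<odot>\<^bsub>M\<^esub> b)"
      by (rule lin_combsE)
    then show "v \<in> carrier M" using M.finsum_closed[OF cl] by metis
  qed
  have "(\<Oplus>\<^bsub>M\<^esub>b\<in>B. \<zero> \<odot>\<^bsub>M\<^esub> b) = (\<Oplus>\<^bsub>M\<^esub>b\<in>B. \<zero>\<^bsub>M\<^esub>)"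
    by (rule M.finsum_cong') (use B in auto)
  then show "\<zero>\<^bsub>M\<^esub> \<in> lin_combs R M B"
    by (intro lin_combsI[where c = "\<lambda>_. \<zero>"]) simp_all
next
  fix u v assume "u \<in> lin_combs R M B" "v \<in> lin_combs R M B"
  then obtain c d where cd: "c \<in> B \<rightarrow> carrier R" "d \<in> B \<rightarrow> carrier R"
    and uv: "u = (\<Oplus>\<^bsub>M\<^esub>b\<in>B. c b \<odot>\<^bsub>M\<^esub> b)" "v = (\<Oplus>\<^bsub>M\<^esub>b\<in>B. d b \<odot>\<^bsub>M\<^esub> b)"
    by (elim lin_combsE)
  have "u \<oplus>\<^bsub>M\<^esub> v = (\<Oplus>\<^bsub>M\<^esub>b\<in>B. c b \<odot>\<^bsub>M\<^esub> b \<oplus>\<^bsub>M\<^esub> d b \<odot>\<^bsub>M\<^esub> b)"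
    unfolding uv by (rule M.finsum_addf[symmetric]) (use cd B in auto)
  also have "\<dots> = (\<Oplus>\<^bsub>M\<^esub>b\<in>B. (c b \<oplus> d b) \<odot>\<^bsub>M\<^esub> b)"
    by (rule M.finsum_cong') (use cd B in \<open>auto simp: smult_l_distr Pi_def subset_iff\<close>)
  finally show "u \<oplus>\<^bsub>M\<^esub> v \<in> lin_combs R M B"
    by (rule lin_combsI) (use cd in auto)
next
  fix k v assume k: "k \<in> carrier R" and "v \<in> lin_combs R M B"
  then obtain c where c: "c \<in> B \<rightarrow> carrier R" and v: "v = (\<Oplus>\<^bsub>M\<^esub>b\<in>B. c b \<odot>\<^bsub>M\<^esub> b)"
    by (elim lin_combsE)
  have "k \<odot>\<^bsub>M\<^esub> v = (\<Oplus>\<^bsub>M\<^esub>b\<in>B. k \<odot>\<^bsub>M\<^esub> (c b \<odot>\<^bsub>M\<^esub> b))"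
    unfolding v by (rule finsum_smult_ldistr) (use assms k c in auto)
  also have "\<dots> = (\<Oplus>\<^bsub>M\<^esub>b\<in>B. (k \<otimes> c b) \<odot>\<^bsub>M\<^esub> b)"
    by (rule M.finsum_cong') (use k c B in \<open>auto simp: smult_assoc1 Pi_def subset_iff\<close>)
  finally show "k \<odot>\<^bsub>M\<^esub> v \<in> lin_combs R M B"
    by (rule lin_combsI) (use k c in auto)
qed

lemma subset_lin_combs:
  assumes "finite B" and B: "B \<subseteq> carrier M"
  shows "B \<subseteq> lin_combs R M B"
proof
  fix b assume b: "b \<in> B"
  have "(\<Oplus>\<^bsub>M\<^esub>b'\<in>B. (if b = b' then \<one> else \<zero>) \<odot>\<^bsub>M\<^esub> b') = (\<Oplus>\<^bsub>M\<^esub>b'\<in>B. if b = b' then b' else \<zero>\<^bsub>M\<^esub>)"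
    by (rule M.finsum_cong') (use B in auto)
  also have "\<dots> = b"
    by (rule M.finsum_singleton) (use assms b in auto)
  finally show "b \<in> lin_combs R M B"
    by (intro lin_combsI[OF sym]) auto
qed

lemma finite_dimensional_if_fin_gen:
  assumes "fin_gen R M (carrier M)"
  shows "finite_dimensional R M"
proof -
  obtain B where B: "finite B" "B \<subseteq> carrier M"
    and gen: "\<And>U. submodule U R M \<Longrightarrow> B \<subseteq> U \<Longrightarrow> carrier M \<subseteq> U"
    using assms unfolding fin_gen_def by blast
  have "carrier M \<subseteq> lin_combs R M B"
    by (rule gen[OF submodule_lin_combs[OF B] subset_lin_combs[OF B]])
  then show ?thesis
    unfolding finite_dimensional_def lin_combs_def using B by blast
qed

lemma lin_combs_insert:
  assumes "finite B" "insert b B \<subseteq> carrier M" "b \<notin> B" "v \<in> lin_combs R M (insert b B)"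
  obtains c s where "c \<in> carrier R" "s \<in> lin_combs R M B" "v = c \<odot>\<^bsub>M\<^esub> b \<oplus>\<^bsub>M\<^esub> s"
proof -
  obtain c where c: "c \<in> insert b B \<rightarrow> carrier R"
    and v: "v = (\<Oplus>\<^bsub>M\<^esub>b\<in>insert b B. c b \<odot>\<^bsub>M\<^esub> b)"
    using assms(4) by (rule lin_combsE)
  have "v = c b \<odot>\<^bsub>M\<^esub> b \<oplus>\<^bsub>M\<^esub> (\<Oplus>\<^bsub>M\<^esub>b\<in>B. c b \<odot>\<^bsub>M\<^esub> b)"
    unfolding v by (rule M.finsum_insert) (use assms c in auto)
  moreover have "(\<Oplus>\<^bsub>M\<^esub>b\<in>B. c b \<odot>\<^bsub>M\<^esub> b) \<in> lin_combs R M B"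
    by (rule lin_combsI[OF refl]) (use c in auto)
  ultimately show ?thesis
    using c by (intro that) auto
qed

text \<open>Induction on \<open>B\<close> in the manner of elimination: either \<open>W\<close>
  already lies in the span of the smaller set, or some \<open>w0\<close> in \<open>W\<close> has a
  nonzero coefficient at \<open>b\<close>. In the latter case subtracting a multiple of
  \<open>w0\<close> moves any element of \<open>W\<close> into the intersection with the smaller
  span, so \<open>w0\<close> and generators of that intersection suffice.\<close>

lemma fin_gen_if_subset_lin_combs:
  assumes "field R" and "finite B" "B \<subseteq> carrier M" "submodule W R M" "W \<subseteq> lin_combs R M B"
  shows "fin_gen R M W"
  using assms(2-)
proof (induction B arbitrary: W rule: finite_induct)
  case empty
  then have "W \<subseteq> {\<zero>\<^bsub>M\<^esub>}"
    by (auto simp: lin_combs_def)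
  then show ?case
    unfolding fin_gen_def using submodule_zero by (intro exI[of _ "{}"]) blast
next
  case (insert b B)
  interpret R: field R by fact
  have B: "B \<subseteq> carrier M" and b: "b \<in> carrier M" using insert.prems by auto
  note L = submodule_lin_combs[OF \<open>finite B\<close> B]
  have LM: "s \<in> lin_combs R M B \<Longrightarrow> s \<in> carrier M" for s using submoduleE(1)[OF L] by blast
  have W: "w \<in> W \<Longrightarrow> w \<in> carrier M" for w using submoduleE(1)[OF insert.prems(2)] by blast
  show ?case
  proof (cases "W \<subseteq> lin_combs R M B")
    case True
    then show ?thesis using insert.IH B insert.prems by blast
  next
    case False
    then obtain w0 where w0: "w0 \<in> W" "w0 \<notin> lin_combs R M B" by blast
    then obtain c s0 where c: "c \<in> carrier R" and s0: "s0 \<in> lin_combs R M B"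
      and w0_eq: "w0 = c \<odot>\<^bsub>M\<^esub> b \<oplus>\<^bsub>M\<^esub> s0"
      using lin_combs_insert[of B b w0] insert by blast
    have "c \<noteq> \<zero>"
      using w0(2) s0 w0_eq b LM[OF s0] by auto
    then have c': "c \<in> Units R" using c R.field_Units by blast
    obtain D where D: "finite D" "D \<subseteq> W \<inter> lin_combs R M B"
      and gen: "\<And>U. submodule U R M \<Longrightarrow> D \<subseteq> U \<Longrightarrow> W \<inter> lin_combs R M B \<subseteq> U"
      using insert.IH[OF B submodule_Int[OF insert.prems(2) L]] unfolding fin_gen_def by blast
    have "W \<subseteq> U" if U: "submodule U R M" and sub: "insert w0 D \<subseteq> U" for U
    proof
      fix w assume w: "w \<in> W"
      then obtain d s where d: "d \<in> carrier R" and s: "s \<in> lin_combs R M B"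
        and w_eq: "w = d \<odot>\<^bsub>M\<^esub> b \<oplus>\<^bsub>M\<^esub> s"
        using lin_combs_insert[of B b w] insert by blast
      \<comment> \<open>The multiple of \<open>w0\<close> that cancels the coefficient
        \<open>d\<close> of \<open>w\<close> at \<open>b\<close>; here division in the field is
        used.\<close>
      define k where "k = d \<otimes> inv c"
      have k: "k \<in> carrier R" using d c' by (simp add: k_def)
      have kc: "k \<otimes> c = d" using d c c' by (simp add: k_def m_assoc)
      let ?u = "w \<ominus>\<^bsub>M\<^esub> k \<odot>\<^bsub>M\<^esub> w0"
      have uW: "?u \<in> W"
        using submoduleE[OF insert.prems(2)] w w0(1) k by (simp add: M.minus_eq)
      have "k \<odot>\<^bsub>M\<^esub> w0 = d \<odot>\<^bsub>M\<^esub> b \<oplus>\<^bsub>M\<^esub> k \<odot>\<^bsub>M\<^esub> s0"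
        using k c b LM[OF s0] by (simp add: w0_eq smult_r_distr smult_assoc1[symmetric] kc)
      then have "?u = s \<ominus>\<^bsub>M\<^esub> k \<odot>\<^bsub>M\<^esub> s0"
        using w_eq d b k LM[OF s] LM[OF s0]
        by (simp add: M.minus_eq M.minus_add M.a_ac M.r_neg2)
      then have "?u \<in> lin_combs R M B"
        using submoduleE[OF L] s s0 k by (simp add: M.minus_eq)
      then have "?u \<in> U" using gen[OF U] sub uW by blast
      moreover have "w = ?u \<oplus>\<^bsub>M\<^esub> k \<odot>\<^bsub>M\<^esub> w0"
        using W[OF w] W[OF w0(1)] k by (simp add: M.minus_eq M.a_assoc M.l_neg)
      ultimately show "w \<in> U"
        using submoduleE[OF U] sub k by (metis insert_subset)
    qed
    then show ?thesis
      unfolding fin_gen_def using D w0(1) by (intro exI[of _ "insert w0 D"]) auto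
  qed
qed

lemma fin_gen_submodule:
  assumes "field R" "finite_dimensional R M" "submodule W R M"
  shows "fin_gen R M W"
proof -
  obtain B where "finite B" "B \<subseteq> carrier M" "carrier M \<subseteq> lin_combs R M B"
    using assms(2) unfolding finite_dimensional_def lin_combs_def by blast
  then show ?thesis
    using fin_gen_if_subset_lin_combs[of B W] assms submoduleE(1)[OF assms(3)] by blast
qed

end

text \<open>Generators of the kernel together with lifts of generators of the image generate
  \<open>W\<close>: an element of \<open>W\<close> differs by an element of the kernel from one
  whose image has been matched.\<close>

lemma fin_gen_extension:
  assumes "module K A" "module K B" and f: "linear_map K A B f" and W: "submodule W K A"
    and image: "fin_gen K B (f ` W)" and kernel: "fin_gen K A {w \<in> W. f w = \<zero>\<^bsub>B\<^esub>}"
  shows "fin_gen K A W"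
proof -
  interpret A: module K A by fact
  interpret B: module K B by fact
  note WA = A.submoduleE[OF W]
  obtain D where D: "finite D" "D \<subseteq> {w \<in> W. f w = \<zero>\<^bsub>B\<^esub>}"
    and genD: "\<And>U. submodule U K A \<Longrightarrow> D \<subseteq> U \<Longrightarrow> {w \<in> W. f w = \<zero>\<^bsub>B\<^esub>} \<subseteq> U"
    using kernel unfolding fin_gen_def by blast
  obtain E' where E': "finite E'" "E' \<subseteq> f ` W"
    and genE: "\<And>U. submodule U K B \<Longrightarrow> E' \<subseteq> U \<Longrightarrow> f ` W \<subseteq> U"
    using image unfolding fin_gen_def by blast
  obtain E where E: "finite E" "E \<subseteq> W" "E' = f ` E"
    using finite_subset_image[OF E'] by blast
  have "W \<subseteq> U" if U: "submodule U K A" and sub: "D \<union> E \<subseteq> U" for U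
  proof
    fix w assume w: "w \<in> W"
    \<comment> \<open>The image of \<open>U \<inter> W\<close>, not of \<open>U\<close>, is used, so
      that the preimage \<open>u\<close> lies in \<open>W\<close> as well; otherwise
      \<open>w - u\<close> need not belong to the part of the kernel that \<open>D\<close>
      generates.\<close>
    have "f ` W \<subseteq> f ` (U \<inter> W)"
      by (rule genE[OF submodule_image[OF assms(1-3) A.submodule_Int[OF U W]]]) (use E sub in auto)
    then obtain u where u: "u \<in> U" "u \<in> W" "f w = f u" using w by blast
    have wc: "w \<in> carrier A" "u \<in> carrier A" using WA(1) w u by auto
    let ?k = "w \<oplus>\<^bsub>A\<^esub> (\<ominus>\<^bsub>K\<^esub> \<one>\<^bsub>K\<^esub>) \<odot>\<^bsub>A\<^esub> u"
    have "f ?k = f u \<oplus>\<^bsub>B\<^esub> (\<ominus>\<^bsub>K\<^esub> \<one>\<^bsub>K\<^esub>) \<odot>\<^bsub>B\<^esub> f u"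
      using wc by (simp add: linear_mapD[OF f] u(3))
    also have "\<dots> = \<zero>\<^bsub>B\<^esub>"
      using linear_mapD(1)[OF f wc(2)] by (simp add: B.smult_l_minus B.M.r_neg)
    finally have "f ?k = \<zero>\<^bsub>B\<^esub>" .
    moreover have "?k \<in> W"
      by (intro WA(5)[OF w] WA(4)[OF _ u(2)]) simp
    ultimately have "?k \<in> U" using genD[OF U] sub by blast
    moreover have "w = ?k \<oplus>\<^bsub>A\<^esub> u"
      using wc by (simp add: A.smult_l_minus A.M.a_assoc A.M.l_neg)
    ultimately show "w \<in> U" using A.submoduleE(5)[OF U] u(1) by metis
  qed
  then show ?thesis
    unfolding fin_gen_def using D E by (intro exI[of _ "D \<union> E"]) auto
qed

text \<open>The maps \<open>f i\<close> are jointly injective. Instead of embedding \<open>A\<close>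
  in a product, the conditions \<open>f i v = 0\<close> are dropped one at a time, from the zero
  space up to \<open>A\<close>; each step is an extension whose image is a subspace of one
  \<open>B i\<close>.\<close>

lemma finite_dimensional_if_separated:
  assumes K: "field K" and A: "module K A" and I: "finite I"
    and B: "\<And>i. i \<in> I \<Longrightarrow> module K (B i)" "\<And>i. i \<in> I \<Longrightarrow> finite_dimensional K (B i)"
    and f: "\<And>i. i \<in> I \<Longrightarrow> linear_map K A (B i) (f i)"
    and sep: "\<And>v. \<lbrakk>v \<in> carrier A; \<And>i. i \<in> I \<Longrightarrow> f i v = \<zero>\<^bsub>B i\<^esub>\<rbrakk> \<Longrightarrow> v = \<zero>\<^bsub>A\<^esub>"
  shows "finite_dimensional K A"
proof -
  interpret A: module K A by fact
  let ?W = "\<lambda>J. {v \<in> carrier A. \<forall>i \<in> J. f i v = \<zero>\<^bsub>B i\<^esub>}"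
  have sub: "submodule (?W J) K A" if "finite J" "J \<subseteq> I" for J
    using that
  proof (induction J rule: finite_induct)
    case empty
    then show ?case using A.carrier_is_submodule by simp
  next
    case (insert j J)
    then have "submodule ({v \<in> carrier A. f j v = \<zero>\<^bsub>B j\<^esub>} \<inter> ?W J) K A"
      by (intro A.submodule_Int submodule_kernel A B f) auto
    then show ?case by (rule back_subst[of "\<lambda>W. submodule W K A"]) auto
  qed
  \<comment> \<open>Finite generation of \<open>?W J\<close> is a premise of the induction, so
    inserting \<open>j\<close> reduces the claim to a larger subspace with one condition
    fewer.\<close>
  have "fin_gen K A (carrier A)" if "finite J" "J \<subseteq> I" "fin_gen K A (?W J)" for J
    using that
  proof (induction J rule: finite_induct)
    case empty
    then show ?case by simp
  next
    case (insert j J)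
    have j: "j \<in> I" "J \<subseteq> I" using insert.prems by auto
    interpret B: module K "B j" by (rule B(1)[OF j(1)])
    note W = sub[OF \<open>finite J\<close> j(2)]
    have "fin_gen K A (?W J)"
    proof (rule fin_gen_extension[OF A B(1)[OF j(1)] f[OF j(1)] W])
      show "fin_gen K (B j) (f j ` ?W J)"
        by (rule B.fin_gen_submodule[OF K B(2)[OF j(1)]])
          (rule submodule_image[OF A B(1)[OF j(1)] f[OF j(1)] W])
      have "{w \<in> ?W J. f j w = \<zero>\<^bsub>B j\<^esub>} = ?W (insert j J)" by auto
      then show "fin_gen K A {w \<in> ?W J. f j w = \<zero>\<^bsub>B j\<^esub>}" using insert.prems by simp
    qed
    then show ?case using insert.IH j by blast
  qed
  moreover have "fin_gen K A (?W I)"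
  proof -
    have "?W I \<subseteq> {\<zero>\<^bsub>A\<^esub>}" using sep by blast
    then show ?thesis
      unfolding fin_gen_def using A.submodule_zero by (intro exI[of _ "{}"]) blast
  qed
  ultimately show ?thesis
    using I A.finite_dimensional_if_fin_gen by blast
qed

section \<open>The category of finite-dimensional vector spaces\<close>

lemma Vec_simps [simp]:
  "A \<in> Obj (Vec K) \<longleftrightarrow> module K A \<and> finite_dimensional K A"
  "(A, f, B) \<in> Arr (Vec K) \<longleftrightarrow> module K A \<and> finite_dimensional K A \<and> module K B \<and>
    finite_dimensional K B \<and> linear_map K A B f \<and> f \<in> extensional (carrier A)"
  "Dom (Vec K) (A, f, B) = A"
  "Cod (Vec K) (A, f, B) = B"
  "Id (Vec K) A = (A, \<lambda>v\<in>carrier A. v, A)"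
  "(B', g, C) \<bullet>\<^bsub>Vec K\<^esub> (A, f, B) = (A, compose (carrier A) g f, C)"
  by (auto simp: Vec_def)

lemma linear_map_id: "module K A \<Longrightarrow> linear_map K A A (\<lambda>v. v)"
  by (simp add: linear_map_def)

lemma linear_map_restrict_iff:
  assumes "module K A"
  shows "linear_map K A B (restrict f (carrier A)) \<longleftrightarrow> linear_map K A B f"
  using linear_map_cong[OF assms, of B f "restrict f (carrier A)"]
    linear_map_cong[OF assms, of B "restrict f (carrier A)" f] by auto

lemma linear_map_compose_restrict:
  "\<lbrakk>module K A; linear_map K A B f; linear_map K B C g\<rbrakk>
    \<Longrightarrow> linear_map K A C (compose (carrier A) g f)"
  unfolding compose_def by (simp add: linear_map_restrict_iff linear_map_compose)

lemma category_Vec: "category (Vec K)"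
proof
  fix f assume "f \<in> Arr (Vec K)"
  then show "Dom (Vec K) f \<in> Obj (Vec K)" "Cod (Vec K) f \<in> Obj (Vec K)"
    by (cases f; simp)+
next
  fix A assume "A \<in> Obj (Vec K)"
  then show "Id (Vec K) A \<in> Hom (Vec K) A A"
    by (simp add: hom_iff linear_map_restrict_iff linear_map_id)
next
  fix f g A B C assume "f \<in> Hom (Vec K) A B" "g \<in> Hom (Vec K) B C"
  then show "g \<bullet>\<^bsub>Vec K\<^esub> f \<in> Hom (Vec K) A C"
    by (cases f; cases g) (auto simp: hom_iff linear_map_compose_restrict)
next
  fix f A B assume "f \<in> Hom (Vec K) A B"
  then show "f \<bullet>\<^bsub>Vec K\<^esub> Id (Vec K) A = f" "Id (Vec K) B \<bullet>\<^bsub>Vec K\<^esub> f = f"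
    by (cases f; force simp: hom_iff compose_def linear_map_def intro: extensionalityI)+
next
  fix f g h A B C D
  assume "f \<in> Hom (Vec K) A B" "g \<in> Hom (Vec K) B C" "h \<in> Hom (Vec K) C D"
  then show "(h \<bullet>\<^bsub>Vec K\<^esub> g) \<bullet>\<^bsub>Vec K\<^esub> f = h \<bullet>\<^bsub>Vec K\<^esub> g \<bullet>\<^bsub>Vec K\<^esub> f"
    by (cases f; cases g; cases h) (auto simp: hom_iff linear_map_def compose_assoc)
qed

lemma Vec_isoI:
  assumes f: "(A, f, B) \<in> Arr (Vec K)" and bij: "bij_betw f (carrier A) (carrier B)"
  shows "iso_arr (Vec K) (A, f, B)"
proof -
  interpret category "Vec K" by (rule category_Vec)
  interpret A: module K A using f by simp
  interpret B: module K B using f by simp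
  let ?g = "inv_into (carrier A) f"
  have lin: "linear_map K A B f" using f by simp
  have g: "?g v \<in> carrier A" "f (?g v) = v" if "v \<in> carrier B" for v
    using that bij by (auto simp: bij_betw_def inv_into_into f_inv_into_f)
  have gI: "?g w = v" if "f v = w" "v \<in> carrier A" for v w
    using bij that by (auto simp: bij_betw_def)
  have g_lin: "linear_map K B A ?g"
    unfolding linear_map_def by (auto simp: g linear_mapD[OF lin] intro!: gI)
  show ?thesis
  proof (rule iso_arrI(1)[where g = "(B, restrict ?g (carrier B), A)"])
    show "(B, restrict ?g (carrier B), A) \<in> Arr (Vec K)"
      using f g_lin by (simp add: linear_map_restrict_iff)
  qed (use f in \<open>auto simp: compose_def g linear_mapD(1)[OF lin] intro!: restrict_ext gI\<close>)
qed

text \<open>The two invertible composites give \<open>g\<close> a right and a left inverse. These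
  coincide, so \<open>g\<close> is invertible, and \<open>f\<close> is recovered as the inverse of
  \<open>g\<close> after \<open>g \<bullet> f\<close>.\<close>

lemma (in category) two_of_six:
  assumes "f \<in> Arr C" "g \<in> Arr C" "h \<in> Arr C" "Dom C g = Cod C f" "Dom C h = Cod C g"
    and gf: "iso_arr C (g \<bullet> f)" and hg: "iso_arr C (h \<bullet> g)"
  shows "iso_arr C f"
proof -
  let ?r = "f \<bullet> inv_arr C (g \<bullet> f)" and ?l = "inv_arr C (h \<bullet> g) \<bullet> h"
  note [simp] = assms(1-5) inv_arr_simps(1-3)[OF gf] inv_arr_simps(1-3)[OF hg]
  have r: "g \<bullet> ?r = Id C (Cod C g)"
    using inv_arr_simps(5)[OF gf] by simp
  have l: "?l \<bullet> g = Id C (Cod C f)"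
    using inv_arr_simps(4)[OF hg] by simp
  have "?l = ?l \<bullet> g \<bullet> ?r" unfolding r by simp
  also have "\<dots> = (?l \<bullet> g) \<bullet> ?r" by simp
  also have "\<dots> = ?r" unfolding l by simp
  finally have "iso_arr C g"
    using r l by (intro iso_arrI(1)[of g ?r]) simp_all
  then show ?thesis
    using iso_arr_comp[OF gf, of "inv_arr C g"] by simp
qed

context cat_functor
begin

lemma functor_simps [simp]:
  "x \<in> Obj C \<Longrightarrow> FO F x \<in> Obj D"
  "f \<in> Arr C \<Longrightarrow> FM F f \<in> Arr D"
  "f \<in> Arr C \<Longrightarrow> Dom D (FM F f) = FO F (Dom C f)"
  "f \<in> Arr C \<Longrightarrow> Cod D (FM F f) = FO F (Cod C f)"
  using functor_obj functor_hom[of f "Dom C f" "Cod C f"] by (simp_all add: hom_iff)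

lemma functor_comp_simp:
  "\<lbrakk>f \<in> Arr C; g \<in> Arr C; Dom C g = Cod C f\<rbrakk>
    \<Longrightarrow> FM F (g \<bullet>\<^bsub>C\<^esub> f) = FM F g \<bullet>\<^bsub>D\<^esub> FM F f"
  using functor_comp[of f "Dom C f" "Cod C f" g "Cod C g"] by (simp add: hom_iff)

lemma functor_iso [simp]:
  assumes "iso_arr C f"
  shows "iso_arr D (FM F f)"
  using assms C.iso_arr_arr[OF assms]
  by (intro D.iso_arrI(1)[of _ "FM F (inv_arr C f)"])
    (simp_all add: functor_id flip: functor_comp_simp)

end

context linear_category
begin

lemma in_HomSp [simp]: "\<lbrakk>x \<in> Obj V; y \<in> Obj V\<rbrakk>
    \<Longrightarrow> f \<in> carrier (HomSp V x y) \<longleftrightarrow> f \<in> Arr V \<and> Dom V f = x \<and> Cod V f = y"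
  by (simp add: hom_carrier hom_iff)

lemma linear_comp_left:
  "\<lbrakk>x \<in> Obj V; f \<in> Arr V; Dom V f = y; Cod V f = z\<rbrakk>
    \<Longrightarrow> linear_map K (HomSp V x y) (HomSp V x z) (\<lambda>g. f \<bullet>\<^bsub>V\<^esub> g)"
  by (rule comp_linear_left) (simp_all add: hom_iff)

lemma linear_comp_right:
  "\<lbrakk>z \<in> Obj V; f \<in> Arr V; Dom V f = x; Cod V f = y\<rbrakk>
    \<Longrightarrow> linear_map K (HomSp V y z) (HomSp V x z) (\<lambda>g. g \<bullet>\<^bsub>V\<^esub> f)"
  by (rule comp_linear_right) (simp_all add: hom_iff)

lemma comp_zero_left:
  "\<lbrakk>x \<in> Obj V; f \<in> Arr V; Dom V f = y; Cod V f = z\<rbrakk>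
    \<Longrightarrow> f \<bullet>\<^bsub>V\<^esub> zero_arr V x y = zero_arr V x z"
  by (rule linear_map_zero[OF hom_module hom_module linear_comp_left]) auto

lemma comp_zero_right:
  "\<lbrakk>z \<in> Obj V; f \<in> Arr V; Dom V f = x; Cod V f = y\<rbrakk>
    \<Longrightarrow> zero_arr V y z \<bullet>\<^bsub>V\<^esub> f = zero_arr V x z"
  by (rule linear_map_zero[OF hom_module hom_module linear_comp_right]) auto

end

section \<open>The 2-character as a class functor\<close>

locale two_rep_with_duals = two_rep K G V M + dual_module_category G V M
  for K :: "('k, 'r) ring_scheme" and G :: "('g, 'gm, 'y) dual_mon_cat_scheme"
    and V :: "('v, 'vm, 'k, 'z) lin_cat_scheme" and M :: "('g, 'gm, 'v, 'vm) action" (structure)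
begin

abbreviation \<chi> :: "'g \<Rightarrow> ('k, 'v \<Rightarrow> 'vm) module"
  where "\<chi> \<equiv> two_char_space G V M"

lemma \<chi>_simps [simp]:
  "carrier (\<chi> x) = char_carrier x"
  "zero (\<chi> x) = (\<lambda>v\<in>Obj V. zero_arr V v (x \<odot>\<^sub>o v))"
  "add (\<chi> x) = (\<lambda>\<alpha> \<beta>. \<lambda>v\<in>Obj V. \<alpha> v \<oplus>\<^bsub>HomSp V v (x \<odot>\<^sub>o v)\<^esub> \<beta> v)"
  "smult (\<chi> x) = (\<lambda>c \<alpha>. \<lambda>v\<in>Obj V. c \<odot>\<^bsub>HomSp V v (x \<odot>\<^sub>o v)\<^esub> \<alpha> v)"
  by (simp_all add: two_char_space_def)

section \<open>The vector space of natural transformations and its dimension\<close>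

lemma char_carrier_HomSp:
  "\<lbrakk>\<alpha> \<in> char_carrier x; x \<in> Obj G; v \<in> Obj V\<rbrakk> \<Longrightarrow> \<alpha> v \<in> carrier (HomSp V v (x \<odot>\<^sub>o v))"
  by (simp add: char_carrier_simps)

text \<open>\<open>\<delta> f\<close> is a common value for both sides of the naturality square: for
  a linear operation, one side reaches it by linearity of precomposition with \<open>f\<close>, the
  other by linearity of postcomposition and naturality of the arguments.\<close>

lemma pointwise_in_char_carrier:
  assumes x: "x \<in> Obj G"
    and hom: "\<And>v. v \<in> Obj V \<Longrightarrow> \<gamma> v \<in> carrier (HomSp V v (x \<odot>\<^sub>o v))"
    and right: "\<And>f. f \<in> Arr V \<Longrightarrow> \<gamma> (Cod V f) \<bullet>\<^bsub>V\<^esub> f = \<delta> f"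
    and left: "\<And>f. f \<in> Arr V \<Longrightarrow> (Id G x \<odot>\<^sub>m f) \<bullet>\<^bsub>V\<^esub> \<gamma> (Dom V f) = \<delta> f"
  shows "restrict \<gamma> (Obj V) \<in> char_carrier x"
  using assms by (intro char_carrierI) simp_all

lemma zero_in_char_carrier:
  "x \<in> Obj G \<Longrightarrow> (\<lambda>v\<in>Obj V. zero_arr V v (x \<odot>\<^sub>o v)) \<in> char_carrier x"
  by (rule pointwise_in_char_carrier[where \<delta> = "\<lambda>f. zero_arr V (Dom V f) (x \<odot>\<^sub>o Cod V f)"])
    (simp_all add: V.comp_zero_left V.comp_zero_right
      abelian_groupE(2)[OF module.axioms(2)[OF V.hom_module]] del: V.in_HomSp)

lemma add_in_char_carrier:
  assumes [simp]: "x \<in> Obj G" and \<alpha>: "\<alpha> \<in> char_carrier x" and \<beta>: "\<beta> \<in> char_carrier x"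
  shows "(\<lambda>v\<in>Obj V. \<alpha> v \<oplus>\<^bsub>HomSp V v (x \<odot>\<^sub>o v)\<^esub> \<beta> v) \<in> char_carrier x"
proof (rule pointwise_in_char_carrier[where \<delta> =
      "\<lambda>f. (\<alpha> (Cod V f) \<bullet>\<^bsub>V\<^esub> f) \<oplus>\<^bsub>HomSp V (Dom V f) (x \<odot>\<^sub>o Cod V f)\<^esub> (\<beta> (Cod V f) \<bullet>\<^bsub>V\<^esub> f)"])
  note [simp] = char_carrier_simps[OF \<alpha>] char_carrier_simps[OF \<beta>]
  fix v assume "v \<in> Obj V"
  then show "\<alpha> v \<oplus>\<^bsub>HomSp V v (x \<odot>\<^sub>o v)\<^esub> \<beta> v \<in> carrier (HomSp V v (x \<odot>\<^sub>o v))"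
    by (intro abelian_groupE(1)[OF module.axioms(2)[OF V.hom_module]]) simp_all
next
  note [simp] = char_carrier_simps[OF \<alpha>] char_carrier_simps[OF \<beta>]
  fix f assume [simp]: "f \<in> Arr V"
  show "(\<alpha> (Cod V f) \<oplus>\<^bsub>HomSp V (Cod V f) (x \<odot>\<^sub>o Cod V f)\<^esub> \<beta> (Cod V f)) \<bullet>\<^bsub>V\<^esub> f
    = (\<alpha> (Cod V f) \<bullet>\<^bsub>V\<^esub> f) \<oplus>\<^bsub>HomSp V (Dom V f) (x \<odot>\<^sub>o Cod V f)\<^esub> (\<beta> (Cod V f) \<bullet>\<^bsub>V\<^esub> f)"
    by (rule linear_mapD(2)[OF V.linear_comp_right]) simp_all
  have "(Id G x \<odot>\<^sub>m f) \<bullet>\<^bsub>V\<^esub> (\<alpha> (Dom V f) \<oplus>\<^bsub>HomSp V (Dom V f) (x \<odot>\<^sub>o Dom V f)\<^esub> \<beta> (Dom V f))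
    = ((Id G x \<odot>\<^sub>m f) \<bullet>\<^bsub>V\<^esub> \<alpha> (Dom V f)) \<oplus>\<^bsub>HomSp V (Dom V f) (x \<odot>\<^sub>o Cod V f)\<^esub>
      ((Id G x \<odot>\<^sub>m f) \<bullet>\<^bsub>V\<^esub> \<beta> (Dom V f))"
    by (rule linear_mapD(2)[OF V.linear_comp_left]) simp_all
  then show "(Id G x \<odot>\<^sub>m f) \<bullet>\<^bsub>V\<^esub> (\<alpha> (Dom V f) \<oplus>\<^bsub>HomSp V (Dom V f) (x \<odot>\<^sub>o Dom V f)\<^esub> \<beta> (Dom V f))
    = (\<alpha> (Cod V f) \<bullet>\<^bsub>V\<^esub> f) \<oplus>\<^bsub>HomSp V (Dom V f) (x \<odot>\<^sub>o Cod V f)\<^esub> (\<beta> (Cod V f) \<bullet>\<^bsub>V\<^esub> f)"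
    by (simp add: char_carrier_nat[OF \<alpha>] char_carrier_nat[OF \<beta>])
qed simp

lemma smult_in_char_carrier:
  assumes [simp]: "x \<in> Obj G" "c \<in> carrier K" and \<alpha>: "\<alpha> \<in> char_carrier x"
  shows "(\<lambda>v\<in>Obj V. c \<odot>\<^bsub>HomSp V v (x \<odot>\<^sub>o v)\<^esub> \<alpha> v) \<in> char_carrier x"
proof (rule pointwise_in_char_carrier[where \<delta> =
      "\<lambda>f. c \<odot>\<^bsub>HomSp V (Dom V f) (x \<odot>\<^sub>o Cod V f)\<^esub> (\<alpha> (Cod V f) \<bullet>\<^bsub>V\<^esub> f)"])
  note [simp] = char_carrier_simps[OF \<alpha>]
  fix v assume "v \<in> Obj V"
  then show "c \<odot>\<^bsub>HomSp V v (x \<odot>\<^sub>o v)\<^esub> \<alpha> v \<in> carrier (HomSp V v (x \<odot>\<^sub>o v))"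
    by (intro module.smult_closed[OF V.hom_module]) simp_all
next
  note [simp] = char_carrier_simps[OF \<alpha>]
  fix f assume [simp]: "f \<in> Arr V"
  show "(c \<odot>\<^bsub>HomSp V (Cod V f) (x \<odot>\<^sub>o Cod V f)\<^esub> \<alpha> (Cod V f)) \<bullet>\<^bsub>V\<^esub> f
    = c \<odot>\<^bsub>HomSp V (Dom V f) (x \<odot>\<^sub>o Cod V f)\<^esub> (\<alpha> (Cod V f) \<bullet>\<^bsub>V\<^esub> f)"
    by (rule linear_mapD(3)[OF V.linear_comp_right]) simp_all
  have "(Id G x \<odot>\<^sub>m f) \<bullet>\<^bsub>V\<^esub> (c \<odot>\<^bsub>HomSp V (Dom V f) (x \<odot>\<^sub>o Dom V f)\<^esub> \<alpha> (Dom V f))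
    = c \<odot>\<^bsub>HomSp V (Dom V f) (x \<odot>\<^sub>o Cod V f)\<^esub> ((Id G x \<odot>\<^sub>m f) \<bullet>\<^bsub>V\<^esub> \<alpha> (Dom V f))"
    by (rule linear_mapD(3)[OF V.linear_comp_left]) simp_all
  then show "(Id G x \<odot>\<^sub>m f) \<bullet>\<^bsub>V\<^esub> (c \<odot>\<^bsub>HomSp V (Dom V f) (x \<odot>\<^sub>o Dom V f)\<^esub> \<alpha> (Dom V f))
    = c \<odot>\<^bsub>HomSp V (Dom V f) (x \<odot>\<^sub>o Cod V f)\<^esub> (\<alpha> (Cod V f) \<bullet>\<^bsub>V\<^esub> f)"
    by (simp add: char_carrier_nat[OF \<alpha>])
qed simp

lemma module_\<chi>:
  assumes x [simp]: "x \<in> Obj G"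
  shows "module K (\<chi> x)"
proof -
  have H: "module K (HomSp V v (x \<odot>\<^sub>o v))" if "v \<in> Obj V" for v
    using that by (intro V.hom_module) simp_all
  note A = abelian_groupE[OF module.axioms(2)[OF H]]
  note in_H = char_carrier_HomSp[OF _ x]
  note closed = add_in_char_carrier[OF x] smult_in_char_carrier[OF x] zero_in_char_carrier[OF x]
  have cK: "cring K" using module.axioms(1)[OF H] V.K.is_cring by blast
  \<comment> \<open>Negatives are taken as multiples by minus one, which are already known to be
    natural.\<close>
  have neg: "(\<ominus>\<^bsub>K\<^esub> \<one>\<^bsub>K\<^esub>) \<odot>\<^bsub>\<chi> x\<^esub> \<alpha> \<oplus>\<^bsub>\<chi> x\<^esub> \<alpha> = \<zero>\<^bsub>\<chi> x\<^esub>"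
    if \<alpha>: "\<alpha> \<in> char_carrier x" for \<alpha>
  proof -
    have "(\<ominus>\<^bsub>K\<^esub> \<one>\<^bsub>K\<^esub>) \<odot>\<^bsub>HomSp V v (x \<odot>\<^sub>o v)\<^esub> \<alpha> v \<oplus>\<^bsub>HomSp V v (x \<odot>\<^sub>o v)\<^esub> \<alpha> v
      = zero_arr V v (x \<odot>\<^sub>o v)" if v: "v \<in> Obj V" for v
    proof -
      interpret Hv: module K "HomSp V v (x \<odot>\<^sub>o v)" by (rule H[OF v])
      show ?thesis
        using in_H[OF \<alpha> v] by (simp add: Hv.smult_l_minus Hv.M.l_neg del: V.in_HomSp)
    qed
    then show ?thesis by (auto intro!: restrict_ext)
  qed
  show ?thesis
  proof (rule moduleI[OF cK abelian_groupI])
    fix \<alpha> assume "\<alpha> \<in> carrier (\<chi> x)"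
    then have \<alpha>: "\<alpha> \<in> char_carrier x" by simp
    show "\<exists>\<beta>\<in>carrier (\<chi> x). \<beta> \<oplus>\<^bsub>\<chi> x\<^esub> \<alpha> = \<zero>\<^bsub>\<chi> x\<^esub>"
      using neg[OF \<alpha>] closed(2)[OF V.K.a_inv_closed[OF V.K.one_closed] \<alpha>]
      by (intro bexI[of _ "(\<ominus>\<^bsub>K\<^esub> \<one>\<^bsub>K\<^esub>) \<odot>\<^bsub>\<chi> x\<^esub> \<alpha>"]) simp_all
    show "\<zero>\<^bsub>\<chi> x\<^esub> \<oplus>\<^bsub>\<chi> x\<^esub> \<alpha> = \<alpha>"
      by (rule char_carrier_eqI[OF _ \<alpha>])
        (use closed(1)[OF closed(3) \<alpha>] A(5)[OF _ in_H[OF \<alpha>]] in simp_all)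
    show "\<one>\<^bsub>K\<^esub> \<odot>\<^bsub>\<chi> x\<^esub> \<alpha> = \<alpha>"
      by (rule char_carrier_eqI[OF _ \<alpha>])
        (use closed(2)[OF V.K.one_closed \<alpha>] module.smult_one[OF H in_H[OF \<alpha>]] in simp_all)
    fix \<beta> assume "\<beta> \<in> carrier (\<chi> x)"
    then have \<beta>: "\<beta> \<in> char_carrier x" by simp
    show "\<alpha> \<oplus>\<^bsub>\<chi> x\<^esub> \<beta> \<in> carrier (\<chi> x)"
      using closed(1)[OF \<alpha> \<beta>] by simp
    show "\<alpha> \<oplus>\<^bsub>\<chi> x\<^esub> \<beta> = \<beta> \<oplus>\<^bsub>\<chi> x\<^esub> \<alpha>"
      using A(4)[OF _ in_H[OF \<alpha>] in_H[OF \<beta>]] by (auto intro!: restrict_ext)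
    fix \<gamma> assume "\<gamma> \<in> carrier (\<chi> x)"
    then have \<gamma>: "\<gamma> \<in> char_carrier x" by simp
    show "\<alpha> \<oplus>\<^bsub>\<chi> x\<^esub> \<beta> \<oplus>\<^bsub>\<chi> x\<^esub> \<gamma> = \<alpha> \<oplus>\<^bsub>\<chi> x\<^esub> (\<beta> \<oplus>\<^bsub>\<chi> x\<^esub> \<gamma>)"
      using A(3)[OF _ in_H[OF \<alpha>] in_H[OF \<beta>] in_H[OF \<gamma>]] by (auto intro!: restrict_ext)
  next
    show "\<zero>\<^bsub>\<chi> x\<^esub> \<in> carrier (\<chi> x)" using closed(3) by simp
  next
    fix a \<alpha> assume a: "a \<in> carrier K" and "\<alpha> \<in> carrier (\<chi> x)"
    then have \<alpha>: "\<alpha> \<in> char_carrier x" by simp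
    show "a \<odot>\<^bsub>\<chi> x\<^esub> \<alpha> \<in> carrier (\<chi> x)" using closed(2)[OF a \<alpha>] by simp
    {
      fix b assume b: "b \<in> carrier K"
      show "(a \<oplus>\<^bsub>K\<^esub> b) \<odot>\<^bsub>\<chi> x\<^esub> \<alpha> = a \<odot>\<^bsub>\<chi> x\<^esub> \<alpha> \<oplus>\<^bsub>\<chi> x\<^esub> b \<odot>\<^bsub>\<chi> x\<^esub> \<alpha>"
        using module.smult_l_distr[OF H a b in_H[OF \<alpha>]] by (auto intro!: restrict_ext)
      show "(a \<otimes>\<^bsub>K\<^esub> b) \<odot>\<^bsub>\<chi> x\<^esub> \<alpha> = a \<odot>\<^bsub>\<chi> x\<^esub> (b \<odot>\<^bsub>\<chi> x\<^esub> \<alpha>)"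
        using module.smult_assoc1[OF H a b in_H[OF \<alpha>]] by (auto intro!: restrict_ext)
    }
    fix \<beta> assume "\<beta> \<in> carrier (\<chi> x)"
    then have \<beta>: "\<beta> \<in> char_carrier x" by simp
    show "a \<odot>\<^bsub>\<chi> x\<^esub> (\<alpha> \<oplus>\<^bsub>\<chi> x\<^esub> \<beta>) = a \<odot>\<^bsub>\<chi> x\<^esub> \<alpha> \<oplus>\<^bsub>\<chi> x\<^esub> a \<odot>\<^bsub>\<chi> x\<^esub> \<beta>"
      using module.smult_r_distr[OF H a in_H[OF \<alpha>] in_H[OF \<beta>]] by (auto intro!: restrict_ext)
  qed
qed

text \<open>Naturality carries vanishing along an isomorphism and, through the inclusions of the
  summands, to direct sums.\<close>

lemma char_carrier_zero_if_zero_on_simples: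
  assumes x [simp]: "x \<in> Obj G" and \<alpha>: "\<alpha> \<in> char_carrier x"
    and S: "\<And>s. simple_object V s \<Longrightarrow> \<exists>t \<in> S. simple_object V t \<and> Iso V s t \<noteq> {}"
    and zero: "\<And>t. \<lbrakk>t \<in> S; simple_object V t\<rbrakk> \<Longrightarrow> \<alpha> t = zero_arr V t (x \<odot>\<^sub>o t)"
    and v [simp]: "v \<in> Obj V"
  shows "\<alpha> v = zero_arr V v (x \<odot>\<^sub>o v)"
proof -
  note [simp] = char_carrier_simps[OF \<alpha>]
  have simple: "\<alpha> s = zero_arr V s (x \<odot>\<^sub>o s)" if s: "simple_object V s" for s
  proof -
    obtain t i where t: "t \<in> S" "simple_object V t" and "i \<in> Iso V s t"
      using S[OF s] by blast
    then have i: "iso_arr V i" "Dom V i = s" "Cod V i = t"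
      by (simp_all add: Iso_iff)
    have [simp]: "s \<in> Obj V" "t \<in> Obj V" "i \<in> Arr V"
      using s t i by (auto simp: simple_object_def V.iso_arr_arr)
    have "\<alpha> s = (inv_arr V (Id G x \<odot>\<^sub>m i)) \<bullet>\<^bsub>V\<^esub> (Id G x \<odot>\<^sub>m i) \<bullet>\<^bsub>V\<^esub> \<alpha> s"
      using i by (simp add: act_interchange')
    also have "\<dots> = (inv_arr V (Id G x \<odot>\<^sub>m i)) \<bullet>\<^bsub>V\<^esub> \<alpha> t \<bullet>\<^bsub>V\<^esub> i"
      using i by (simp add: char_carrier_nat[OF \<alpha>])
    also have "\<dots> = zero_arr V s (x \<odot>\<^sub>o s)"
      using i by (simp add: zero t V.comp_zero_right[of "x \<odot>\<^sub>o t" i s t]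
          V.comp_zero_left[of s _ "x \<odot>\<^sub>o t" "x \<odot>\<^sub>o s"])
    finally show ?thesis .
  qed
  obtain n s where s: "\<forall>i<n. simple_object V (s i)" and "direct_sum V n s v"
    using V.semisimple[OF v] by blast
  then obtain \<iota> \<pi> where hom: "\<And>i. i < n \<Longrightarrow> \<iota> i \<in> Hom V (s i) v" "\<And>i. i < n \<Longrightarrow> \<pi> i \<in> Hom V v (s i)"
    and id: "Id V v = (\<Oplus>\<^bsub>HomSp V v v\<^esub>i\<in>{..<n}. \<iota> i \<bullet>\<^bsub>V\<^esub> \<pi> i)"
    unfolding direct_sum_def by blast
  let ?H = "HomSp V v v"
  have mH: "module K ?H" "module K (HomSp V v (x \<odot>\<^sub>o v))" by (simp_all add: V.hom_module)
  interpret H: module K ?H by (rule mH)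
  have lin: "linear_map K ?H (HomSp V v (x \<odot>\<^sub>o v)) (\<lambda>f. \<alpha> v \<bullet>\<^bsub>V\<^esub> f)"
    by (rule V.linear_comp_left) simp_all
  \<comment> \<open>The endomorphisms of \<open>v\<close> annihilated by \<open>\<alpha> v\<close>.
    They form a subspace containing every summand of the decomposition of the identity, hence the
    identity itself.\<close>
  let ?N = "{f \<in> carrier ?H. \<alpha> v \<bullet>\<^bsub>V\<^esub> f = zero_arr V v (x \<odot>\<^sub>o v)}"
  have N: "submodule ?N K ?H" by (rule submodule_kernel[OF mH lin])
  have summand: "\<iota> i \<bullet>\<^bsub>V\<^esub> \<pi> i \<in> ?N" if "i < n" for i
  proof -
    have [simp]: "s i \<in> Obj V" "\<iota> i \<in> Arr V" "Dom V (\<iota> i) = s i" "Cod V (\<iota> i) = v"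
      "\<pi> i \<in> Arr V" "Dom V (\<pi> i) = v" "Cod V (\<pi> i) = s i"
      using hom[OF that] s that by (auto simp: hom_iff simple_object_def)
    have "\<alpha> v \<bullet>\<^bsub>V\<^esub> \<iota> i \<bullet>\<^bsub>V\<^esub> \<pi> i = (Id G x \<odot>\<^sub>m \<iota> i) \<bullet>\<^bsub>V\<^esub> \<alpha> (s i) \<bullet>\<^bsub>V\<^esub> \<pi> i"
      using V.comp_extend[OF char_carrier_nat[OF \<alpha>, of "\<iota> i" v], of "\<pi> i"] by simp
    also have "\<dots> = zero_arr V v (x \<odot>\<^sub>o v)"
      using s that by (simp add: simple V.comp_zero_right[of "x \<odot>\<^sub>o s i" "\<pi> i" v "s i"]
          V.comp_zero_left[of v _ "x \<odot>\<^sub>o s i" "x \<odot>\<^sub>o v"])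
    finally show ?thesis by simp
  qed
  have "(\<Oplus>\<^bsub>?H\<^esub>i\<in>J. \<iota> i \<bullet>\<^bsub>V\<^esub> \<pi> i) \<in> ?N" if "finite J" "J \<subseteq> {..<n}" for J
    using that
  proof (induction J rule: finite_induct)
    case empty
    then show ?case using H.submodule_zero[OF N] by simp
  next
    case (insert j J)
    have "(\<Oplus>\<^bsub>?H\<^esub>i\<in>insert j J. \<iota> i \<bullet>\<^bsub>V\<^esub> \<pi> i)
      = (\<iota> j \<bullet>\<^bsub>V\<^esub> \<pi> j) \<oplus>\<^bsub>?H\<^esub> (\<Oplus>\<^bsub>?H\<^esub>i\<in>J. \<iota> i \<bullet>\<^bsub>V\<^esub> \<pi> i)"
      by (rule H.M.finsum_insert) (use insert summand in auto)
    then show ?case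
      using H.submoduleE(5)[OF N, of "\<iota> j \<bullet>\<^bsub>V\<^esub> \<pi> j"] insert summand by auto
  qed
  from this[of "{..<n}"] have "Id V v \<in> ?N" unfolding id by simp
  then show ?thesis by simp
qed

lemma finite_dimensional_\<chi>:
  assumes x [simp]: "x \<in> Obj G"
  shows "finite_dimensional K (\<chi> x)"
proof -
  obtain S where "finite S"
    and S: "\<And>s. simple_object V s \<Longrightarrow> \<exists>t \<in> S. simple_object V t \<and> Iso V s t \<noteq> {}"
    using V.finitely_many_simples by blast
  \<comment> \<open>\<open>S\<close> only has to contain a simple representative of each isomorphism
    class of simples; its other elements need not be objects of \<open>V\<close>, hence the
    restriction to simple ones.\<close>
  have obj: "t \<in> Obj V" if "t \<in> {t \<in> S. simple_object V t}" for t
    using that by (simp add: simple_object_def)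
  show ?thesis
  proof (rule finite_dimensional_if_separated[where I = "{t \<in> S. simple_object V t}"
        and B = "\<lambda>t. HomSp V t (x \<odot>\<^sub>o t)" and f = "\<lambda>t \<alpha>. \<alpha> t"])
    show "field K" ..
    show "module K (\<chi> x)" by (rule module_\<chi>[OF x])
    show "finite {t \<in> S. simple_object V t}" using \<open>finite S\<close> by simp
  next
    fix t assume t: "t \<in> {t \<in> S. simple_object V t}"
    show "module K (HomSp V t (x \<odot>\<^sub>o t))" "finite_dimensional K (HomSp V t (x \<odot>\<^sub>o t))"
      using obj[OF t] by (simp_all add: V.hom_module V.hom_finite_dimensional)
    show "linear_map K (\<chi> x) (HomSp V t (x \<odot>\<^sub>o t)) (\<lambda>\<alpha>. \<alpha> t)"
      using obj[OF t] char_carrier_simps[of _ x t] by (auto simp: linear_map_def)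
  next
    fix \<alpha> assume "\<alpha> \<in> carrier (\<chi> x)"
      and "\<And>t. t \<in> {t \<in> S. simple_object V t} \<Longrightarrow> \<alpha> t = zero_arr V t (x \<odot>\<^sub>o t)"
    then show "\<alpha> = \<zero>\<^bsub>\<chi> x\<^esub>"
      using char_carrier_zero_if_zero_on_simples[OF x _ S, of \<alpha>] zero_in_char_carrier[OF x]
      by (intro char_carrier_eqI[of \<alpha> x]) auto
  qed
qed

end

section \<open>Functoriality of the 2-character\<close>

context two_rep_with_duals
begin

lemma \<chi>_obj [simp]: "x \<in> Obj G \<Longrightarrow> \<chi> x \<in> Obj (Vec K)"
  by (simp add: module_\<chi> finite_dimensional_\<chi>)

text \<open>The common shape of the action of an arrow and of the conjugation maps: the new
  component at \<open>v\<close> is a linear function of a single old component, at an object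
  \<open>w\<close>. It is applied with \<open>w = v\<close> to the former and with
  \<open>w = Dual G g \<odot> v\<close> to the latter.\<close>

lemma post_comp_linear:
  assumes [simp]: "x \<in> Obj G" "y \<in> Obj G"
    and lin: "\<And>v. v \<in> Obj V \<Longrightarrow> \<exists>w \<in> Obj V.
      linear_map K (HomSp V w (x \<odot>\<^sub>o w)) (HomSp V v (y \<odot>\<^sub>o v)) (\<Phi> v) \<and> (\<forall>\<alpha>. \<Theta> \<alpha> v = \<Phi> v (\<alpha> w))"
    and nat: "\<And>\<alpha>. \<alpha> \<in> char_carrier x \<Longrightarrow> (\<lambda>v\<in>Obj V. \<Theta> \<alpha> v) \<in> char_carrier y"
  shows "(\<chi> x, \<lambda>\<alpha>\<in>carrier (\<chi> x). \<lambda>v\<in>Obj V. \<Theta> \<alpha> v, \<chi> y) \<in> Arr (Vec K)"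
proof -
  note closed = add_in_char_carrier smult_in_char_carrier
  have add: "\<Theta> (\<alpha> \<oplus>\<^bsub>\<chi> x\<^esub> \<beta>) v = \<Theta> \<alpha> v \<oplus>\<^bsub>HomSp V v (y \<odot>\<^sub>o v)\<^esub> \<Theta> \<beta> v"
    if v: "v \<in> Obj V" and \<alpha>: "\<alpha> \<in> char_carrier x" and \<beta>: "\<beta> \<in> char_carrier x" for \<alpha> \<beta> v
  proof -
    obtain w where w: "w \<in> Obj V" and l: "linear_map K (HomSp V w (x \<odot>\<^sub>o w)) (HomSp V v (y \<odot>\<^sub>o v)) (\<Phi> v)"
      and eq: "\<And>\<alpha>. \<Theta> \<alpha> v = \<Phi> v (\<alpha> w)" using lin[OF v] by blast
    show ?thesis
      using w linear_mapD(2)[OF l char_carrier_HomSp[OF \<alpha> _ w] char_carrier_HomSp[OF \<beta> _ w]]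
      by (simp add: eq)
  qed
  have smult: "\<Theta> (c \<odot>\<^bsub>\<chi> x\<^esub> \<alpha>) v = c \<odot>\<^bsub>HomSp V v (y \<odot>\<^sub>o v)\<^esub> \<Theta> \<alpha> v"
    if v: "v \<in> Obj V" and \<alpha>: "\<alpha> \<in> char_carrier x" and c: "c \<in> carrier K" for c \<alpha> v
  proof -
    obtain w where w: "w \<in> Obj V" and l: "linear_map K (HomSp V w (x \<odot>\<^sub>o w)) (HomSp V v (y \<odot>\<^sub>o v)) (\<Phi> v)"
      and eq: "\<And>\<alpha>. \<Theta> \<alpha> v = \<Phi> v (\<alpha> w)" using lin[OF v] by blast
    show ?thesis
      using w linear_mapD(3)[OF l c char_carrier_HomSp[OF \<alpha> _ w]] by (simp add: eq)
  qed
  have "linear_map K (\<chi> x) (\<chi> y) (\<lambda>\<alpha>. \<lambda>v\<in>Obj V. \<Theta> \<alpha> v)"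
    unfolding linear_map_def
  proof (intro conjI ballI)
    show "(\<lambda>\<alpha>. \<lambda>v\<in>Obj V. \<Theta> \<alpha> v) \<in> carrier (\<chi> x) \<rightarrow> carrier (\<chi> y)"
      using nat by auto
  qed (use add smult in \<open>auto intro!: restrict_ext\<close>)
  then have "linear_map K (\<chi> x) (\<chi> y) (\<lambda>\<alpha>\<in>carrier (\<chi> x). \<lambda>v\<in>Obj V. \<Theta> \<alpha> v)"
    by (simp only: linear_map_restrict_iff[OF module_\<chi>[OF assms(1)]])
  then show ?thesis
    by (simp add: module_\<chi> finite_dimensional_\<chi>)
qed

lemma two_char_FM_in_char_carrier:
  assumes [simp]: "f \<in> Arr G" and \<alpha>: "\<alpha> \<in> char_carrier (Dom G f)"
  shows "(\<lambda>v\<in>Obj V. (f \<odot>\<^sub>m Id V v) \<bullet>\<^bsub>V\<^esub> \<alpha> v) \<in> char_carrier (Cod G f)"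
proof (rule char_carrierI)
  note [simp] = char_carrier_simps[OF \<alpha>]
  fix \<phi> assume [simp]: "\<phi> \<in> Arr V"
  show "(\<lambda>v\<in>Obj V. (f \<odot>\<^sub>m Id V v) \<bullet>\<^bsub>V\<^esub> \<alpha> v) (Cod V \<phi>) \<bullet>\<^bsub>V\<^esub> \<phi>
    = (Id G (Cod G f) \<odot>\<^sub>m \<phi>) \<bullet>\<^bsub>V\<^esub> (\<lambda>v\<in>Obj V. (f \<odot>\<^sub>m Id V v) \<bullet>\<^bsub>V\<^esub> \<alpha> v) (Dom V \<phi>)"
    by (simp add: char_carrier_nat[OF \<alpha>] act_interchange')
qed (use char_carrier_simps[OF \<alpha>] in auto)

lemma two_char_simps [simp]:
  "FO (two_char G V M) = \<chi>"
  "FM (two_char G V M) f = (\<chi> (Dom G f),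
    \<lambda>\<alpha>\<in>char_carrier (Dom G f). \<lambda>v\<in>Obj V. (f \<odot>\<^sub>m Id V v) \<bullet>\<^bsub>V\<^esub> \<alpha> v, \<chi> (Cod G f))"
  by (simp_all add: two_char_def)

lemma two_char_FM_arr:
  assumes [simp]: "f \<in> Arr G"
  shows "FM (two_char G V M) f \<in> Arr (Vec K)"
  unfolding two_char_simps \<chi>_simps(1)[symmetric]
proof (rule post_comp_linear[where \<Phi> = "\<lambda>v t. (f \<odot>\<^sub>m Id V v) \<bullet>\<^bsub>V\<^esub> t"])
  fix v assume [simp]: "v \<in> Obj V"
  have "linear_map K (HomSp V v (Dom G f \<odot>\<^sub>o v)) (HomSp V v (Cod G f \<odot>\<^sub>o v)) (\<lambda>t. (f \<odot>\<^sub>m Id V v) \<bullet>\<^bsub>V\<^esub> t)"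
    by (rule V.linear_comp_left) simp_all
  then show "\<exists>w\<in>Obj V. linear_map K (HomSp V w (Dom G f \<odot>\<^sub>o w)) (HomSp V v (Cod G f \<odot>\<^sub>o v))
      (\<lambda>t. (f \<odot>\<^sub>m Id V v) \<bullet>\<^bsub>V\<^esub> t)
      \<and> (\<forall>\<alpha>. (f \<odot>\<^sub>m Id V v) \<bullet>\<^bsub>V\<^esub> \<alpha> v = (f \<odot>\<^sub>m Id V v) \<bullet>\<^bsub>V\<^esub> \<alpha> w)"
    by (intro bexI[of _ v]) simp_all
qed (use two_char_FM_in_char_carrier in simp_all)

lemma char_carrier_ext: "\<alpha> \<in> char_carrier x \<Longrightarrow> restrict \<alpha> (Obj V) = \<alpha>"
  by (auto simp: NatTrans_def PiE_def extensional_restrict)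

lemma two_char_FM_id:
  "\<lbrakk>x \<in> Obj G; \<alpha> \<in> char_carrier x\<rbrakk> \<Longrightarrow> (\<lambda>w\<in>Obj V. (Id G x \<odot>\<^sub>m Id V w) \<bullet>\<^bsub>V\<^esub> \<alpha> w) = \<alpha>"
  using char_carrier_ext[of \<alpha> x] char_carrier_simps[of \<alpha> x] by (simp cong: restrict_cong)

lemma two_char_functor: "cat_functor G (Vec K) (two_char G V M)"
proof -
  interpret Vec: category "Vec K" by (rule category_Vec)
  show ?thesis
  proof
    fix x assume "x \<in> Obj G"
    then show "FO (two_char G V M) x \<in> Obj (Vec K)" by (simp del: Vec_simps)
  next
    fix f x y assume "f \<in> Hom G x y"
    then show "FM (two_char G V M) f \<in> Hom (Vec K) (FO (two_char G V M) x) (FO (two_char G V M) y)"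
      using two_char_FM_arr[of f] by (auto simp: hom_iff)
  next
    fix x assume [simp]: "x \<in> Obj G"
    show "FM (two_char G V M) (Id G x) = Id (Vec K) (FO (two_char G V M) x)"
      by (auto simp: two_char_FM_id simp del: restrict_apply intro!: restrict_ext)
  next
    fix f g x y z assume f: "f \<in> Hom G x y" and g: "g \<in> Hom G y z"
    then have [simp]: "f \<in> Arr G" "g \<in> Arr G" and eqs: "Dom G f = x" "Cod G f = y" "Dom G g = y" "Cod G g = z"
      by (auto simp: hom_iff)
    have "(\<lambda>v\<in>Obj V. ((g \<bullet>\<^bsub>G\<^esub> f) \<odot>\<^sub>m Id V v) \<bullet>\<^bsub>V\<^esub> \<alpha> v)
      = (\<lambda>v\<in>Obj V. (g \<odot>\<^sub>m Id V v) \<bullet>\<^bsub>V\<^esub> (\<lambda>v\<in>Obj V. (f \<odot>\<^sub>m Id V v) \<bullet>\<^bsub>V\<^esub> \<alpha> v) v)"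
      if \<alpha>: "\<alpha> \<in> char_carrier x" for \<alpha>
      using char_carrier_simps[OF \<alpha>] by (auto intro!: restrict_ext simp: eqs act_comp_left)
    moreover have "(\<lambda>v\<in>Obj V. (f \<odot>\<^sub>m Id V v) \<bullet>\<^bsub>V\<^esub> \<alpha> v) \<in> char_carrier y"
      if "\<alpha> \<in> char_carrier x" for \<alpha>
      using two_char_FM_in_char_carrier[of f] that by (simp add: eqs)
    ultimately show "FM (two_char G V M) (g \<bullet>\<^bsub>G\<^esub> f)
      = FM (two_char G V M) g \<bullet>\<^bsub>Vec K\<^esub> FM (two_char G V M) f"
      by (auto simp: eqs compose_def intro!: restrict_ext)
  qed
qed

sublocale two_char: cat_functor G "Vec K" "two_char G V M"
  by (rule two_char_functor)

section \<open>The conjugation maps: linearity, naturality and conditions (i) and (ii)\<close>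

abbreviation \<psi> :: "'g \<Rightarrow> 'g \<Rightarrow> ('k, 'v \<Rightarrow> 'vm) lin_arr"
  where "\<psi> \<equiv> conj_inv G V M"

abbreviation \<psi>_map :: "'g \<Rightarrow> 'g \<Rightarrow> ('v \<Rightarrow> 'vm) \<Rightarrow> 'v \<Rightarrow> 'vm"
  where "\<psi>_map g x \<alpha> \<equiv> \<lambda>v\<in>Obj V. conj_comp g (Dual G g) (Coev G g) x \<alpha> v"

lemma \<psi>_eq: "\<psi> g x = (\<chi> x, \<lambda>\<alpha>\<in>char_carrier x. \<psi>_map g x \<alpha>, \<chi> (conjO G g x))"
  by (simp add: conj_inv_def conj_inv_component_def conj_comp_def)

lemma conjO_simp [simp]: "\<lbrakk>g \<in> Obj G; x \<in> Obj G\<rbrakk> \<Longrightarrow> conjO G g x \<in> Obj G"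
  by (simp add: conjO_def)

lemma \<psi>_map_in_char_carrier:
  "\<lbrakk>g \<in> Obj G; x \<in> Obj G; \<alpha> \<in> char_carrier x\<rbrakk> \<Longrightarrow> \<psi>_map g x \<alpha> \<in> char_carrier (conjO G g x)"
  unfolding conjO_def by (rule conj_comp_in_char_carrier) simp_all

lemma \<psi>_arr:
  assumes [simp]: "g \<in> Obj G" "x \<in> Obj G"
  shows "\<psi> g x \<in> Arr (Vec K)"
  unfolding \<psi>_eq \<chi>_simps(1)[symmetric]
proof (rule post_comp_linear[where \<Phi> = "\<lambda>v t. inv_arr V (MAssoc M (g \<otimes>\<^sub>o\<^bsub>G\<^esub> x) (Dual G g) v)
    \<bullet>\<^bsub>V\<^esub> inv_arr V (MAssoc M g x (Dual G g \<odot>\<^sub>o v)) \<bullet>\<^bsub>V\<^esub> (Id G g \<odot>\<^sub>m t) \<bullet>\<^bsub>V\<^esub> MAssoc M g (Dual G g) v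
    \<bullet>\<^bsub>V\<^esub> (Coev G g \<odot>\<^sub>m Id V v) \<bullet>\<^bsub>V\<^esub> inv_arr V (MUnit M v)"])
  fix v assume [simp]: "v \<in> Obj V"
  let ?w = "Dual G g \<odot>\<^sub>o v"
  let ?Q = "MAssoc M g (Dual G g) v \<bullet>\<^bsub>V\<^esub> (Coev G g \<odot>\<^sub>m Id V v) \<bullet>\<^bsub>V\<^esub> inv_arr V (MUnit M v)"
  let ?\<Phi> = "\<lambda>t. inv_arr V (MAssoc M (g \<otimes>\<^sub>o\<^bsub>G\<^esub> x) (Dual G g) v)
    \<bullet>\<^bsub>V\<^esub> inv_arr V (MAssoc M g x ?w) \<bullet>\<^bsub>V\<^esub> (Id G g \<odot>\<^sub>m t) \<bullet>\<^bsub>V\<^esub> ?Q"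
  \<comment> \<open>Linearity in \<open>\<alpha>\<close> rests here on the
    \<open>k\<close>-linearity of the functor given by \<open>g\<close>; the other three maps are
    compositions with fixed arrows.\<close>
  have 1: "linear_map K (HomSp V ?w (x \<odot>\<^sub>o ?w)) (HomSp V (g \<odot>\<^sub>o ?w) (g \<odot>\<^sub>o x \<odot>\<^sub>o ?w)) (\<lambda>t. Id G g \<odot>\<^sub>m t)"
    by (rule act_linear) simp_all
  have 2: "linear_map K (HomSp V (g \<odot>\<^sub>o ?w) (g \<odot>\<^sub>o x \<odot>\<^sub>o ?w)) (HomSp V v (g \<odot>\<^sub>o x \<odot>\<^sub>o ?w))
      (\<lambda>t. t \<bullet>\<^bsub>V\<^esub> ?Q)"
    by (rule V.linear_comp_right) simp_all
  have 3: "linear_map K (HomSp V v (g \<odot>\<^sub>o x \<odot>\<^sub>o ?w)) (HomSp V v ((g \<otimes>\<^sub>o\<^bsub>G\<^esub> x) \<odot>\<^sub>o ?w))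
      (\<lambda>t. inv_arr V (MAssoc M g x ?w) \<bullet>\<^bsub>V\<^esub> t)"
    by (rule V.linear_comp_left) simp_all
  have 4: "linear_map K (HomSp V v ((g \<otimes>\<^sub>o\<^bsub>G\<^esub> x) \<odot>\<^sub>o ?w)) (HomSp V v (conjO G g x \<odot>\<^sub>o v))
      (\<lambda>t. inv_arr V (MAssoc M (g \<otimes>\<^sub>o\<^bsub>G\<^esub> x) (Dual G g) v) \<bullet>\<^bsub>V\<^esub> t)"
    by (rule V.linear_comp_left) (simp_all add: conjO_def)
  have "linear_map K (HomSp V ?w (x \<odot>\<^sub>o ?w)) (HomSp V v (conjO G g x \<odot>\<^sub>o v)) ?\<Phi>"
    by (rule linear_map_compose[OF linear_map_compose[OF linear_map_compose[OF 1 2] 3] 4])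
  then show "\<exists>w\<in>Obj V. linear_map K (HomSp V w (x \<odot>\<^sub>o w)) (HomSp V v (conjO G g x \<odot>\<^sub>o v)) ?\<Phi>
      \<and> (\<forall>\<alpha>. conj_comp g (Dual G g) (Coev G g) x \<alpha> v = ?\<Phi> (\<alpha> w))"
    by (intro bexI[of _ ?w]) (simp_all add: conj_comp_def)
qed (use \<psi>_map_in_char_carrier in simp_all)

lemma \<psi>_simps [simp]:
  assumes "g \<in> Obj G" "x \<in> Obj G"
  shows "Dom (Vec K) (\<psi> g x) = \<chi> x" "Cod (Vec K) (\<psi> g x) = \<chi> (conjO G g x)"
  by (simp_all add: \<psi>_eq)

lemma conjM_simps [simp]:
  assumes "g \<in> Obj G" "f \<in> Arr G"
  shows "conjM G g f \<in> Arr G" "Dom G (conjM G g f) = conjO G g (Dom G f)"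
    "Cod G (conjM G g f) = conjO G g (Cod G f)"
  using assms by (simp_all add: conjM_def conjO_def)

lemma \<psi>_natural:
  assumes [simp]: "g \<in> Obj G" "f \<in> Arr G"
  shows "FM (two_char G V M) (conjM G g f) \<bullet>\<^bsub>Vec K\<^esub> \<psi> g (Dom G f)
    = \<psi> g (Cod G f) \<bullet>\<^bsub>Vec K\<^esub> FM (two_char G V M) f"
proof -
  have "(conjM G g f \<odot>\<^sub>m Id V v) \<bullet>\<^bsub>V\<^esub> conj_comp g (Dual G g) (Coev G g) (Dom G f) \<alpha> v
    = conj_comp g (Dual G g) (Coev G g) (Cod G f) (\<lambda>w\<in>Obj V. (f \<odot>\<^sub>m Id V w) \<bullet>\<^bsub>V\<^esub> \<alpha> w) v"
    if \<alpha>: "\<alpha> \<in> char_carrier (Dom G f)" and [simp]: "v \<in> Obj V" for \<alpha> v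
    using conj_comp_natural[OF \<alpha>, of "Id G g" "Id G (Dual G g)" "Id V v" "Coev G g"]
      conj_comp_simps[OF two_char_FM_in_char_carrier[OF _ \<alpha>], of g "Dual G g" "Coev G g" v]
    by (simp add: conjM_def)
  then show ?thesis
    using \<psi>_map_in_char_carrier[of g "Dom G f"] two_char_FM_in_char_carrier[of f]
    by (auto simp: \<psi>_eq compose_def intro!: restrict_ext)
qed

text \<open>\<open>conj_tens\<close> is the comparison of duals \<open>?D\<close> followed by the
  rebracketing \<open>?X\<close>. By naturality \<open>?D\<close> replaces the chosen coevaluation
  of \<open>g \<otimes> h\<close> with \<open>coev_tens\<close>, and \<open>conj_comp_tens\<close>
  deals with \<open>?X\<close>.\<close>

lemma \<psi>_tens:
  assumes [simp]: "g \<in> Obj G" "h \<in> Obj G" "x \<in> Obj G"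
  shows "\<psi> g (conjO G h x) \<bullet>\<^bsub>Vec K\<^esub> \<psi> h x
    = FM (two_char G V M) (conj_tens G g h x) \<bullet>\<^bsub>Vec K\<^esub> \<psi> (g \<otimes>\<^sub>o\<^bsub>G\<^esub> h) x"
proof -
  let ?gh = "g \<otimes>\<^sub>o\<^bsub>G\<^esub> h" and ?p = "Dual G g" and ?q = "Dual G h"
  let ?X = "(Assoc G g (h \<otimes>\<^sub>o\<^bsub>G\<^esub> x) ?q \<otimes>\<^sub>m\<^bsub>G\<^esub> Id G ?p)
      \<bullet>\<^bsub>G\<^esub> ((Assoc G g h x \<otimes>\<^sub>m\<^bsub>G\<^esub> Id G ?q) \<otimes>\<^sub>m\<^bsub>G\<^esub> Id G ?p)
      \<bullet>\<^bsub>G\<^esub> inv_arr G (Assoc G (?gh \<otimes>\<^sub>o\<^bsub>G\<^esub> x) ?q ?p)"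
  let ?D = "Id G (?gh \<otimes>\<^sub>o\<^bsub>G\<^esub> x) \<otimes>\<^sub>m\<^bsub>G\<^esub> dual_tens G g h"
  have X: "conj_tens G g h x = ?X \<bullet>\<^bsub>G\<^esub> ?D"
    by (simp add: conj_tens_def)
  have [simp]: "Dom G (conj_tens G g h x) = conjO G ?gh x"
    "Cod G (conj_tens G g h x) = conjO G g (conjO G h x)"
    by (simp_all add: X conjO_def)
  have "conj_comp g ?p (Coev G g) (conjO G h x) (\<psi>_map h x \<alpha>) v
    = (conj_tens G g h x \<odot>\<^sub>m Id V v) \<bullet>\<^bsub>V\<^esub> conj_comp ?gh (Dual G ?gh) (Coev G ?gh) x \<alpha> v"
    if \<alpha>: "\<alpha> \<in> char_carrier x" and [simp]: "v \<in> Obj V" for \<alpha> v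
  proof -
    note [simp] = conj_comp_simps[OF \<alpha>]
    have "(?D \<odot>\<^sub>m Id V v) \<bullet>\<^bsub>V\<^esub> conj_comp ?gh (Dual G ?gh) (Coev G ?gh) x \<alpha> v
      = conj_comp ?gh (?q \<otimes>\<^sub>o\<^bsub>G\<^esub> ?p) (coev_tens G g h) x \<alpha> v"
      using conj_comp_natural[of \<alpha> "Id G x" "Id G ?gh" "dual_tens G g h" "Id V v" "Coev G ?gh"] \<alpha>
      by (simp add: G.dual_tens_coev char_carrier_ext[OF \<alpha>]
          char_carrier_simps[OF \<alpha>] cong: restrict_cong)
    then show ?thesis
      by (simp add: conj_comp_tens[OF \<alpha>] X act_comp_left)
  qed
  then show ?thesis
    using \<psi>_map_in_char_carrier[of h x] \<psi>_map_in_char_carrier[of ?gh x]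
    by (auto simp: \<psi>_eq compose_def intro!: restrict_ext)
qed

lemma \<psi>_arr_natural:
  assumes [simp]: "a \<in> Arr G" "x \<in> Obj G"
  shows "FM (two_char G V M) ((a \<otimes>\<^sub>m\<^bsub>G\<^esub> Id G x) \<otimes>\<^sub>m\<^bsub>G\<^esub> star_arr G a) \<bullet>\<^bsub>Vec K\<^esub> \<psi> (Dom G a) x
    = \<psi> (Cod G a) x"
proof -
  let ?g = "Dom G a" and ?h = "Cod G a"
  have "(((a \<otimes>\<^sub>m\<^bsub>G\<^esub> Id G x) \<otimes>\<^sub>m\<^bsub>G\<^esub> star_arr G a) \<odot>\<^sub>m Id V v)
      \<bullet>\<^bsub>V\<^esub> conj_comp ?g (Dual G ?g) (Coev G ?g) x \<alpha> v
    = conj_comp ?h (Dual G ?h) (Coev G ?h) x \<alpha> v"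
    if \<alpha>: "\<alpha> \<in> char_carrier x" and [simp]: "v \<in> Obj V" for \<alpha> v
    using conj_comp_natural[of \<alpha> "Id G x" a "star_arr G a" "Id V v" "Coev G ?g"] \<alpha>
    by (simp add: G.star_arr_coev char_carrier_ext[OF \<alpha>] conj_comp_simps[OF \<alpha>]
        char_carrier_simps[OF \<alpha>] cong: restrict_cong)
  then show ?thesis
    using \<psi>_map_in_char_carrier[of ?g x]
    by (auto simp: \<psi>_eq conjO_def compose_def intro!: restrict_ext)
qed

section \<open>Invertibility of the conjugation maps\<close>

lemma bij_betw_char_carrier:
  assumes [simp]: "x \<in> Obj G" "y \<in> Obj G"
    and T: "\<And>v. v \<in> Obj V \<Longrightarrow> iso_arr V (T v) \<and> Dom V (T v) = x \<odot>\<^sub>o v \<and> Cod V (T v) = y \<odot>\<^sub>o v"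
    and nat: "\<And>f. f \<in> Arr V \<Longrightarrow> T (Cod V f) \<bullet>\<^bsub>V\<^esub> (Id G x \<odot>\<^sub>m f) = (Id G y \<odot>\<^sub>m f) \<bullet>\<^bsub>V\<^esub> T (Dom V f)"
  shows "bij_betw (\<lambda>\<alpha>\<in>char_carrier x. \<lambda>v\<in>Obj V. T v \<bullet>\<^bsub>V\<^esub> \<alpha> v) (char_carrier x) (char_carrier y)"
proof -
  have [simp]: "iso_arr V (T v)" "T v \<in> Arr V" "Dom V (T v) = x \<odot>\<^sub>o v" "Cod V (T v) = y \<odot>\<^sub>o v"
    if "v \<in> Obj V" for v
    using T[OF that] by (auto simp: V.iso_arr_arr)
  have fwd: "(\<lambda>v\<in>Obj V. T v \<bullet>\<^bsub>V\<^esub> \<alpha> v) \<in> char_carrier y" if \<alpha>: "\<alpha> \<in> char_carrier x" for \<alpha>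
    using char_carrier_simps[OF \<alpha>]
    by (intro char_carrierI) (simp_all add: char_carrier_nat[OF \<alpha>] V.comp_extend[OF nat])
  have bwd: "(\<lambda>v\<in>Obj V. inv_arr V (T v) \<bullet>\<^bsub>V\<^esub> \<beta> v) \<in> char_carrier x"
    if \<beta>: "\<beta> \<in> char_carrier y" for \<beta>
  proof (rule char_carrierI)
    note [simp] = char_carrier_simps[OF \<beta>]
    fix f assume [simp]: "f \<in> Arr V"
    have "inv_arr V (T (Cod V f)) \<bullet>\<^bsub>V\<^esub> (Id G y \<odot>\<^sub>m f) = (Id G x \<odot>\<^sub>m f) \<bullet>\<^bsub>V\<^esub> inv_arr V (T (Dom V f))"
      by (rule V.inv_square[OF nat]) simp_all
    from V.comp_extend[OF this]
    show "(\<lambda>v\<in>Obj V. inv_arr V (T v) \<bullet>\<^bsub>V\<^esub> \<beta> v) (Cod V f) \<bullet>\<^bsub>V\<^esub> f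
      = (Id G x \<odot>\<^sub>m f) \<bullet>\<^bsub>V\<^esub> (\<lambda>v\<in>Obj V. inv_arr V (T v) \<bullet>\<^bsub>V\<^esub> \<beta> v) (Dom V f)"
      by (simp add: char_carrier_nat[OF \<beta>])
  qed (use char_carrier_simps[OF \<beta>] in simp_all)
  show ?thesis
  proof (rule bij_betw_byWitness[where f' = "\<lambda>\<beta>. \<lambda>v\<in>Obj V. inv_arr V (T v) \<bullet>\<^bsub>V\<^esub> \<beta> v"])
    show "\<forall>\<alpha>\<in>char_carrier x. (\<lambda>v\<in>Obj V. inv_arr V (T v)
        \<bullet>\<^bsub>V\<^esub> (\<lambda>\<alpha>\<in>char_carrier x. \<lambda>v\<in>Obj V. T v \<bullet>\<^bsub>V\<^esub> \<alpha> v) \<alpha> v) = \<alpha>"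
      using char_carrier_simps[of _ x] by (auto simp: char_carrier_ext cong: restrict_cong)
    show "\<forall>\<beta>\<in>char_carrier y. (\<lambda>\<alpha>\<in>char_carrier x. \<lambda>v\<in>Obj V. T v \<bullet>\<^bsub>V\<^esub> \<alpha> v)
        (\<lambda>v\<in>Obj V. inv_arr V (T v) \<bullet>\<^bsub>V\<^esub> \<beta> v) = \<beta>"
      using char_carrier_simps[of _ y] bwd by (auto simp: char_carrier_ext cong: restrict_cong)
  qed (use fwd bwd in auto)
qed

text \<open>For \<open>g = e\<close> the component of \<open>\<psi>\<close> is \<open>\<alpha>\<^sub>v\<close> followed by a natural isomorphism: naturality of
  \<open>\<alpha>\<close> along \<open>v \<simeq> e \<odot> (e\<^sup>* \<odot> v) \<simeq> e\<^sup>* \<odot> v\<close> moves this isomorphism past \<open>\<alpha>\<close>.\<close>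

lemma \<psi>_unit_iso:
  assumes [simp]: "x \<in> Obj G"
  shows "iso_arr (Vec K) (\<psi> (Unit G) x)"
proof -
  let ?e = "Unit G"
  let ?d = "Dual G ?e"
  \<comment> \<open>\<open>MUnit\<close> and its inverse are inserted around the unit object acting
    on \<open>\<alpha>\<close>: the inverse goes into \<open>A\<close>, after
    \<open>\<alpha>\<close>, and \<open>MUnit\<close> goes into \<open>j\<close>, before it. The
    conjugation becomes \<open>A\<close>, then plain \<open>\<alpha>\<close> in the middle, then
    \<open>j\<close>.\<close>
  define A where "A v = inv_arr V (MAssoc M (?e \<otimes>\<^sub>o\<^bsub>G\<^esub> x) ?d v) \<bullet>\<^bsub>V\<^esub> inv_arr V (MAssoc M ?e x (?d \<odot>\<^sub>o v))
    \<bullet>\<^bsub>V\<^esub> inv_arr V (MUnit M (x \<odot>\<^sub>o ?d \<odot>\<^sub>o v))" for v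
  define j where "j v = MUnit M (?d \<odot>\<^sub>o v) \<bullet>\<^bsub>V\<^esub> MAssoc M ?e ?d v \<bullet>\<^bsub>V\<^esub> (Coev G ?e \<odot>\<^sub>m Id V v)
    \<bullet>\<^bsub>V\<^esub> inv_arr V (MUnit M v)" for v
  have A [simp]: "iso_arr V (A v)" "A v \<in> Arr V" "Dom V (A v) = x \<odot>\<^sub>o ?d \<odot>\<^sub>o v"
    "Cod V (A v) = ((?e \<otimes>\<^sub>o\<^bsub>G\<^esub> x) \<otimes>\<^sub>o\<^bsub>G\<^esub> ?d) \<odot>\<^sub>o v" if "v \<in> Obj V" for v
    using that by (simp_all add: A_def)
  have j [simp]: "iso_arr V (j v)" "j v \<in> Arr V" "Dom V (j v) = v" "Cod V (j v) = ?d \<odot>\<^sub>o v"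
    if "v \<in> Obj V" for v
    using that by (simp_all add: j_def)
  let ?T = "\<lambda>v. A v \<bullet>\<^bsub>V\<^esub> (Id G x \<odot>\<^sub>m j v)"
  have A_nat: "A (Cod V f) \<bullet>\<^bsub>V\<^esub> (Id G x \<odot>\<^sub>m (Id G ?d \<odot>\<^sub>m f))
      = (Id G ((?e \<otimes>\<^sub>o\<^bsub>G\<^esub> x) \<otimes>\<^sub>o\<^bsub>G\<^esub> ?d) \<odot>\<^sub>m f) \<bullet>\<^bsub>V\<^esub> A (Dom V f)" if [simp]: "f \<in> Arr V" for f
    by (simp add: A_def inv_munit_nat inv_massoc_nat')
  have j_nat: "j (Cod V f) \<bullet>\<^bsub>V\<^esub> f = (Id G ?d \<odot>\<^sub>m f) \<bullet>\<^bsub>V\<^esub> j (Dom V f)" if [simp]: "f \<in> Arr V" for f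
  proof -
    have "j (Cod V f) \<bullet>\<^bsub>V\<^esub> f = MUnit M (?d \<odot>\<^sub>o Cod V f) \<bullet>\<^bsub>V\<^esub> MAssoc M ?e ?d (Cod V f)
        \<bullet>\<^bsub>V\<^esub> ((Id G ?e \<otimes>\<^sub>m\<^bsub>G\<^esub> Id G ?d) \<odot>\<^sub>m f) \<bullet>\<^bsub>V\<^esub> (Coev G ?e \<odot>\<^sub>m Id V (Dom V f))
        \<bullet>\<^bsub>V\<^esub> inv_arr V (MUnit M (Dom V f))"
      by (simp add: j_def inv_munit_nat act_interchange')
    also have "\<dots> = (Id G ?d \<odot>\<^sub>m f) \<bullet>\<^bsub>V\<^esub> j (Dom V f)"
      by (subst massoc_nat') (simp_all add: j_def munit_nat')
    finally show ?thesis .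
  qed
  have eq: "conj_comp ?e ?d (Coev G ?e) x \<alpha> v = ?T v \<bullet>\<^bsub>V\<^esub> \<alpha> v"
    if \<alpha>: "\<alpha> \<in> char_carrier x" and [simp]: "v \<in> Obj V" for \<alpha> v
  proof -
    note [simp] = char_carrier_simps[OF \<alpha>]
    have *: "\<alpha> (?d \<odot>\<^sub>o v) \<bullet>\<^bsub>V\<^esub> MUnit M (?d \<odot>\<^sub>o v)
      = MUnit M (x \<odot>\<^sub>o ?d \<odot>\<^sub>o v) \<bullet>\<^bsub>V\<^esub> (Id G ?e \<odot>\<^sub>m \<alpha> (?d \<odot>\<^sub>o v))"
      by (simp add: munit_nat)
    have "?T v \<bullet>\<^bsub>V\<^esub> \<alpha> v = A v \<bullet>\<^bsub>V\<^esub> \<alpha> (?d \<odot>\<^sub>o v) \<bullet>\<^bsub>V\<^esub> j v"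
      by (simp add: char_carrier_nat[OF \<alpha>])
    also have "\<dots> = conj_comp ?e ?d (Coev G ?e) x \<alpha> v"
      by (simp add: A_def j_def conj_comp_def V.comp_extend[OF *])
    finally have "?T v \<bullet>\<^bsub>V\<^esub> \<alpha> v = conj_comp ?e ?d (Coev G ?e) x \<alpha> v" .
    then show ?thesis by (rule sym)
  qed
  have "bij_betw (\<lambda>\<alpha>\<in>char_carrier x. \<lambda>v\<in>Obj V. ?T v \<bullet>\<^bsub>V\<^esub> \<alpha> v) (char_carrier x) (char_carrier (conjO G ?e x))"
    unfolding conjO_def
  proof (rule bij_betw_char_carrier)
    fix f assume [simp]: "f \<in> Arr V"
    have "?T (Cod V f) \<bullet>\<^bsub>V\<^esub> (Id G x \<odot>\<^sub>m f) = A (Cod V f) \<bullet>\<^bsub>V\<^esub> (Id G x \<odot>\<^sub>m (j (Cod V f) \<bullet>\<^bsub>V\<^esub> f))"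
      by (simp add: act_interchange)
    also have "\<dots> = A (Cod V f) \<bullet>\<^bsub>V\<^esub> (Id G x \<odot>\<^sub>m (Id G ?d \<odot>\<^sub>m f)) \<bullet>\<^bsub>V\<^esub> (Id G x \<odot>\<^sub>m j (Dom V f))"
      by (simp add: j_nat act_comp_right)
    also have "\<dots> = (Id G ((?e \<otimes>\<^sub>o\<^bsub>G\<^esub> x) \<otimes>\<^sub>o\<^bsub>G\<^esub> ?d) \<odot>\<^sub>m f) \<bullet>\<^bsub>V\<^esub> ?T (Dom V f)"
      by (simp add: V.comp_extend[OF A_nat])
    finally show "?T (Cod V f) \<bullet>\<^bsub>V\<^esub> (Id G x \<odot>\<^sub>m f)
      = (Id G ((?e \<otimes>\<^sub>o\<^bsub>G\<^esub> x) \<otimes>\<^sub>o\<^bsub>G\<^esub> ?d) \<odot>\<^sub>m f) \<bullet>\<^bsub>V\<^esub> ?T (Dom V f)" .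
  qed simp_all
  moreover have "(\<lambda>\<alpha>\<in>char_carrier x. \<psi>_map ?e x \<alpha>)
      = (\<lambda>\<alpha>\<in>char_carrier x. \<lambda>v\<in>Obj V. ?T v \<bullet>\<^bsub>V\<^esub> \<alpha> v)"
    by (intro restrict_ext) (use eq in auto)
  ultimately show ?thesis
    using \<psi>_arr[of ?e x] Vec_isoI[of "\<chi> x" _ "\<chi> (conjO G ?e x)" K] by (simp add: \<psi>_eq)
qed

text \<open>By (ii), any arrow from the unit object to \<open>g \<otimes> h\<close> makes the map of
  \<open>g \<otimes> h\<close> an isomorphism, since the map of the unit object is one and functors
  preserve isomorphisms; (i) transfers this to the composite. Allowing any such arrow lets
  \<open>Coev\<close> and the inverse of \<open>Ev\<close> treat both orders of \<open>g\<close> and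
  its dual.\<close>

lemma \<psi>_comp_iso:
  assumes a: "a \<in> Arr G" "Dom G a = Unit G" "Cod G a = g \<otimes>\<^sub>o\<^bsub>G\<^esub> h"
    and [simp]: "g \<in> Obj G" "h \<in> Obj G" "x \<in> Obj G"
  shows "iso_arr (Vec K) (\<psi> g (conjO G h x) \<bullet>\<^bsub>Vec K\<^esub> \<psi> h x)"
proof -
  interpret Vec: category "Vec K" by (rule category_Vec)
  note [simp] = \<psi>_arr
  let ?F = "FM (two_char G V M)"
  have conj_tens [simp]: "conj_tens G g h x \<in> Arr G" "Dom G (conj_tens G g h x) = conjO G (g \<otimes>\<^sub>o\<^bsub>G\<^esub> h) x"
    by (simp_all add: conj_tens_def conjO_def)
  have "iso_arr (Vec K) (?F ((a \<otimes>\<^sub>m\<^bsub>G\<^esub> Id G x) \<otimes>\<^sub>m\<^bsub>G\<^esub> star_arr G a) \<bullet>\<^bsub>Vec K\<^esub> \<psi> (Unit G) x)"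
    using a by (intro Vec.iso_arr_comp \<psi>_unit_iso two_char.functor_iso) (simp_all add: conjO_def)
  then have "iso_arr (Vec K) (\<psi> (g \<otimes>\<^sub>o\<^bsub>G\<^esub> h) x)"
    using \<psi>_arr_natural[OF a(1), of x] a by simp
  then show ?thesis
    unfolding \<psi>_tens[OF assms(4-6)]
    by (intro Vec.iso_arr_comp two_char.functor_iso) simp_all
qed

lemma \<psi>_iso:
  assumes [simp]: "g \<in> Obj G" "x \<in> Obj G"
  shows "iso_arr (Vec K) (\<psi> g x)"
proof -
  interpret Vec: category "Vec K" by (rule category_Vec)
  let ?p = "Dual G g"
  show ?thesis
  \<comment> \<open>The chain is \<open>\<psi>\<close> of \<open>g\<close>, then of its dual, then
    of \<open>g\<close> once more. The last map starts at a different object from the first, so the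
    two composites do not simply exhibit one map as inverse to another.\<close>
  proof (rule Vec.two_of_six)
    show "iso_arr (Vec K) (\<psi> ?p (conjO G g x) \<bullet>\<^bsub>Vec K\<^esub> \<psi> g x)"
      by (rule \<psi>_comp_iso[of "inv_arr G (Ev G g)"]) simp_all
    show "iso_arr (Vec K) (\<psi> g (conjO G ?p (conjO G g x)) \<bullet>\<^bsub>Vec K\<^esub> \<psi> ?p (conjO G g x))"
      by (rule \<psi>_comp_iso[of "Coev G g"]) simp_all
  qed (simp_all add: \<psi>_arr)
qed

lemma class_functor_two_char: "class_functor K G (two_char G V M) \<psi>"
proof
  fix g x assume "g \<in> Obj G" "x \<in> Obj G"
  then show "\<psi> g x \<in> Iso (Vec K) (FO (two_char G V M) x) (FO (two_char G V M) (conjO G g x))"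
    by (simp add: Iso_iff \<psi>_iso)
next
  fix g f x y assume "g \<in> Obj G" "f \<in> Hom G x y"
  then show "FM (two_char G V M) (conjM G g f) \<bullet>\<^bsub>Vec K\<^esub> \<psi> g x
    = \<psi> g y \<bullet>\<^bsub>Vec K\<^esub> FM (two_char G V M) f"
    using \<psi>_natural[of g f] by (auto simp: hom_iff)
next
  fix g h x assume "g \<in> Obj G" "h \<in> Obj G" "x \<in> Obj G"
  then show "\<psi> g (conjO G h x) \<bullet>\<^bsub>Vec K\<^esub> \<psi> h x
    = FM (two_char G V M) (conj_tens G g h x) \<bullet>\<^bsub>Vec K\<^esub> \<psi> (g \<otimes>\<^sub>o\<^bsub>G\<^esub> h) x"
    by (rule \<psi>_tens)
next
  fix a g h x assume "a \<in> Hom G g h" "x \<in> Obj G"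
  then show "FM (two_char G V M) ((a \<otimes>\<^sub>m\<^bsub>G\<^esub> Id G x) \<otimes>\<^sub>m\<^bsub>G\<^esub> star_arr G a) \<bullet>\<^bsub>Vec K\<^esub> \<psi> g x = \<psi> h x"
    using \<psi>_arr_natural[of a x] by (auto simp: hom_iff)
qed

end

theorem theorem4p5:
  fixes K :: "('k, 'r) ring_scheme"
    and G :: "('g, 'gm, 'y) dual_mon_cat_scheme"
    and V :: "('v, 'vm, 'k, 'z) lin_cat_scheme"
    and M :: "('g, 'gm, 'v, 'vm) action"
  assumes "algebraically_closed K"
    and "\<And>n::nat. n > 0 \<Longrightarrow> [n] \<cdot>\<^bsub>K\<^esub> \<one>\<^bsub>K\<^esub> \<noteq> \<zero>\<^bsub>K\<^esub>"
    and "two_group_with_duals G"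
    and "two_rep K G V M"
  shows "(two_char G V M, conj_inv G V M) \<in> Obj (class_functors K G)"
proof -
  interpret G: two_group_with_duals G by fact
  interpret two_rep K G V M by fact
  interpret two_rep_with_duals K G V M ..
  show ?thesis
    using class_functor_two_char by (simp add: class_functors_def)
qed

end
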